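(* Let $n=n_1+\ldots+n_k$ with $n_i\geq 1$, and let $U=diag(F_{n_1},\ldots,F_{n_k})\in U_n$ be the block-diagonal matrix with blocks the Fourier matrices $F_{n_i}$. Then for $G=S_n^+$ we have $\Gamma_U=\mathbb Z_{n_1}*\ldots*\mathbb Z_{n_k}$.
   Context: The Fourier matrix is $F_r=\frac{1}{\sqrt r}(\xi^{ij})_{i,j\in\mathbb Z_r}$ with $\xi=e^{2\pi i/r}$ (in the exponent of $\xi^{ij}$, $i,j$ are the indices). $C(U_n^+)$ is the universal $C^*$-algebra generated by $u_{ij}$, $i,j=1,\ldots,n$, with the relations making $u=(u_{ij})$ and $u^t=(u_{ji})$ unitary, with comultiplication $\Delta(u_{ij})=\sum_ku_{ik}\otimes u_{kj}$. A closed subgroup $G\subset U_n^+$ is given by a surjective morphism of Hopf $C^*$-algebras $C(U_n^+)\to C(G)$ (full and reduced versions being identified; here full versions are meant), and the images of the generators are still denoted $u_{ij}$. For $U$ in the group $U_n$ of unitary $n\times n$ scalar matrices, set $v=UuU^*$; the quotient $C(G)/\langle v_{ij}=0,\ \forall\, i\neq j\rangle$ is cocommutative, generated by the group-like elements $g_i=v_{ii}$, and $\Gamma_U=\langle g_1,\ldots,g_n\rangle$ is the discrete group defined by $C^*(\Gamma_U)=C(G)/\langle v_{ij}=0,\ \forall\, i\neq j\rangle$. The quantum permutation group $S_n^+$ is the closed subgroup of $U_n^+$ for which $C(S_n^+)$ is the universal $C^*$-algebra generated by projections $u_{ij}$, $i,j=1,\ldots,n$, summing to $1$ on each row and each column.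 *)

theory Defs
  imports
    Complex_Main
    "HOL-Algebra.QuotRing"
    "HOL-Algebra.Elementary_Groups"
    "Jordan_Normal_Form.Matrix"
begin

section \<open>Complex *-algebras and C*-algebras, relative to carriers\<close>

record 'a star_alg = "(complex, 'a) module" +
  star :: "'a \<Rightarrow> 'a"

record 'a cstar_alg = "'a star_alg" +
  cnorm :: "'a \<Rightarrow> real"

text \<open>The quotient by a two-sided *-ideal \<open>I\<close>, as the set of cosets. The first five components are
  those of \<^const>\<open>FactRing\<close>.\<close>

definition star_quot :: "('a, 'z) star_alg_scheme \<Rightarrow> 'a set \<Rightarrow> 'a set star_alg" where
  "star_quot A I =
    \<lparr>carrier = a_rcosets\<^bsub>A\<^esub> I, monoid.mult = rcoset_mult A I, one = I +>\<^bsub>A\<^esub> \<one>\<^bsub>A\<^esub>,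
     zero = I, add = set_add A,
     smult = (\<lambda>c X. \<Union>x\<in>X. I +>\<^bsub>A\<^esub> (c \<odot>\<^bsub>A\<^esub> x)),
     star = (\<lambda>X. \<Union>x\<in>X. I +>\<^bsub>A\<^esub> star A x)\<rparr>"

definition cstar_seminorm :: "('a, 'z) star_alg_scheme \<Rightarrow> ('a \<Rightarrow> real) \<Rightarrow> bool" where
  "cstar_seminorm A p \<longleftrightarrow>
    (\<forall>a\<in>carrier A. 0 \<le> p a) \<and>
    (\<forall>a\<in>carrier A. \<forall>b\<in>carrier A. p (a \<oplus>\<^bsub>A\<^esub> b) \<le> p a + p b) \<and>
    (\<forall>c. \<forall>a\<in>carrier A. p (c \<odot>\<^bsub>A\<^esub> a) = cmod c * p a) \<and>
    (\<forall>a\<in>carrier A. \<forall>b\<in>carrier A. p (a \<otimes>\<^bsub>A\<^esub> b) \<le> p a * p b) \<and>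
    (\<forall>a\<in>carrier A. p (star A a \<otimes>\<^bsub>A\<^esub> a) = (p a)\<^sup>2)"


section \<open>Universal C*-algebras\<close>

subsection \<open>The free unital *-algebra on a set\<close>

text \<open>A letter \<open>(x, False)\<close> is the generator \<open>x\<close> and \<open>(x, True)\<close> is its adjoint. An element of the
  free *-algebra is its family of coefficients on words, so multiplication sums over all ways of
  cutting a word in two.\<close>

type_synonym 'g star_word = "('g \<times> bool) list"
type_synonym 'g star_poly = "'g star_word \<Rightarrow> complex"

definition free_star_alg :: "'g set \<Rightarrow> 'g star_poly star_alg" where
  "free_star_alg X =
    \<lparr>carrier = {f. finite {w. f w \<noteq> 0} \<and> (\<forall>w. f w \<noteq> 0 \<longrightarrow> fst ` set w \<subseteq> X)},
     monoid.mult = (\<lambda>f g w. \<Sum>i\<le>length w. f (take i w) * g (drop i w)),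
     one = (\<lambda>w. if w = [] then 1 else 0),
     zero = (\<lambda>w. 0),
     add = (\<lambda>f g w. f w + g w),
     smult = (\<lambda>c f w. c * f w),
     star = (\<lambda>f w. cnj (f (rev (map (\<lambda>(x, s). (x, \<not> s)) w))))\<rparr>"

definition free_gen :: "'g \<Rightarrow> 'g star_poly" where
  "free_gen x = (\<lambda>w. if w = [(x, False)] then 1 else 0)"

subsection \<open>Separation and completion of a *-algebra with respect to a C*-seminorm\<close>

definition cauchy_alg :: "('a, 'z) star_alg_scheme \<Rightarrow> ('a \<Rightarrow> real) \<Rightarrow> (nat \<Rightarrow> 'a) star_alg" where
  "cauchy_alg A p =
    \<lparr>carrier = {x. (\<forall>m. x m \<in> carrier A) \<and>
        (\<forall>e>0. \<exists>N. \<forall>m\<ge>N. \<forall>k\<ge>N. p (x m \<ominus>\<^bsub>A\<^esub> x k) < e)},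
     monoid.mult = (\<lambda>x y m. x m \<otimes>\<^bsub>A\<^esub> y m),
     one = (\<lambda>m. \<one>\<^bsub>A\<^esub>),
     zero = (\<lambda>m. \<zero>\<^bsub>A\<^esub>),
     add = (\<lambda>x y m. x m \<oplus>\<^bsub>A\<^esub> y m),
     smult = (\<lambda>c x m. c \<odot>\<^bsub>A\<^esub> x m),
     star = (\<lambda>x m. star A (x m))\<rparr>"

definition null_seqs :: "('a, 'z) star_alg_scheme \<Rightarrow> ('a \<Rightarrow> real) \<Rightarrow> (nat \<Rightarrow> 'a) set" where
  "null_seqs A p = {x \<in> carrier (cauchy_alg A p). (\<lambda>m. p (x m)) \<longlonglongrightarrow> 0}"

definition completion :: "('a, 'z) star_alg_scheme \<Rightarrow> ('a \<Rightarrow> real) \<Rightarrow> (nat \<Rightarrow> 'a) set cstar_alg" where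
  "completion A p =
    star_alg.extend (star_quot (cauchy_alg A p) (null_seqs A p))
      (cstar_alg.fields (\<lambda>C. THE l. \<exists>x\<in>C. (\<lambda>m. p (x m)) \<longlonglongrightarrow> l))"

definition completion_emb :: "('a, 'z) star_alg_scheme \<Rightarrow> ('a \<Rightarrow> real) \<Rightarrow> 'a \<Rightarrow> (nat \<Rightarrow> 'a) set" where
  "completion_emb A p a = null_seqs A p +>\<^bsub>cauchy_alg A p\<^esub> (\<lambda>m. a)"

subsection \<open>Generators and relations\<close>

text \<open>The universal C*-algebra generated by \<open>X\<close> subject to \<open>r = 0\<close> for \<open>r \<in> R\<close> is the completion
  of the free *-algebra in the largest C*-seminorm that vanishes on \<open>R\<close>. The supremum is meant
  only for relations that bound the C*-seminorms of the generators.\<close>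

definition univ_seminorm :: "'g set \<Rightarrow> 'g star_poly set \<Rightarrow> 'g star_poly \<Rightarrow> real" where
  "univ_seminorm X R a =
    Sup {p a |p. cstar_seminorm (free_star_alg X) p \<and> (\<forall>r\<in>R. p r = 0)}"

definition univ_cstar :: "'g set \<Rightarrow> 'g star_poly set \<Rightarrow> (nat \<Rightarrow> 'g star_poly) set cstar_alg" where
  "univ_cstar X R = completion (free_star_alg X) (univ_seminorm X R)"

definition univ_gen :: "'g set \<Rightarrow> 'g star_poly set \<Rightarrow> 'g \<Rightarrow> (nat \<Rightarrow> 'g star_poly) set" where
  "univ_gen X R x = completion_emb (free_star_alg X) (univ_seminorm X R) (free_gen x)"


section \<open>Quotients of C*-algebras by relations\<close>

definition norm_closed_in :: "('a, 'z) cstar_alg_scheme \<Rightarrow> 'a set \<Rightarrow> bool" where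
  "norm_closed_in A I \<longleftrightarrow>
    (\<forall>x. \<forall>a\<in>carrier A. (\<forall>m. x m \<in> I) \<and> (\<lambda>m. cnorm A (x m \<ominus>\<^bsub>A\<^esub> a)) \<longlonglongrightarrow> 0 \<longrightarrow> a \<in> I)"

definition closed_ideal_gen :: "('a, 'z) cstar_alg_scheme \<Rightarrow> 'a set \<Rightarrow> 'a set" where
  "closed_ideal_gen A S =
    \<Inter>{I. ideal I A \<and> star A ` I \<subseteq> I \<and> norm_closed_in A I \<and> S \<subseteq> I}"

definition cstar_quot :: "('a, 'z) cstar_alg_scheme \<Rightarrow> 'a set \<Rightarrow> 'a set cstar_alg" where
  "cstar_quot A I =
    star_alg.extend (star_quot A I) (cstar_alg.fields (\<lambda>C. Inf (cnorm A ` C)))"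


section \<open>The group \<open>\<Gamma>\<^sub>U\<close>\<close>

text \<open>Here \<open>A = C(G)\<close> with standard generators \<open>u i j\<close>; indices run over \<open>{..<n}\<close>.\<close>

text \<open>The entries of \<open>U u U\<^sup>*\<close>.\<close>

definition spun :: "('a, 'z) cstar_alg_scheme \<Rightarrow> (nat \<Rightarrow> nat \<Rightarrow> 'a) \<Rightarrow> nat \<Rightarrow> complex mat
    \<Rightarrow> nat \<Rightarrow> nat \<Rightarrow> 'a" where
  "spun A u n U i j =
    (\<Oplus>\<^bsub>A\<^esub>k\<in>{..<n}. \<Oplus>\<^bsub>A\<^esub>l\<in>{..<n}. (U $$ (i, k) * cnj (U $$ (j, l))) \<odot>\<^bsub>A\<^esub> u k l)"

definition diag_ideal :: "('a, 'z) cstar_alg_scheme \<Rightarrow> (nat \<Rightarrow> nat \<Rightarrow> 'a) \<Rightarrow> nat \<Rightarrow> complex mat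
    \<Rightarrow> 'a set" where
  "diag_ideal A u n U = closed_ideal_gen A {spun A u n U i j |i j. i < n \<and> j < n \<and> i \<noteq> j}"

definition diag_quot :: "('a, 'z) cstar_alg_scheme \<Rightarrow> (nat \<Rightarrow> nat \<Rightarrow> 'a) \<Rightarrow> nat \<Rightarrow> complex mat
    \<Rightarrow> 'a set cstar_alg" where
  "diag_quot A u n U = cstar_quot A (diag_ideal A u n U)"

definition diag_gen :: "('a, 'z) cstar_alg_scheme \<Rightarrow> (nat \<Rightarrow> nat \<Rightarrow> 'a) \<Rightarrow> nat \<Rightarrow> complex mat
    \<Rightarrow> nat \<Rightarrow> 'a set" where
  "diag_gen A u n U i = diag_ideal A u n U +>\<^bsub>A\<^esub> spun A u n U i i"

text \<open>Inside \<open>C\<^sup>*(\<Gamma>\<^sub>U)\<close>, which is the quotient, \<open>\<Gamma>\<^sub>U\<close> is the group generated by the \<open>g\<^sub>i\<close>. These are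
  unitary, hence units, of the quotient whenever \<open>u\<close> and \<open>U\<close> are unitary.\<close>

definition Gamma :: "('a, 'z) cstar_alg_scheme \<Rightarrow> (nat \<Rightarrow> nat \<Rightarrow> 'a) \<Rightarrow> nat \<Rightarrow> complex mat
    \<Rightarrow> 'a set monoid" where
  "Gamma A u n U = subgroup_generated (units_of (diag_quot A u n U)) (diag_gen A u n U ` {..<n})"


section \<open>The quantum permutation group\<close>

definition magic_relations :: "nat \<Rightarrow> (nat \<times> nat) star_poly set" where
  "magic_relations n =
    (let F = free_star_alg ({..<n} \<times> {..<n}) in
      {free_gen (i, j) \<otimes>\<^bsub>F\<^esub> free_gen (i, j) \<ominus>\<^bsub>F\<^esub> free_gen (i, j) |i j. i < n \<and> j < n} \<union>
      {star F (free_gen (i, j)) \<ominus>\<^bsub>F\<^esub> free_gen (i, j) |i j. i < n \<and> j < n} \<union>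
      {(\<Oplus>\<^bsub>F\<^esub>j\<in>{..<n}. free_gen (i, j)) \<ominus>\<^bsub>F\<^esub> \<one>\<^bsub>F\<^esub> |i. i < n} \<union>
      {(\<Oplus>\<^bsub>F\<^esub>i\<in>{..<n}. free_gen (i, j)) \<ominus>\<^bsub>F\<^esub> \<one>\<^bsub>F\<^esub> |j. j < n})"

definition C_qperm :: "nat \<Rightarrow> (nat \<Rightarrow> (nat \<times> nat) star_poly) set cstar_alg" where
  "C_qperm n = univ_cstar ({..<n} \<times> {..<n}) (magic_relations n)"

definition qperm_gen :: "nat \<Rightarrow> nat \<Rightarrow> nat \<Rightarrow> (nat \<Rightarrow> (nat \<times> nat) star_poly) set" where
  "qperm_gen n i j = univ_gen ({..<n} \<times> {..<n}) (magic_relations n) (i, j)"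


section \<open>Fourier matrices\<close>

definition fourier_mat :: "nat \<Rightarrow> complex mat" where
  "fourier_mat r =
    mat r r (\<lambda>(i, j). exp (2 * of_real pi * \<i> / of_nat r) ^ (i * j) / of_real (sqrt (of_nat r)))"


section \<open>Free products of groups\<close>

definition fp_words :: "'i set \<Rightarrow> ('i \<Rightarrow> ('a, 'z) monoid_scheme) \<Rightarrow> ('i \<times> 'a) list set" where
  "fp_words I G = {w. \<forall>(i, x)\<in>set w. i \<in> I \<and> x \<in> carrier (G i)}"

inductive fp_eq :: "'i set \<Rightarrow> ('i \<Rightarrow> ('a, 'z) monoid_scheme) \<Rightarrow> ('i \<times> 'a) list \<Rightarrow> ('i \<times> 'a) list \<Rightarrow> bool"
  for I :: "'i set" and G :: "'i \<Rightarrow> ('a, 'z) monoid_scheme" where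
  unit: "\<lbrakk>v \<in> fp_words I G; w \<in> fp_words I G; i \<in> I\<rbrakk>
    \<Longrightarrow> fp_eq I G (v @ [(i, \<one>\<^bsub>G i\<^esub>)] @ w) (v @ w)"
| mult: "\<lbrakk>v \<in> fp_words I G; w \<in> fp_words I G; i \<in> I; x \<in> carrier (G i); y \<in> carrier (G i)\<rbrakk>
    \<Longrightarrow> fp_eq I G (v @ [(i, x), (i, y)] @ w) (v @ [(i, x \<otimes>\<^bsub>G i\<^esub> y)] @ w)"
| refl: "w \<in> fp_words I G \<Longrightarrow> fp_eq I G w w"
| sym: "fp_eq I G v w \<Longrightarrow> fp_eq I G w v"
| trans: "\<lbrakk>fp_eq I G v w; fp_eq I G w z\<rbrakk> \<Longrightarrow> fp_eq I G v z"

definition free_product :: "'i set \<Rightarrow> ('i \<Rightarrow> ('a, 'z) monoid_scheme) \<Rightarrow> ('i \<times> 'a) list set monoid" where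
  "free_product I G =
    \<lparr>carrier = fp_words I G // {(v, w). fp_eq I G v w},
     monoid.mult = (\<lambda>X Y. \<Union>v\<in>X. \<Union>w\<in>Y. {z. fp_eq I G (v @ w) z}),
     one = {z. fp_eq I G [] z}\<rparr>"

end

theory Submission
  imports Defs "HOL-Library.Function_Algebras" "HOL-Analysis.L2_Norm"
begin

text \<open>Write \<open>g\<^sub>i\<close> for the diagonal entries of \<open>v = U u U\<^sup>*\<close> and \<open>F\<close> for the free *-algebra on the \<open>u\<^sub>k\<^sub>l\<close>. Where \<open>v\<close>
is diagonal, \<open>u = U\<^sup>* diag(g) U\<close>, so \<open>u\<close> is block-diagonal and each of its blocks is circulant. The
first row of the block of size \<open>r\<close> consists of projections \<open>p\<^sub>0, \<dots>, p\<^bsub>r-1\<^esub>\<close>, which are pairwise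
orthogonal because they occur in a row of a magic unitary, and the \<open>g\<^sub>i\<close> of this block are their
Fourier transforms, \<open>g\<^sub>i = \<Sum>\<^sub>a \<xi>\<^bsup>-ia\<^esup> p\<^sub>a\<close>. Orthogonality turns into \<open>g\<^sub>i g\<^sub>j = g\<^bsub>i+j\<^esub>\<close> (indices modulo \<open>r\<close>,
\<open>block_gen_mult\<close>), and the row sums of \<open>u\<close> into \<open>g\<^sub>0 = 1\<close> (\<open>spun_poly_first\<close>). Hence every block gives
a homomorphism from a cyclic group, and together they give a surjection from the free product onto
the group generated by all \<open>g\<^sub>i\<close>.

For injectivity let \<open>\<lambda>\<close> be the left regular representation of the free product and \<open>\<gamma>\<^sub>i\<close> the element
of the free product that corresponds to \<open>g\<^sub>i\<close>. The operators \<open>U\<^sup>* diag(\<lambda>(\<gamma>)) U\<close> again form a magic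
unitary (\<open>magic_op_idem\<close>, \<open>magic_op_adj\<close>, \<open>magic_op_row_sum\<close>, \<open>magic_op_col_sum\<close>), and spinning them by
\<open>U\<close> returns \<open>diag(\<lambda>(\<gamma>))\<close>. So the quotient represents every word in the \<open>g\<^sub>i\<close> by the corresponding
translation, and a word that is \<open>1\<close> in the quotient is \<open>1\<close> in the free product.

Two points need analysis. That projections with sum \<open>1\<close> are orthogonal is proved for an arbitrary
C*-seminorm on \<open>F\<close> without spectral theory (\<open>projections_sum_1_orthogonal\<close>), and then holds for the
supremum that defines the universal C*-algebra. The regular representation acts on finitely
supported functions only: operator norms on this pre-Hilbert space already form a C*-seminorm
(\<open>opnorm_cstar_seminorm\<close>). Since that seminorm is dominated by the universal one, its kernel in the
completion is a closed *-ideal, and vanishing on the generators of the diagonal ideal forces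
vanishing on all of it (\<open>emb_closed_ideal_gen\<close>).\<close>

section \<open>The free *-algebra\<close>

definition conv :: "('a list \<Rightarrow> complex) \<Rightarrow> ('a list \<Rightarrow> complex) \<Rightarrow> 'a list \<Rightarrow> complex" (infixl "\<star>" 70)
  where "f \<star> g = (\<lambda>w. \<Sum>i\<le>length w. f (take i w) * g (drop i w))"

definition scal :: "complex \<Rightarrow> ('a \<Rightarrow> complex) \<Rightarrow> 'a \<Rightarrow> complex"
  where "scal c f = (\<lambda>w. c * f w)"

definition single :: "'a \<Rightarrow> 'a \<Rightarrow> complex"
  where "single v = (\<lambda>w. if w = v then 1 else 0)"

definition flip :: "'g star_word \<Rightarrow> 'g star_word"
  where "flip w = rev (map (\<lambda>(x, s). (x, \<not> s)) w)"

definition adj :: "'g star_poly \<Rightarrow> 'g star_poly"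
  where "adj f = (\<lambda>w. cnj (f (flip w)))"

definition polys :: "'g set \<Rightarrow> 'g star_poly set"
  where "polys X = {f. finite {w. f w \<noteq> 0} \<and> (\<forall>w. f w \<noteq> 0 \<longrightarrow> fst ` set w \<subseteq> X)}"

text \<open>Sums and multiples of coefficient families are treated as algebra elements and kept whole by the
simplifier. The pointwise rules are collected in \<open>fun_ext_simps\<close>, for the identities that are checked
coefficient by coefficient.\<close>

declare plus_fun_apply [simp del] zero_fun_apply [simp del] minus_apply [simp del] uminus_apply [simp del]

lemma sum_fun_apply: "sum f A x = (\<Sum>i\<in>A. f i x)" for f :: "'i \<Rightarrow> 'a \<Rightarrow> 'b::comm_monoid_add"
  by (induction A rule: infinite_finite_induct) (auto simp: zero_fun_apply plus_fun_apply)

lemma scal_apply: "scal c f x = c * f x"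
  by (simp add: scal_def)

lemmas fun_ext_simps = fun_eq_iff plus_fun_apply zero_fun_apply minus_apply uminus_apply scal_apply

lemma free_star_alg_simps [simp]:
  "carrier (free_star_alg X) = polys X"
  "monoid.mult (free_star_alg X) = (\<star>)"
  "one (free_star_alg X) = single []"
  "zero (free_star_alg X) = 0"
  "add (free_star_alg X) = (+)"
  "smult (free_star_alg X) = scal"
  "star (free_star_alg X) = adj"
  by (simp_all add: free_star_alg_def polys_def conv_def[abs_def] single_def scal_def[abs_def]
      adj_def[abs_def] flip_def zero_fun_def plus_fun_def[abs_def])

lemma free_gen_single: "free_gen x = single [(x, False)]"
  by (simp add: free_gen_def single_def)

lemma flip_flip [simp]: "flip (flip w) = w"
  by (simp add: flip_def rev_map comp_def case_prod_beta)

lemma length_flip [simp]: "length (flip w) = length w"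
  by (simp add: flip_def)

lemma flip_Nil [simp]: "flip [] = []"
  by (simp add: flip_def)

lemma fst_set_flip [simp]: "fst ` set (flip w) = fst ` set w"
  by (force simp: flip_def)

lemma scal_simps [simp]:
  "scal 0 f = 0" "scal c 0 = 0" "scal 1 f = f" "scal c (scal d f) = scal (c * d) f"
  by (auto simp: fun_ext_simps)

lemma scal_add: "scal c (f + g) = scal c f + scal c g"
  and scal_diff: "scal c (f - g) = scal c f - scal c g"
  and scal_left_add: "scal (c + d) f = scal c f + scal d f"
  and scal_left_diff: "scal (c - d) f = scal c f - scal d f"
  by (auto simp: fun_ext_simps algebra_simps)

lemma scal_minus_one: "- f = scal (- 1) f"
  by (auto simp: fun_ext_simps)

lemma scal_sum: "scal c (sum f A) = (\<Sum>i\<in>A. scal c (f i))"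
  by (auto simp: fun_ext_simps sum_fun_apply sum_distrib_left)

lemma conv_add_left: "(f + g) \<star> h = f \<star> h + g \<star> h"
  and conv_add_right: "h \<star> (f + g) = h \<star> f + h \<star> g"
  and conv_diff_left: "(f - g) \<star> h = f \<star> h - g \<star> h"
  and conv_diff_right: "h \<star> (f - g) = h \<star> f - h \<star> g"
  by (auto simp: fun_ext_simps conv_def algebra_simps sum.distrib sum_subtractf)

lemma conv_scal_left: "scal c f \<star> h = scal c (f \<star> h)"
  and conv_scal_right: "h \<star> scal c f = scal c (h \<star> f)"
  by (auto simp: fun_ext_simps conv_def algebra_simps sum_distrib_left)

lemma conv_zero [simp]: "0 \<star> h = 0" "h \<star> 0 = 0"
  by (auto simp: fun_ext_simps conv_def)

lemma conv_sum_left: "sum f A \<star> h = (\<Sum>i\<in>A. f i \<star> h)"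
  using sum_comp_morphism[of "\<lambda>f. f \<star> h" f A] by (simp add: conv_add_left comp_def)

lemma conv_sum_right: "h \<star> sum f A = (\<Sum>i\<in>A. h \<star> f i)"
  using sum_comp_morphism[of "\<lambda>f. h \<star> f" f A] by (simp add: conv_add_right comp_def)

lemmas conv_algebra_simps = conv_add_left conv_add_right conv_diff_left conv_diff_right
  conv_scal_left conv_scal_right scal_add scal_diff scal_left_add scal_left_diff

lemma conv_one [simp]: "single [] \<star> f = f" "f \<star> single [] = f"
proof -
  show "single [] \<star> f = f"
  proof
    fix w
    have "(single [] \<star> f) w = (\<Sum>i\<in>{0}. single [] (take i w) * f (drop i w))"
      unfolding conv_def by (rule sum.mono_neutral_right) (auto simp: single_def)
    then show "(single [] \<star> f) w = f w" by (simp add: single_def)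
  qed
  show "f \<star> single [] = f"
  proof
    fix w
    have "(f \<star> single []) w = (\<Sum>i\<in>{length w}. f (take i w) * single [] (drop i w))"
      unfolding conv_def by (rule sum.mono_neutral_right) (auto simp: single_def)
    then show "(f \<star> single []) w = f w" by (simp add: single_def)
  qed
qed

lemma conv_assoc: "(f \<star> g) \<star> h = f \<star> (g \<star> h)"
proof
  fix w :: "'a list"
  let ?n = "length w"
  have "((f \<star> g) \<star> h) w
      = (\<Sum>i\<le>?n. \<Sum>j\<le>i. f (take j w) * g (take (i - j) (drop j w)) * h (drop i w))"
    by (auto simp: conv_def sum_distrib_right min_def drop_take intro!: sum.cong)
  also have "\<dots> = (\<Sum>(i, j)\<in>(SIGMA i:{..?n}. {..i}).
      f (take j w) * g (take (i - j) (drop j w)) * h (drop i w))"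
    by (subst sum.Sigma) auto
  also have "\<dots> = (\<Sum>(j, k)\<in>(SIGMA j:{..?n}. {..?n - j}).
      f (take j w) * g (take k (drop j w)) * h (drop (j + k) w))"
    by (rule sum.reindex_bij_witness[where i = "\<lambda>(j, k). (j + k, j)" and j = "\<lambda>(i, j). (j, i - j)"])
      auto
  also have "\<dots> = (\<Sum>j\<le>?n. \<Sum>k\<le>?n - j.
      f (take j w) * g (take k (drop j w)) * h (drop (j + k) w))"
    by (subst sum.Sigma) auto
  also have "\<dots> = (f \<star> (g \<star> h)) w"
    by (simp add: conv_def sum_distrib_left add.commute mult.assoc)
  finally show "((f \<star> g) \<star> h) w = (f \<star> (g \<star> h)) w" .
qed

lemma single_conv_single: "single v \<star> single w = single (v @ w)"
proof
  fix u :: "'a list"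
  show "(single v \<star> single w) u = single (v @ w) u"
  proof (cases "u = v @ w")
    case True
    have "single v (take i u) * single w (drop i u) = 0" if "i \<le> length u" "i \<noteq> length v" for i
    proof -
      from that have "length (take i u) \<noteq> length v" by simp
      then have "take i u \<noteq> v" by metis
      then show ?thesis by (simp add: single_def)
    qed
    then have "(single v \<star> single w) u = (\<Sum>i\<in>{length v}. single v (take i u) * single w (drop i u))"
      unfolding conv_def using True by (intro sum.mono_neutral_right) auto
    then show ?thesis using True by (simp add: single_def)
  next
    case False
    then have "single v (take i u) * single w (drop i u) = 0" for i
      using append_take_drop_id[of i u] by (auto simp: single_def)
    then have "(single v \<star> single w) u = 0"
      unfolding conv_def by (intro sum.neutral) blast
    then show ?thesis using False by (simp add: single_def)
  qed
qed

lemma adj_adj [simp]: "adj (adj f) = f"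
  by (auto simp: adj_def fun_ext_simps)

lemma adj_simps: "adj (f + g) = adj f + adj g" "adj (f - g) = adj f - adj g"
    "adj (scal c f) = scal (cnj c) (adj f)" "adj 0 = 0"
  by (auto simp: adj_def fun_ext_simps)

lemma adj_single: "adj (single w) = single (flip w)"
  by (auto simp: adj_def single_def fun_ext_simps)

lemma adj_conv: "adj (f \<star> g) = adj g \<star> adj f"
proof
  fix w :: "('a \<times> bool) list"
  have *: "take i (flip w) = flip (drop (length w - i) w)"
      "drop i (flip w) = flip (take (length w - i) w)" for i
    by (simp_all add: flip_def take_rev drop_rev take_map drop_map)
  have "adj (f \<star> g) w = (\<Sum>i\<le>length w.
      cnj (f (flip (drop (length w - i) w))) * cnj (g (flip (take (length w - i) w))))"
    by (simp add: adj_def conv_def *)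
  also have "\<dots> = (\<Sum>i\<le>length w. cnj (f (flip (drop i w))) * cnj (g (flip (take i w))))"
    by (rule sum.reindex_bij_witness[where i = "\<lambda>i. length w - i" and j = "\<lambda>i. length w - i"]) auto
  finally show "adj (f \<star> g) w = (adj g \<star> adj f) w"
    by (simp add: adj_def conv_def mult.commute)
qed

lemma polys_zero [simp]: "0 \<in> polys X"
  by (simp add: polys_def zero_fun_apply)

lemma polys_single: "fst ` set w \<subseteq> X \<Longrightarrow> single w \<in> polys X"
  by (auto simp: polys_def single_def)

lemma polys_one [simp]: "single [] \<in> polys X"
  by (simp add: polys_single)

lemma polys_gen [simp]: "x \<in> X \<Longrightarrow> free_gen x \<in> polys X"
  by (simp add: free_gen_single polys_single)

lemma polys_add [simp]: "f \<in> polys X \<Longrightarrow> g \<in> polys X \<Longrightarrow> f + g \<in> polys X"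
  unfolding polys_def plus_fun_def
  by (auto intro!: finite_subset[of "{w. f w + g w \<noteq> 0}" "{w. f w \<noteq> 0} \<union> {w. g w \<noteq> 0}"]) force+

lemma polys_scal [simp]: "f \<in> polys X \<Longrightarrow> scal c f \<in> polys X"
  unfolding polys_def by (auto simp: scal_apply elim!: rev_finite_subset)

lemma polys_diff [simp]: "f \<in> polys X \<Longrightarrow> g \<in> polys X \<Longrightarrow> f - g \<in> polys X"
proof -
  have "f - g = f + scal (- 1) g" by (auto simp: fun_ext_simps)
  then show "f \<in> polys X \<Longrightarrow> g \<in> polys X \<Longrightarrow> f - g \<in> polys X"
    by (metis polys_add polys_scal)
qed

lemma polys_minus [simp]: "f \<in> polys X \<Longrightarrow> - f \<in> polys X"
  by (simp add: scal_minus_one)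

lemma polys_sum [simp]: "(\<And>i. i \<in> A \<Longrightarrow> f i \<in> polys X) \<Longrightarrow> sum f A \<in> polys X"
  by (induction A rule: infinite_finite_induct) auto

lemma polys_adj [simp]: "f \<in> polys X \<Longrightarrow> adj f \<in> polys X"
proof -
  assume f: "f \<in> polys X"
  have "{w. adj f w \<noteq> 0} = flip ` {w. f w \<noteq> 0}"
    by (auto simp: adj_def image_iff) (metis flip_flip)
  with f show ?thesis
    unfolding polys_def by (auto simp: adj_def) (metis fst_set_flip image_eqI imageI subsetD fst_conv)
qed

text \<open>The expansion into monomials, through which bounds on letters become bounds on polynomials and
multiplicativity reduces to words.\<close>

lemma polys_expand:
  assumes "f \<in> polys X"
  shows "f = (\<Sum>w\<in>{w. f w \<noteq> 0}. scal (f w) (single w))"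
proof
  fix v
  have fin: "finite {w. f w \<noteq> 0}" using assms by (simp add: polys_def)
  have "(\<Sum>w\<in>{w. f w \<noteq> 0}. scal (f w) (single w)) v
      = (\<Sum>w\<in>{w. f w \<noteq> 0}. if w = v then f w else 0)"
    by (auto simp: sum_fun_apply single_def scal_apply intro!: sum.cong)
  also have "\<dots> = f v" using fin by (simp add: sum.delta)
  finally show "f v = (\<Sum>w\<in>{w. f w \<noteq> 0}. scal (f w) (single w)) v" by simp
qed

lemma polys_conv [simp]:
  fixes f g :: "'a star_poly"
  assumes f: "f \<in> polys X" and g: "g \<in> polys X"
  shows "f \<star> g \<in> polys X"
proof -
  have s: "fst ` set w \<subseteq> X" if "f w \<noteq> 0 \<or> g w \<noteq> 0" for w
    using f g that by (auto simp: polys_def)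
  have "(\<Sum>v\<in>{v. f v \<noteq> 0}. \<Sum>w\<in>{w. g w \<noteq> 0}.
      scal (f v) (scal (g w) (single v \<star> single w))) \<in> polys X"
    unfolding single_conv_single
    by (intro polys_sum polys_scal polys_single) (use s in \<open>simp add: image_Un\<close>)
  also have "(\<Sum>v\<in>{v. f v \<noteq> 0}. \<Sum>w\<in>{w. g w \<noteq> 0}. scal (f v) (scal (g w) (single v \<star> single w)))
     = (\<Sum>v\<in>{w. f w \<noteq> 0}. scal (f v) (single v)) \<star> (\<Sum>w\<in>{w. g w \<noteq> 0}. scal (g w) (single w))"
    by (subst sum.swap) (simp add: conv_sum_left conv_sum_right conv_scal_left conv_scal_right
        scal_sum mult.commute)
  also have "\<dots> = f \<star> g"
    using polys_expand[OF f] polys_expand[OF g] by simp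
  finally show ?thesis .
qed

lemma ring_free_star_alg: "ring (free_star_alg X)"
proof (rule ringI)
  show "abelian_group (free_star_alg X)"
  proof (rule abelian_groupI)
    show "\<exists>y\<in>carrier (free_star_alg X). y \<oplus>\<^bsub>free_star_alg X\<^esub> x = \<zero>\<^bsub>free_star_alg X\<^esub>"
      if "x \<in> carrier (free_star_alg X)" for x
      using that by (intro bexI[of _ "- x"]) auto
  qed (auto simp: algebra_simps)
  show "Group.monoid (free_star_alg X)"
    by (rule Group.monoidI) (auto simp: conv_assoc)
qed (auto simp: conv_algebra_simps)

lemma free_minus [simp]:
  assumes "f \<in> polys X" "g \<in> polys X"
  shows "f \<ominus>\<^bsub>free_star_alg X\<^esub> g = f - g"
proof -
  interpret ring "free_star_alg X" by (rule ring_free_star_alg)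
  have "\<ominus>\<^bsub>free_star_alg X\<^esub> g = - g"
    by (rule minus_equality) (use assms in auto)
  then show ?thesis by (simp add: a_minus_def)
qed

lemma free_finsum [simp]:
  assumes "finite A" "\<And>i. i \<in> A \<Longrightarrow> f i \<in> polys X"
  shows "finsum (free_star_alg X) f A = sum f A"
proof -
  interpret ring "free_star_alg X" by (rule ring_free_star_alg)
  show ?thesis
    using assms by (induction A rule: finite_induct) (auto simp: Pi_def)
qed

section \<open>C*-seminorms and orthogonality of projections\<close>

lemma sum_subadditive:
  fixes f :: "'i \<Rightarrow> 'a::comm_monoid_add" and p :: "'a \<Rightarrow> real"
  assumes "p 0 = 0" "0 \<in> S" and add: "\<And>x y. x \<in> S \<Longrightarrow> y \<in> S \<Longrightarrow> x + y \<in> S \<and> p (x + y) \<le> p x + p y"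
    and f: "\<And>i. i \<in> A \<Longrightarrow> f i \<in> S"
  shows "p (sum f A) \<le> (\<Sum>i\<in>A. p (f i))"
proof -
  have "sum f A \<in> S \<and> p (sum f A) \<le> (\<Sum>i\<in>A. p (f i))"
    using f
  proof (induction A rule: infinite_finite_induct)
    case (insert x A)
    then show ?case using add[of "f x" "sum f A"] by force
  qed (use assms(1,2) in auto)
  then show ?thesis ..
qed

locale free_cstar_seminorm =
  fixes X :: "'g set" and p :: "'g star_poly \<Rightarrow> real"
  assumes cstar_seminorm: "cstar_seminorm (free_star_alg X) p"
begin

lemma p_nonneg [simp]: "a \<in> polys X \<Longrightarrow> 0 \<le> p a"
  and p_add: "a \<in> polys X \<Longrightarrow> b \<in> polys X \<Longrightarrow> p (a + b) \<le> p a + p b"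
  and p_scal: "a \<in> polys X \<Longrightarrow> p (scal c a) = cmod c * p a"
  and p_conv: "a \<in> polys X \<Longrightarrow> b \<in> polys X \<Longrightarrow> p (a \<star> b) \<le> p a * p b"
  and p_cstar: "a \<in> polys X \<Longrightarrow> p (adj a \<star> a) = (p a)\<^sup>2"
  using cstar_seminorm by (simp_all add: cstar_seminorm_def)

lemma p_eq_0I: "a \<in> polys X \<Longrightarrow> p a \<le> 0 \<Longrightarrow> p a = 0"
  by (rule antisym) simp_all

lemma p_zero [simp]: "p 0 = 0"
  using p_scal[of 0 0] by simp

lemma p_minus: "a \<in> polys X \<Longrightarrow> p (- a) = p a"
  using p_scal[of a "- 1"] by (simp add: scal_minus_one)

lemma p_minus_commute: "a \<in> polys X \<Longrightarrow> b \<in> polys X \<Longrightarrow> p (a - b) = p (b - a)"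
  using p_minus[of "a - b"] by simp

lemma p_diff: "a \<in> polys X \<Longrightarrow> b \<in> polys X \<Longrightarrow> p (a - b) \<le> p a + p b"
  using p_add[of a "- b"] p_minus[of b] by simp

lemma p_triangle: "a \<in> polys X \<Longrightarrow> b \<in> polys X \<Longrightarrow> c \<in> polys X \<Longrightarrow> p (a - c) \<le> p (a - b) + p (b - c)"
  using p_add[of "a - b" "b - c"] by simp

lemma p_le: "a \<in> polys X \<Longrightarrow> b \<in> polys X \<Longrightarrow> p a \<le> p b + p (a - b)"
  using p_add[of b "a - b"] by simp

lemma p_sum:
  assumes "\<And>i. i \<in> A \<Longrightarrow> f i \<in> polys X"
  shows "p (sum f A) \<le> (\<Sum>i\<in>A. p (f i))"
  by (rule sum_subadditive[where S = "polys X"]) (use assms p_add in auto)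

text \<open>From \<open>p(a)\<^sup>2 = p(a\<^sup>* a) \<le> p(a\<^sup>*) p(a)\<close> one gets \<open>p(a) \<le> p(a\<^sup>*)\<close>, hence equality by symmetry.\<close>

lemma p_adj: assumes "a \<in> polys X" shows "p (adj a) = p a"
proof -
  have *: "p b \<le> p (adj b)" if "b \<in> polys X" for b
  proof -
    have "(p b)\<^sup>2 \<le> p (adj b) * p b"
      using that p_conv[of "adj b" b] by (simp add: p_cstar[symmetric])
    then have "p b * p b \<le> p (adj b) * p b" by (simp add: power2_eq_square)
    then show ?thesis
      using p_nonneg[OF that] p_nonneg[OF polys_adj[OF that]]
      by (cases "p b = 0") auto
  qed
  from *[of a] *[of "adj a"] assms show ?thesis by simp
qed

lemma p_le_1_of_idem:
  assumes "a \<in> polys X" "p (adj a \<star> a) = p a" shows "p a \<le> 1"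
proof -
  have "p a * (p a - 1) = 0"
    using p_cstar[OF assms(1)] assms(2) by (simp add: algebra_simps power2_eq_square)
  then show ?thesis by auto
qed

lemma p_one: "p (single []) \<le> 1"
  by (rule p_le_1_of_idem) (simp_all add: adj_single)

lemma p_single:
  assumes "fst ` set w \<subseteq> X" and le: "\<And>x s. x \<in> X \<Longrightarrow> p (single [(x, s)]) \<le> 1"
  shows "p (single w) \<le> 1"
  using assms(1)
proof (induction w)
  case Nil
  show ?case by (rule p_one)
next
  case (Cons l w)
  obtain x s where l: "l = (x, s)" by (cases l)
  have "p (single (l # w)) = p (single [l] \<star> single w)"
    by (simp add: single_conv_single)
  also have "\<dots> \<le> p (single [l]) * p (single w)"
    using Cons.prems by (intro p_conv polys_single) auto
  also have "\<dots> \<le> 1 * 1"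
    using Cons l le[of x s] by (intro mult_mono) (auto simp: polys_single)
  finally show ?case by simp
qed

text \<open>If all letters have seminorm at most \<open>1\<close> then so do all words, so the seminorm is dominated by the sum
of the absolute values of the coefficients. This bound does not depend on \<open>p\<close>.\<close>

lemma p_le_l1:
  assumes a: "a \<in> polys X" and le: "\<And>x s. x \<in> X \<Longrightarrow> p (single [(x, s)]) \<le> 1"
  shows "p a \<le> (\<Sum>w | a w \<noteq> 0. cmod (a w))"
proof -
  have w: "fst ` set w \<subseteq> X" if "a w \<noteq> 0" for w
    using a that by (auto simp: polys_def)
  have "p a = p (\<Sum>w | a w \<noteq> 0. scal (a w) (single w))"
    using polys_expand[OF a] by simp
  also have "\<dots> \<le> (\<Sum>w | a w \<noteq> 0. p (scal (a w) (single w)))"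
    using w by (intro p_sum polys_scal polys_single) auto
  also have "\<dots> \<le> (\<Sum>w | a w \<noteq> 0. cmod (a w))"
    using w by (intro sum_mono) (auto simp: p_scal polys_single intro!: mult_left_le p_single le)
  finally show ?thesis .
qed

text \<open>Equality in the quotient by the null ideal of \<open>p\<close>. Computing with this congruence replaces the
construction of that quotient.\<close>

definition eqv :: "'g star_poly \<Rightarrow> 'g star_poly \<Rightarrow> bool" (infix "\<approx>" 50)
  where "a \<approx> b \<longleftrightarrow> a \<in> polys X \<and> b \<in> polys X \<and> p (a - b) = 0"

lemma eqv_polys: "a \<approx> b \<Longrightarrow> a \<in> polys X" "a \<approx> b \<Longrightarrow> b \<in> polys X"
  by (auto simp: eqv_def)

lemma eqv_refl [simp]: "a \<approx> a \<longleftrightarrow> a \<in> polys X"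
  by (simp add: eqv_def)

lemma eqv_sym: "a \<approx> b \<Longrightarrow> b \<approx> a"
  by (simp add: eqv_def p_minus_commute)

lemma eqv_trans [trans]: "a \<approx> b \<Longrightarrow> b \<approx> c \<Longrightarrow> a \<approx> c"
  unfolding eqv_def
  by (metis p_triangle add.right_neutral p_nonneg polys_diff antisym)

lemma eq_eqv_trans [trans]: "a = b \<Longrightarrow> b \<approx> c \<Longrightarrow> a \<approx> c"
  and eqv_eq_trans [trans]: "a \<approx> b \<Longrightarrow> b = c \<Longrightarrow> a \<approx> c"
  by simp_all

lemma eqv_p: assumes "a \<approx> b" shows "p a = p b"
  using p_le[of a b] p_le[of b a] assms eqv_sym[OF assms] by (simp add: eqv_def)

lemma eqv_0_iff: "a \<approx> 0 \<longleftrightarrow> a \<in> polys X \<and> p a = 0"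
  by (simp add: eqv_def)

lemma eqv_add: assumes "a \<approx> b" "c \<approx> d" shows "a + c \<approx> b + d"
proof -
  have "p ((a + c) - (b + d)) \<le> p (a - b) + p (c - d)"
    using p_add[of "a - b" "c - d"] assms by (simp add: eqv_def algebra_simps)
  then show ?thesis
    using assms unfolding eqv_def by (auto intro!: p_eq_0I)
qed

lemma eqv_scal: "a \<approx> b \<Longrightarrow> scal c a \<approx> scal c b"
  by (simp add: eqv_def scal_diff[symmetric] p_scal)

lemma eqv_diff: assumes "a \<approx> b" "c \<approx> d" shows "a - c \<approx> b - d"
  using eqv_add[OF assms(1) eqv_scal[OF assms(2), of "- 1"]] by (simp add: scal_minus_one[symmetric])

lemma eqv_conv: assumes "a \<approx> b" "c \<approx> d" shows "a \<star> c \<approx> b \<star> d"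
proof -
  have "p (a \<star> c - b \<star> d) = p ((a - b) \<star> c + b \<star> (c - d))"
    by (simp add: conv_algebra_simps)
  also have "\<dots> \<le> p ((a - b) \<star> c) + p (b \<star> (c - d))"
    using assms by (intro p_add) (auto simp: eqv_def)
  also have "\<dots> \<le> p (a - b) * p c + p b * p (c - d)"
    using assms by (intro add_mono p_conv) (auto simp: eqv_def)
  also have "\<dots> = 0" using assms by (simp add: eqv_def)
  finally show ?thesis using assms unfolding eqv_def by (auto intro!: p_eq_0I)
qed

context
  fixes e w :: "'g star_poly"
  assumes ee: "e \<star> e \<approx> e" and ew: "e \<star> w \<approx> w" and we: "w \<star> e \<approx> w"
begin

lemma polys_ew: "e \<in> polys X" "w \<in> polys X"
  using ee ew by (auto dest: eqv_polys)

lemma square_expand: "(e + scal \<alpha> w) \<star> (e + scal \<alpha> w) \<approx> e + scal (2 * \<alpha>) w + scal (\<alpha>\<^sup>2) (w \<star> w)"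
proof -
  note [simp] = polys_ew
  have "(e + scal \<alpha> w) \<star> (e + scal \<alpha> w) = (e \<star> e + (scal \<alpha> (e \<star> w) + scal \<alpha> (w \<star> e))) + scal (\<alpha>\<^sup>2) (w \<star> w)"
    by (simp add: conv_algebra_simps power2_eq_square algebra_simps)
  also have "\<dots> \<approx> (e + (scal \<alpha> w + scal \<alpha> w)) + scal (\<alpha>\<^sup>2) (w \<star> w)"
    by (intro eqv_add eqv_scal ee ew we) simp
  also have "\<dots> = e + scal (2 * \<alpha>) w + scal (\<alpha>\<^sup>2) (w \<star> w)"
    by (simp add: fun_ext_simps)
  finally show ?thesis .
qed

text \<open>Since \<open>(e + \<alpha> w)\<^sup>2 = e + 2\<alpha> w + \<alpha>\<^sup>2 w\<^sup>2\<close> modulo null elements, the quadratic terms cancel in the mean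
of two such squares if \<open>\<alpha>\<^sup>2 + \<beta>\<^sup>2 = 0\<close>. The mean of two elements of the unit ball stays in the unit ball.\<close>

lemma average_squares:
  assumes "p (e + scal \<alpha> w) \<le> 1" "p (e + scal \<beta> w) \<le> 1" "\<alpha>\<^sup>2 + \<beta>\<^sup>2 = 0"
  shows "p (e + scal (\<alpha> + \<beta>) w) \<le> 1"
proof -
  note [simp] = polys_ew
  have sq: "p (a \<star> a) \<le> 1" if "p a \<le> 1" "a \<in> polys X" for a
    using p_conv[OF that(2) that(2)] that mult_mono[of "p a" 1 "p a" 1] by auto
  let ?A = "(e + scal \<alpha> w) \<star> (e + scal \<alpha> w)" and ?B = "(e + scal \<beta> w) \<star> (e + scal \<beta> w)"
  have "scal (1 / 2) (?A + ?B) \<approx> scal (1 / 2) ((e + scal (2 * \<alpha>) w + scal (\<alpha>\<^sup>2) (w \<star> w))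
      + (e + scal (2 * \<beta>) w + scal (\<beta>\<^sup>2) (w \<star> w)))"
    by (intro eqv_scal eqv_add square_expand)
  also have "\<dots> = e + scal (\<alpha> + \<beta>) w + scal ((\<alpha>\<^sup>2 + \<beta>\<^sup>2) / 2) (w \<star> w)"
    by (auto simp: fun_ext_simps field_simps)
  also have "\<dots> = e + scal (\<alpha> + \<beta>) w" by (simp add: assms(3))
  finally have "p (e + scal (\<alpha> + \<beta>) w) = p (scal (1 / 2) (?A + ?B))"
    by (rule eqv_p[symmetric])
  also have "\<dots> \<le> (p ?A + p ?B) / 2"
    using p_add[of ?A ?B] by (simp add: p_scal)
  also have "\<dots> \<le> 1"
    using sq[OF assms(1)] sq[OF assms(2)] by simp
  finally show ?thesis .
qed

text \<open>Two averagings double the scale: those with \<open>\<sigma> u(1+\<i>)\<close> and \<open>\<sigma> u(1-\<i>)\<close> lead to the axis points \<open>2\<sigma> u\<close>,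
and those with the axis points \<open>2\<sigma> u\<close> and \<open>2\<sigma> v\<close> (one real, one imaginary) to the corners \<open>2\<sigma>(u + v)\<close>.\<close>

lemma corner_doubling:
  assumes "\<And>c. c \<in> {1 + \<i>, 1 - \<i>, - 1 + \<i>, - 1 - \<i>} \<Longrightarrow> p (e + scal (\<sigma> * c) w) \<le> 1"
    and "c \<in> {1 + \<i>, 1 - \<i>, - 1 + \<i>, - 1 - \<i>}"
  shows "p (e + scal (2 * \<sigma> * c) w) \<le> 1"
proof -
  have axis: "p (e + scal (2 * \<sigma> * u) w) \<le> 1" if u: "u \<in> {1, - 1, \<i>, - \<i>}" for u
  proof -
    have mem: "u * (1 + \<i>) \<in> {1 + \<i>, 1 - \<i>, - 1 + \<i>, - 1 - \<i>}"
        "u * (1 - \<i>) \<in> {1 + \<i>, 1 - \<i>, - 1 + \<i>, - 1 - \<i>}"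
      using u by (elim insertE emptyE; simp add: complex_eq_iff)+
    have "(1 + \<i>)\<^sup>2 + (1 - \<i>)\<^sup>2 = 0" by (simp add: power2_eq_square algebra_simps)
    moreover have "(\<sigma> * (u * (1 + \<i>)))\<^sup>2 + (\<sigma> * (u * (1 - \<i>)))\<^sup>2
        = \<sigma>\<^sup>2 * u\<^sup>2 * ((1 + \<i>)\<^sup>2 + (1 - \<i>)\<^sup>2)"
      by (simp only: power_mult_distrib mult.assoc distrib_left[symmetric])
    ultimately have "p (e + scal (\<sigma> * (u * (1 + \<i>)) + \<sigma> * (u * (1 - \<i>))) w) \<le> 1"
      by (intro average_squares assms(1) mem) simp
    moreover have "\<sigma> * (u * (1 + \<i>)) + \<sigma> * (u * (1 - \<i>)) = 2 * \<sigma> * u"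
      by (simp add: algebra_simps)
    ultimately show ?thesis by simp
  qed
  have "\<exists>u\<in>{1, - 1}. \<exists>v\<in>{\<i>, - \<i>}. c = u + v"
    using assms(2) by (elim insertE emptyE; simp)
  then obtain u v where uv: "u \<in> {1, - 1}" "v \<in> {\<i>, - \<i>}" "c = u + v" by blast
  have "(2 * \<sigma> * u)\<^sup>2 + (2 * \<sigma> * v)\<^sup>2 = 0"
    using uv(1,2) by (auto simp: power_mult_distrib)
  then have "p (e + scal (2 * \<sigma> * u + 2 * \<sigma> * v) w) \<le> 1"
    using uv(1,2) by (intro average_squares axis) auto
  then show ?thesis by (simp add: uv(3) distrib_left)
qed

text \<open>Iterated doubling keeps \<open>e + 2\<^sup>k \<sigma>(1+\<i>) w\<close> in the unit ball for all \<open>k\<close>, which is possible only if \<open>w\<close>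
is null. This elementary form of the statement that the unit is an extreme point of the unit ball
takes the place of spectral theory.\<close>

lemma null_of_corners:
  assumes "\<sigma> > 0"
    and corner: "\<And>c. c \<in> {1 + \<i>, 1 - \<i>, - 1 + \<i>, - 1 - \<i>} \<Longrightarrow> p (e + scal (of_real \<sigma> * c) w) \<le> 1"
  shows "p w = 0"
proof (rule ccontr)
  note [simp] = polys_ew
  assume "p w \<noteq> 0"
  then have pos: "p w > 0" using p_nonneg[OF polys_ew(2)] by linarith
  have E: "p (e + scal (2 ^ k * of_real \<sigma> * c) w) \<le> 1"
    if "c \<in> {1 + \<i>, 1 - \<i>, - 1 + \<i>, - 1 - \<i>}" for k c
    using that
  proof (induction k arbitrary: c)
    case (Suc k)
    show ?case
      using corner_doubling[of "2 ^ k * of_real \<sigma>" c, OF Suc.IH Suc.prems] by (simp add: mult.assoc)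
  qed (use corner in simp)
  have bound: "2 ^ k * \<sigma> * p w \<le> 1 + p e" for k :: nat
  proof -
    let ?c = "2 ^ k * of_real \<sigma> * (1 + \<i>)"
    have "1 \<le> cmod (1 + \<i>)" using abs_Re_le_cmod[of "1 + \<i>"] by simp
    then have "2 ^ k * \<sigma> * p w * 1 \<le> 2 ^ k * \<sigma> * p w * cmod (1 + \<i>)"
      using assms(1) pos by (intro mult_left_mono) auto
    also have "\<dots> = p (scal ?c w)"
      using assms(1) by (simp add: p_scal norm_mult norm_power)
    also have "\<dots> \<le> p (e + scal ?c w) + p e"
      using p_diff[of "e + scal ?c w" e] by simp
    also have "\<dots> \<le> 1 + p e" using E[of "1 + \<i>" k] by simp
    finally show ?thesis by simp
  qed
  obtain k :: nat where "(1 + p e) / (\<sigma> * p w) < 2 ^ k"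
    using real_arch_pow[of 2] by auto
  then have "1 + p e < 2 ^ k * \<sigma> * p w"
    using assms(1) pos by (simp add: divide_less_eq mult.assoc)
  with bound[of k] show False by simp
qed

end

text \<open>Let \<open>e = q\<^sub>a\<close> and \<open>w\<^sub>k = e q\<^sub>k e\<close>. For \<open>|1 - \<mu>| = 1\<close> the element \<open>1 - \<mu> q\<^sub>k\<close> is unitary modulo null
elements, so \<open>e - \<mu> w\<^sub>k = e (1 - \<mu> q\<^sub>k) e\<close> lies in the unit ball. Compressing \<open>\<Sum>\<^sub>k q\<^sub>k = 1\<close> by \<open>e\<close> gives
\<open>\<Sum>\<^bsub>k \<noteq> a\<^esub> w\<^sub>k = 0\<close>, so \<open>w\<^sub>b\<close> is minus the sum of the other \<open>w\<^sub>k\<close>, and \<open>e + \<mu> w\<^sub>b\<close> lies in the unit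
ball as well after scaling \<open>\<mu>\<close> down. With \<open>\<mu> = 1 \<plusminus> \<i>\<close> all four corners of a square around \<open>0\<close> are
reached, hence \<open>w\<^sub>b\<close> is null, and \<open>w\<^sub>b = (q\<^sub>b e)\<^sup>* (q\<^sub>b e)\<close>.\<close>

theorem projections_sum_1_orthogonal:
  assumes fin: "finite I"
    and q: "\<And>i. i \<in> I \<Longrightarrow> q i \<in> polys X"
    and idem: "\<And>i. i \<in> I \<Longrightarrow> q i \<star> q i \<approx> q i"
    and sa: "\<And>i. i \<in> I \<Longrightarrow> adj (q i) \<approx> q i"
    and sum1: "sum q I \<approx> single []"
    and ab: "a \<in> I" "b \<in> I" "a \<noteq> b"
  shows "q b \<star> q a \<approx> 0"
proof -
  define e where "e = q a"
  define w where "w k = e \<star> q k \<star> e" for k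
  have e [simp]: "e \<in> polys X" using q ab by (simp add: e_def)
  have w [simp]: "w k \<in> polys X" if "k \<in> I" for k using q that by (simp add: w_def)
  have ee: "e \<star> e \<approx> e" using idem ab by (simp add: e_def)
  have adj_idem: "adj (q k) \<star> q k \<approx> q k" if "k \<in> I" for k
    using eqv_trans[OF eqv_conv[OF sa[OF that], of "q k" "q k"] idem[OF that]] q[OF that] by simp
  have pe: "p e \<le> 1"
    using eqv_p[OF adj_idem[OF ab(1)]] by (intro p_le_1_of_idem) (auto simp: e_def[symmetric])
  have unitary: "p (single [] - scal \<mu> (q k)) \<le> 1" if k: "k \<in> I" and l: "\<mu> + cnj \<mu> = \<mu> * cnj \<mu>" for \<mu> k
  proof -
    let ?s = "single [] - scal \<mu> (q k)"
    note [simp] = q[OF k]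
    have "adj ?s \<star> ?s = single [] - scal (cnj \<mu>) (adj (q k)) - scal \<mu> (q k) + scal (\<mu> * cnj \<mu>) (adj (q k) \<star> q k)"
      by (simp add: adj_simps adj_single conv_algebra_simps algebra_simps)
    also have "\<dots> \<approx> single [] - scal (cnj \<mu>) (q k) - scal \<mu> (q k) + scal (\<mu> * cnj \<mu>) (q k)"
      by (intro eqv_add eqv_diff eqv_scal sa adj_idem k) auto
    also have "\<dots> = single []"
      by (auto simp: fun_ext_simps algebra_simps l[symmetric])
    finally have "(p ?s)\<^sup>2 = p (single [])" by (simp add: p_cstar[symmetric] eqv_p)
    then have "(p ?s)\<^sup>2 \<le> 1" using p_one by simp
    then show ?thesis by (simp add: power_le_one_iff abs_le_square_iff[of _ 1, simplified])
  qed
  have comp: "p (e - scal \<mu> (w k)) \<le> 1" if k: "k \<in> I" and l: "\<mu> + cnj \<mu> = \<mu> * cnj \<mu>" for \<mu> k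
  proof -
    let ?s = "single [] - scal \<mu> (q k)"
    have s: "?s \<in> polys X" using q[OF k] by simp
    have "e \<star> ?s \<star> e = e \<star> e - scal \<mu> (w k)"
      by (simp add: conv_algebra_simps w_def)
    also have "\<dots> \<approx> e - scal \<mu> (w k)" using k by (intro eqv_diff ee) simp
    finally have "p (e - scal \<mu> (w k)) = p (e \<star> ?s \<star> e)" by (simp add: eqv_p)
    also have "\<dots> \<le> p (e \<star> ?s) * p e" using s by (intro p_conv) simp_all
    also have "\<dots> \<le> (p e * p ?s) * p e" using s by (intro mult_right_mono p_conv) auto
    also have "\<dots> \<le> (1 * 1) * 1" using s pe unitary[OF k l] by (intro mult_mono) auto
    finally show ?thesis by simp
  qed
  have wa: "w a \<approx> e"
    unfolding w_def e_def[symmetric] using eqv_trans[OF eqv_conv[OF ee, of e e] ee] by simp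
  have all: "sum w I \<approx> e"
  proof -
    have "sum w I = e \<star> sum q I \<star> e" by (simp add: w_def[abs_def] conv_sum_left conv_sum_right)
    also have "\<dots> \<approx> e \<star> single [] \<star> e" by (intro eqv_conv sum1) auto
    also have "\<dots> = e \<star> e" by simp
    also have "\<dots> \<approx> e" by (rule ee)
    finally show ?thesis .
  qed
  let ?K = "I - {a, b}"
  \<comment> \<open>The compressed relation, solved for the compression of the projection in question.\<close>
  have wb: "w b \<approx> - sum w ?K"
  proof -
    have "sum w I = w a + (w b + sum w ?K)"
      using fin ab by (subst sum.remove[of I a], simp, simp, subst sum.remove[of "I - {a}" b])
        (auto simp: Diff_insert2[symmetric])
    then have "w b = (sum w I - w a) - sum w ?K" by simp
    also have "\<dots> \<approx> (e - e) - sum w ?K" by (intro eqv_diff all wa) (auto intro!: polys_sum)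
    finally show ?thesis by simp
  qed
  \<comment> \<open>Dividing by the cardinality of the index set leaves room for all compressions that are summed
    in the case of a plus sign.\<close>
  define M where "M = real (card I)"
  have cardK: "real (card ?K) \<le> M" "M > 0" unfolding M_def using fin ab
    by (auto intro!: card_mono simp: card_gt_0_iff)
  have minus: "p (e - scal (\<mu> / of_real M) (w b)) \<le> 1" if l: "\<mu> + cnj \<mu> = \<mu> * cnj \<mu>" for \<mu>
  proof -
    have M: "M \<ge> 1" using cardK ab fin by (simp add: M_def Suc_le_eq card_gt_0_iff)
    have "e - scal (\<mu> / of_real M) (w b)
        = scal (of_real (1 / M)) (e - scal \<mu> (w b)) + scal (of_real (1 - 1 / M)) e"
      using M by (auto simp: fun_ext_simps field_simps)
    then have "p (e - scal (\<mu> / of_real M) (w b))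
        \<le> p (scal (of_real (1 / M)) (e - scal \<mu> (w b))) + p (scal (of_real (1 - 1 / M)) e)"
      using ab by (simp add: p_add del: of_real_diff of_real_divide)
    also have "\<dots> = 1 / M * p (e - scal \<mu> (w b)) + (1 - 1 / M) * p e"
      using ab M by (simp add: p_scal del: of_real_diff of_real_divide)
    also have "\<dots> \<le> 1 / M * 1 + (1 - 1 / M) * 1"
      using M pe comp[OF ab(2) l] by (intro add_mono mult_left_mono) auto
    finally show ?thesis by simp
  qed
  have plus: "p (e + scal (\<mu> / of_real M) (w b)) \<le> 1" if l: "\<mu> + cnj \<mu> = \<mu> * cnj \<mu>" for \<mu>
  proof -
    have "e + scal (\<mu> / of_real M) (w b) \<approx> e + scal (\<mu> / of_real M) (- sum w ?K)"
      by (intro eqv_add eqv_scal wb) simp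
    also have "\<dots> = scal (of_real (1 / M))
        ((\<Sum>k\<in>?K. e - scal \<mu> (w k)) + scal (of_real (M - real (card ?K))) e)"
      using cardK
      by (auto simp: fun_ext_simps sum_fun_apply sum_subtractf sum_distrib_left[symmetric] field_simps)
    finally have "p (e + scal (\<mu> / of_real M) (w b)) = p (scal (of_real (1 / M))
        ((\<Sum>k\<in>?K. e - scal \<mu> (w k)) + scal (of_real (M - real (card ?K))) e))"
      by (rule eqv_p)
    also have "\<dots> = 1 / M * p ((\<Sum>k\<in>?K. e - scal \<mu> (w k)) + scal (of_real (M - real (card ?K))) e)"
      using cardK by (subst p_scal) (auto intro!: polys_add polys_sum simp: norm_divide)
    also have "\<dots> \<le> 1 / M * ((\<Sum>k\<in>?K. p (e - scal \<mu> (w k))) + (M - real (card ?K)) * p e)"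
    proof (intro mult_left_mono order.trans[OF p_add] add_mono p_sum)
      show "p (scal (of_real (M - real (card ?K))) e) \<le> (M - real (card ?K)) * p e"
        using cardK by (subst p_scal) (auto simp del: of_real_diff)
    qed (use cardK in \<open>auto intro!: polys_sum\<close>)
    also have "\<dots> \<le> 1 / M * ((\<Sum>k\<in>?K. 1) + (M - real (card ?K)) * 1)"
      using cardK pe comp l by (intro mult_left_mono add_mono sum_mono) (auto simp: mult_left_le)
    also have "\<dots> = 1" using cardK by simp
    finally show ?thesis .
  qed
  have "p (w b) = 0"
  proof (rule null_of_corners[of e])
    show "e \<star> w b \<approx> w b" "w b \<star> e \<approx> w b"
    proof -
      have "e \<star> w b = (e \<star> e) \<star> (q b \<star> e)" by (simp add: w_def conv_assoc)
      also have "\<dots> \<approx> e \<star> (q b \<star> e)" using q ab by (intro eqv_conv ee) auto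
      finally show "e \<star> w b \<approx> w b" by (simp add: w_def conv_assoc)
      have "w b \<star> e = (e \<star> q b) \<star> (e \<star> e)" by (simp add: w_def conv_assoc)
      also have "\<dots> \<approx> (e \<star> q b) \<star> e" using q ab by (intro eqv_conv ee) auto
      finally show "w b \<star> e \<approx> w b" by (simp add: w_def conv_assoc)
    qed
    show "p (e + scal (of_real (1 / M) * c) (w b)) \<le> 1"
      if c: "c \<in> {1 + \<i>, 1 - \<i>, - 1 + \<i>, - 1 - \<i>}" for c
    proof -
      consider "c \<in> {1 + \<i>, 1 - \<i>}" | "- c \<in> {1 + \<i>, 1 - \<i>}"
        using c by (elim insertE emptyE; simp)
      then show ?thesis
      proof cases
        case 1
        then have "c + cnj c = c * cnj c" by (elim insertE emptyE; simp add: complex_eq_iff)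
        from plus[OF this] show ?thesis by simp
      next
        case 2
        then have "(- c) + cnj (- c) = (- c) * cnj (- c)"
          by (elim insertE emptyE; simp add: complex_eq_iff)
        from minus[OF this] show ?thesis by (simp add: scal_def fun_diff_def plus_fun_def)
      qed
    qed
  qed (use cardK ee in auto)
  moreover have "adj (q b \<star> e) \<star> (q b \<star> e) \<approx> w b"
  proof -
    note [simp] = q[OF ab(2)]
    have "adj (q b \<star> e) \<star> (q b \<star> e) = adj e \<star> ((adj (q b) \<star> q b) \<star> e)"
      by (simp add: adj_conv conv_assoc)
    also have "\<dots> \<approx> e \<star> (q b \<star> e)"
      using sa[OF ab(1)] adj_idem[OF ab(2)] q[OF ab(1)] by (intro eqv_conv) (auto simp: e_def)
    finally show ?thesis by (simp add: w_def conv_assoc)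
  qed
  ultimately have "(p (q b \<star> e))\<^sup>2 = 0"
    using q[OF ab(2)] by (simp add: p_cstar[symmetric] eqv_p)
  then show ?thesis using q[OF ab(2)] by (simp add: eqv_0_iff e_def[symmetric])
qed

end

section \<open>The largest C*-seminorm of a presentation\<close>

text \<open>Relations that bound the C*-seminorms of all generators and their adjoints by \<open>1\<close>, as those of partial
isometries do. Then the supremum over the C*-seminorms that vanish on the relations is finite.\<close>

locale cstar_presentation =
  fixes X :: "'g set" and R :: "'g star_poly set"
  assumes gen_bound: "\<And>p x s. cstar_seminorm (free_star_alg X) p \<Longrightarrow> \<forall>r\<in>R. p r = 0 \<Longrightarrow> x \<in> X \<Longrightarrow>
      p (single [(x, s)]) \<le> 1"
begin

definition adm :: "('g star_poly \<Rightarrow> real) \<Rightarrow> bool"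
  where "adm p \<longleftrightarrow> cstar_seminorm (free_star_alg X) p \<and> (\<forall>r\<in>R. p r = 0)"

abbreviation P :: "'g star_poly \<Rightarrow> real" where "P \<equiv> univ_seminorm X R"

lemma adm_locale: "adm p \<Longrightarrow> free_cstar_seminorm X p"
  by (simp add: adm_def free_cstar_seminorm_def)

lemma adm_zero: "adm (\<lambda>_. 0)"
  by (simp add: adm_def cstar_seminorm_def)

lemma P_eq: "P a = (SUP p\<in>Collect adm. p a)"
  by (simp add: univ_seminorm_def adm_def[abs_def] setcompr_eq_image)

lemma adm_bdd: "a \<in> polys X \<Longrightarrow> bdd_above ((\<lambda>p. p a) ` Collect adm)"
proof (rule bdd_aboveI2)
  fix p assume a: "a \<in> polys X" and "p \<in> Collect adm"
  then have p: "adm p" by simp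
  interpret free_cstar_seminorm X p by (rule adm_locale[OF p])
  show "p a \<le> (\<Sum>w | a w \<noteq> 0. cmod (a w))"
    using p a by (intro p_le_l1 gen_bound) (auto simp: adm_def)
qed

lemma adm_le_P: "adm p \<Longrightarrow> a \<in> polys X \<Longrightarrow> p a \<le> P a"
  unfolding P_eq by (rule cSUP_upper[OF _ adm_bdd]) auto

lemma P_le: "(\<And>p. adm p \<Longrightarrow> p a \<le> c) \<Longrightarrow> P a \<le> c"
  unfolding P_eq by (rule cSUP_least) (use adm_zero in auto)

lemma P_nonneg: "a \<in> polys X \<Longrightarrow> 0 \<le> P a"
  using adm_le_P[OF adm_zero] by simp

lemma P_eq_0I: "a \<in> polys X \<Longrightarrow> (\<And>p. adm p \<Longrightarrow> p a = 0) \<Longrightarrow> P a = 0"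
  by (intro antisym P_le P_nonneg) (auto intro: eq_refl)

lemma P_relation: "r \<in> R \<Longrightarrow> r \<in> polys X \<Longrightarrow> P r = 0"
  by (rule P_eq_0I) (auto simp: adm_def)

text \<open>A supremum of C*-seminorms is a C*-seminorm: inequalities pass to the supremum directly, and the
reverse half of an equation follows by solving it for the seminorm of \<open>a\<close> first.\<close>

lemma P_cstar_seminorm: "cstar_seminorm (free_star_alg X) P"
  unfolding cstar_seminorm_def free_star_alg_simps
proof (intro conjI ballI allI)
  fix a b :: "'g star_poly" and c :: complex assume a: "a \<in> polys X"
  show "0 \<le> P a" using a by (rule P_nonneg)
  show "P (scal c a) = cmod c * P a"
  proof (rule antisym)
    show "P (scal c a) \<le> cmod c * P a"
    proof (rule P_le)
      fix p assume "adm p"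
      then interpret free_cstar_seminorm X p by (rule adm_locale)
      show "p (scal c a) \<le> cmod c * P a"
        using a adm_le_P[OF \<open>adm p\<close> a] by (simp add: p_scal mult_left_mono)
    qed
    show "cmod c * P a \<le> P (scal c a)"
    proof (cases "c = 0")
      case False
      have "P a \<le> P (scal c a) / cmod c"
      proof (rule P_le)
        fix p assume "adm p"
        then interpret free_cstar_seminorm X p by (rule adm_locale)
        have "cmod c * p a \<le> P (scal c a)"
          using adm_le_P[OF \<open>adm p\<close> polys_scal[OF a], of c] a by (simp add: p_scal)
        then show "p a \<le> P (scal c a) / cmod c" using False by (simp add: field_simps)
      qed
      then show ?thesis using False by (simp add: field_simps)
    qed (use P_nonneg[of 0] in simp)
  qed
  show "P (adj a \<star> a) = (P a)\<^sup>2"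
  proof (rule antisym)
    show "P (adj a \<star> a) \<le> (P a)\<^sup>2"
    proof (rule P_le)
      fix p assume "adm p"
      then interpret free_cstar_seminorm X p by (rule adm_locale)
      show "p (adj a \<star> a) \<le> (P a)\<^sup>2"
        using a adm_le_P[OF \<open>adm p\<close> a] by (simp add: p_cstar power_mono)
    qed
    have "P a \<le> sqrt (P (adj a \<star> a))"
    proof (rule P_le)
      fix p assume "adm p"
      then interpret free_cstar_seminorm X p by (rule adm_locale)
      have "(p a)\<^sup>2 \<le> P (adj a \<star> a)"
        using a adm_le_P[OF \<open>adm p\<close>, of "adj a \<star> a"] by (simp add: p_cstar)
      then show "p a \<le> sqrt (P (adj a \<star> a))" by (rule real_le_rsqrt)
    qed
    then have "(P a)\<^sup>2 \<le> (sqrt (P (adj a \<star> a)))\<^sup>2"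
      using P_nonneg[OF a] by (intro power_mono)
    then show "(P a)\<^sup>2 \<le> P (adj a \<star> a)" using a by (simp add: P_nonneg)
  qed
  assume b: "b \<in> polys X"
  show "P (a + b) \<le> P a + P b"
  proof (rule P_le)
    fix p assume "adm p"
    then interpret free_cstar_seminorm X p by (rule adm_locale)
    show "p (a + b) \<le> P a + P b"
      using p_add[OF a b] adm_le_P[OF \<open>adm p\<close> a] adm_le_P[OF \<open>adm p\<close> b] by simp
  qed
  show "P (a \<star> b) \<le> P a * P b"
  proof (rule P_le)
    fix p assume "adm p"
    then interpret free_cstar_seminorm X p by (rule adm_locale)
    have "p a * p b \<le> P a * P b"
      using a b by (intro mult_mono adm_le_P \<open>adm p\<close> P_nonneg p_nonneg)
    then show "p (a \<star> b) \<le> P a * P b" using p_conv[OF a b] by simp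
  qed
qed

sublocale free_cstar_seminorm X P
  by (simp add: free_cstar_seminorm_def P_cstar_seminorm)

end

section \<open>Separation and completion\<close>

lemma squeeze_0:
  fixes f g :: "nat \<Rightarrow> real"
  shows "(\<And>m. 0 \<le> f m) \<Longrightarrow> (\<And>m. f m \<le> g m) \<Longrightarrow> g \<longlonglongrightarrow> 0 \<Longrightarrow> f \<longlonglongrightarrow> 0"
  by (rule tendsto_sandwich[of "\<lambda>_. 0" f sequentially g 0]) auto

text \<open>Being a ring depends only on the ring components of a record, so results about \<^const>\<open>FactRing\<close> carry
over to quotients with scalars, star and norm.\<close>

lemma ring_cong:
  fixes S :: "('a, 'm) ring_scheme" and R :: "('a, 'n) ring_scheme"
  assumes "ring S" and eq: "carrier R = carrier S" "monoid.mult R = monoid.mult S" "one R = one S"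
    "zero R = zero S" "add R = add S"
  shows "ring R"
proof -
  interpret S: ring S by fact
  show ?thesis
  proof (rule ringI)
    show "abelian_group R"
      by (rule abelian_groupI) (auto simp: eq S.a_ac intro: S.add.l_inv_ex)
    show "Group.monoid R"
      by (rule Group.monoidI) (auto simp: eq S.m_assoc)
  qed (auto simp: eq S.l_distr S.r_distr)
qed

lemma star_quot_simps [simp]:
  "carrier (star_quot R I) = a_rcosets\<^bsub>R\<^esub> I"
  "monoid.mult (star_quot R I) = rcoset_mult R I"
  "one (star_quot R I) = I +>\<^bsub>R\<^esub> \<one>\<^bsub>R\<^esub>"
  "zero (star_quot R I) = I"
  "add (star_quot R I) = set_add R"
  "smult (star_quot R I) = (\<lambda>c X. \<Union>x\<in>X. I +>\<^bsub>R\<^esub> (c \<odot>\<^bsub>R\<^esub> x))"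
  "star (star_quot R I) = (\<lambda>X. \<Union>x\<in>X. I +>\<^bsub>R\<^esub> star R x)"
  by (simp_all add: star_quot_def)

lemma extend_simps [simp]:
  "carrier (star_alg.extend R m) = carrier R"
  "monoid.mult (star_alg.extend R m) = monoid.mult R"
  "one (star_alg.extend R m) = one R"
  "zero (star_alg.extend R m) = zero R"
  "add (star_alg.extend R m) = add R"
  "smult (star_alg.extend R m) = smult R"
  "star (star_alg.extend R m) = star R"
  by (simp_all add: star_alg.extend_def)

lemma cnorm_extend [simp]: "cnorm (star_alg.extend R (cstar_alg.fields f)) = f"
  by (simp add: star_alg.extend_def cstar_alg.fields_def)


lemma star_quot_ring:
  fixes R :: "('a, 'z) star_alg_scheme"
  assumes "ideal I R"
  shows "ring (star_alg.extend (star_quot R I) m)"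
    and "a_r_coset R I \<in> Ring.ring_hom R (star_alg.extend (star_quot R I) m)"
proof -
  interpret ideal I R by fact
  show "ring (star_alg.extend (star_quot R I) m)"
    by (rule ring_cong[OF quotient_is_ring]) (simp_all add: FactRing_def)
  show "a_r_coset R I \<in> Ring.ring_hom R (star_alg.extend (star_quot R I) m)"
    using rcos_ring_hom by (simp add: Ring.ring_hom_def FactRing_def)
qed

context free_cstar_seminorm
begin

abbreviation F :: "'g star_poly star_alg" where "F \<equiv> free_star_alg X"

abbreviation Ca :: "(nat \<Rightarrow> 'g star_poly) star_alg" where "Ca \<equiv> cauchy_alg F p"

abbreviation A :: "(nat \<Rightarrow> 'g star_poly) set cstar_alg" where "A \<equiv> completion F p"

abbreviation null :: "(nat \<Rightarrow> 'g star_poly) set" where "null \<equiv> null_seqs F p"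

definition seqs :: "(nat \<Rightarrow> 'g star_poly) set"
  where "seqs = {x. (\<forall>m. x m \<in> polys X) \<and> (\<forall>e>0. \<exists>N. \<forall>m\<ge>N. \<forall>k\<ge>N. p (x m - x k) < e)}"

lemma Ca_simps [simp]:
  "carrier Ca = seqs"
  "monoid.mult Ca = (\<lambda>x y m. x m \<star> y m)"
  "one Ca = (\<lambda>m. single [])"
  "zero Ca = (\<lambda>m. 0)"
  "add Ca = (\<lambda>x y m. x m + y m)"
  "smult Ca = (\<lambda>c x m. scal c (x m))"
  "star Ca = (\<lambda>x m. adj (x m))"
  by (auto simp: cauchy_alg_def seqs_def)

lemma seqs_polys: "x \<in> seqs \<Longrightarrow> x m \<in> polys X"
  by (simp add: seqs_def)

lemma seqsD: "x \<in> seqs \<Longrightarrow> \<forall>m. x m \<in> polys X"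
  by (simp add: seqs_def)

lemma null_iff: "x \<in> null \<longleftrightarrow> x \<in> seqs \<and> (\<lambda>m. p (x m)) \<longlonglongrightarrow> 0"
  by (simp add: null_seqs_def)

lemma p_lipschitz: "a \<in> polys X \<Longrightarrow> b \<in> polys X \<Longrightarrow> \<bar>p a - p b\<bar> \<le> p (a - b)"
  using p_le[of a b] p_le[of b a] p_minus_commute[of a b] by linarith

lemma convergent_p: assumes "x \<in> seqs" shows "convergent (\<lambda>m. p (x m))"
  unfolding Cauchy_convergent_iff[symmetric]
proof (rule CauchyI)
  fix e :: real assume "e > 0"
  then obtain N where N: "\<forall>m\<ge>N. \<forall>k\<ge>N. p (x m - x k) < e"
    using assms unfolding seqs_def by blast
  have "\<bar>p (x m) - p (x k)\<bar> < e" if "m \<ge> N" "k \<ge> N" for m k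
    by (rule le_less_trans[OF p_lipschitz]) (use seqsD[OF assms] N that in auto)
  then show "\<exists>M. \<forall>m\<ge>M. \<forall>n\<ge>M. norm (p (x m) - p (x n)) < e" by auto
qed

lemma seqs_bounded: assumes "x \<in> seqs" obtains B where "B > 0" "\<And>m. p (x m) \<le> B"
proof -
  have "Bseq (\<lambda>m. p (x m))" using convergent_p[OF assms] by (rule convergent_imp_Bseq)
  then obtain B where "B > 0" "\<And>m. norm (p (x m)) \<le> B" by (auto simp: Bseq_def)
  then show ?thesis using that[of B] abs_le_D1 by (metis real_norm_def)
qed

lemma seqsI:
  assumes "\<And>m. z m \<in> polys X" "x \<in> seqs" "y \<in> seqs" "C > 0"
    and le: "\<And>m k. p (z m - z k) \<le> C * (p (x m - x k) + p (y m - y k))"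
  shows "z \<in> seqs"
  unfolding seqs_def
proof (intro CollectI conjI allI impI assms(1))
  fix e :: real assume e: "e > 0"
  then have "e / (2 * C) > 0" using assms(4) by simp
  then obtain N M where N: "\<forall>m\<ge>N. \<forall>k\<ge>N. p (x m - x k) < e / (2 * C)"
      and M: "\<forall>m\<ge>M. \<forall>k\<ge>M. p (y m - y k) < e / (2 * C)"
    using assms(2,3) unfolding seqs_def by blast
  have "p (z m - z k) < e" if "m \<ge> max N M" "k \<ge> max N M" for m k
  proof -
    have "p (x m - x k) + p (y m - y k) < e / (2 * C) + e / (2 * C)"
      using N M that by (intro add_strict_mono) auto
    then have "C * (p (x m - x k) + p (y m - y k)) < e"
      using assms(4) by (simp add: field_simps)
    then show ?thesis using le[of m k] by linarith
  qed
  then show "\<exists>N. \<forall>m\<ge>N. \<forall>k\<ge>N. p (z m - z k) < e" by blast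
qed

lemma seqs_const [simp]: "a \<in> polys X \<Longrightarrow> (\<lambda>m. a) \<in> seqs"
  by (auto simp: seqs_def)

lemma seqs_add [simp]: assumes "x \<in> seqs" "y \<in> seqs" shows "(\<lambda>m. x m + y m) \<in> seqs"
proof (rule seqsI[OF _ assms, of _ 1])
  fix m k
  have "x m + y m - (x k + y k) = (x m - x k) + (y m - y k)" by simp
  then have "p (x m + y m - (x k + y k)) = p ((x m - x k) + (y m - y k))" by (simp only:)
  also have "\<dots> \<le> p (x m - x k) + p (y m - y k)" using seqsD[OF assms(1)] seqsD[OF assms(2)] by (intro p_add) auto
  finally show "p (x m + y m - (x k + y k)) \<le> 1 * (p (x m - x k) + p (y m - y k))" by simp
qed (use seqsD[OF assms(1)] seqsD[OF assms(2)] in auto)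

lemma seqs_scal [simp]: assumes "x \<in> seqs" shows "(\<lambda>m. scal c (x m)) \<in> seqs"
proof (rule seqsI[OF _ assms assms, of _ "cmod c + 1"])
  fix m k
  have "cmod c * p (x m - x k) \<le> (cmod c + 1) * (p (x m - x k) + p (x m - x k))"
    using seqsD[OF assms] by (intro mult_mono) auto
  then show "p (scal c (x m) - scal c (x k)) \<le> (cmod c + 1) * (p (x m - x k) + p (x m - x k))"
    using seqsD[OF assms] by (simp add: scal_diff[symmetric] p_scal)
qed (use seqsD[OF assms] in \<open>auto intro: add_nonneg_pos\<close>)

lemma seqs_uminus [simp]: "x \<in> seqs \<Longrightarrow> (\<lambda>m. - x m) \<in> seqs"
  using seqs_scal[of x "- 1"] by (simp add: scal_minus_one)

lemma seqs_diff [simp]: assumes "x \<in> seqs" "y \<in> seqs" shows "(\<lambda>m. x m - y m) \<in> seqs"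
  using seqs_add[OF assms(1) seqs_uminus[OF assms(2)]] by simp

lemma seqs_adj [simp]: assumes "x \<in> seqs" shows "(\<lambda>m. adj (x m)) \<in> seqs"
  by (rule seqsI[OF _ assms assms, of _ 1])
    (use seqsD[OF assms] in \<open>auto simp: adj_simps(2)[symmetric] p_adj\<close>)

lemma seqs_conv [simp]: assumes "x \<in> seqs" "y \<in> seqs" shows "(\<lambda>m. x m \<star> y m) \<in> seqs"
proof -
  obtain B where B: "B > 0" "\<And>m. p (x m) \<le> B" using seqs_bounded[OF assms(1)] by blast
  obtain C where C: "C > 0" "\<And>m. p (y m) \<le> C" using seqs_bounded[OF assms(2)] by blast
  show ?thesis
  proof (rule seqsI[OF _ assms, of _ "B + C"])
    fix m k
    note [simp] = seqs_polys[OF assms(1)] seqs_polys[OF assms(2)]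
    have "p (x m \<star> y m - x k \<star> y k) = p ((x m - x k) \<star> y m + x k \<star> (y m - y k))"
      by (simp add: conv_algebra_simps)
    also have "\<dots> \<le> p ((x m - x k) \<star> y m) + p (x k \<star> (y m - y k))"
      by (intro p_add) auto
    also have "\<dots> \<le> p (x m - x k) * p (y m) + p (x k) * p (y m - y k)"
      by (intro add_mono p_conv) auto
    also have "\<dots> \<le> p (x m - x k) * (B + C) + (B + C) * p (y m - y k)"
      using B C by (intro add_mono mult_left_mono mult_right_mono)
        (auto intro: order.trans add_increasing add_increasing2)
    finally show "p (x m \<star> y m - x k \<star> y k) \<le> (B + C) * (p (x m - x k) + p (y m - y k))"
      by (simp add: algebra_simps)
  qed (use seqsD[OF assms(1)] seqsD[OF assms(2)] B C in auto)
qed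

lemma ring_Ca: "ring Ca"
proof (rule ringI)
  show "abelian_group Ca"
  proof (rule abelian_groupI)
    show "\<exists>y\<in>carrier Ca. y \<oplus>\<^bsub>Ca\<^esub> x = \<zero>\<^bsub>Ca\<^esub>" if "x \<in> carrier Ca" for x
      using that by (intro bexI[of _ "\<lambda>m. - x m"]) auto
  qed (auto simp: ac_simps)
  show "Group.monoid Ca"
    by (rule Group.monoidI) (auto simp: conv_assoc)
qed (auto simp: conv_algebra_simps)

lemma null_0I:
  assumes "x \<in> seqs" "y \<in> null" "\<And>m. p (x m) \<le> C * p (y m)"
  shows "x \<in> null"
proof -
  have "(\<lambda>m. C * p (y m)) \<longlonglongrightarrow> C * 0"
    using assms(2) by (intro tendsto_mult tendsto_const) (simp add: null_iff)
  then have "(\<lambda>m. p (x m)) \<longlonglongrightarrow> 0"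
    using seqsD[OF assms(1)] assms(3) by (intro squeeze_0[of "\<lambda>m. p (x m)" "\<lambda>m. C * p (y m)"]) auto
  then show ?thesis using assms(1) by (simp add: null_iff)
qed

lemma null_add: assumes "x \<in> null" "y \<in> null" shows "(\<lambda>m. x m + y m) \<in> null"
proof -
  have xy: "x \<in> seqs" "y \<in> seqs" and "(\<lambda>m. p (x m) + p (y m)) \<longlonglongrightarrow> 0 + 0"
    using assms by (auto simp: null_iff intro: tendsto_add_zero)
  then have "(\<lambda>m. p (x m + y m)) \<longlonglongrightarrow> 0"
    using seqsD[OF xy(1)] seqsD[OF xy(2)]
    by (intro squeeze_0[of "\<lambda>m. p (x m + y m)" "\<lambda>m. p (x m) + p (y m)"]) (auto simp: p_add)
  then show ?thesis using xy by (simp add: null_iff)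
qed

lemma ideal_null: "ideal null Ca"
proof (rule idealI[OF ring_Ca])
  interpret Ca: ring Ca by (rule ring_Ca)
  have minus: "\<ominus>\<^bsub>Ca\<^esub> x = (\<lambda>m. - x m)" if "x \<in> seqs" for x
    by (rule Ca.minus_equality) (use that in auto)
  show "subgroup null (add_monoid Ca)"
  proof (rule group.subgroupI[OF Ca.a_group])
    have "(\<lambda>m. 0) \<in> null" by (simp add: null_iff)
    then show "null \<noteq> {}" by blast
    show "inv\<^bsub>add_monoid Ca\<^esub> x \<in> null" if "x \<in> null" for x
      using that minus[of x] by (auto simp: null_iff a_inv_def p_minus dest: seqsD)
  qed (auto simp: null_add null_iff[THEN iffD1])
  fix x y assume x: "x \<in> null" and "y \<in> carrier Ca"
  then have y: "y \<in> seqs" and xs: "x \<in> seqs" by (auto simp: null_iff)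
  obtain B where B: "B > 0" "\<And>m. p (y m) \<le> B" using seqs_bounded[OF y] by blast
  have "p (y m \<star> x m) \<le> B * p (x m)" "p (x m \<star> y m) \<le> B * p (x m)" for m
    using p_conv[of "y m" "x m"] p_conv[of "x m" "y m"] seqs_polys[OF xs, of m] seqs_polys[OF y, of m] B(2)[of m]
      mult_right_mono[of "p (y m)" B "p (x m)"] by (auto simp: mult.commute)
  then show "y \<otimes>\<^bsub>Ca\<^esub> x \<in> null" "x \<otimes>\<^bsub>Ca\<^esub> y \<in> null"
    using xs y by (auto intro!: null_0I[OF _ x])
qed

definition coset :: "(nat \<Rightarrow> 'g star_poly) \<Rightarrow> (nat \<Rightarrow> 'g star_poly) set"
  where "coset x = null +>\<^bsub>Ca\<^esub> x"

definition emb :: "'g star_poly \<Rightarrow> (nat \<Rightarrow> 'g star_poly) set"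
  where "emb a = coset (\<lambda>m. a)"

lemma completion_emb_eq: "completion_emb F p a = emb a"
  by (simp add: completion_emb_def emb_def coset_def)

lemma mem_coset: assumes "x \<in> seqs" shows "y \<in> coset x \<longleftrightarrow> y \<in> seqs \<and> (\<lambda>m. y m - x m) \<in> null"
proof
  assume "y \<in> coset x"
  then obtain h where "h \<in> null" "y = (\<lambda>m. h m + x m)"
    by (auto simp: coset_def a_r_coset_def r_coset_def)
  then show "y \<in> seqs \<and> (\<lambda>m. y m - x m) \<in> null" using assms by (auto simp: null_iff)
next
  assume y: "y \<in> seqs \<and> (\<lambda>m. y m - x m) \<in> null"
  then show "y \<in> coset x"
    by (auto simp: coset_def a_r_coset_def r_coset_def intro!: bexI[of _ "\<lambda>m. y m - x m"])
qed

lemma null_uminus: "x \<in> null \<Longrightarrow> (\<lambda>m. - x m) \<in> null"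
  by (rule null_0I[of _ x 1]) (auto simp: null_iff p_minus dest: seqsD)

lemma coset_eq_iff:
  assumes "x \<in> seqs" "y \<in> seqs" shows "coset x = coset y \<longleftrightarrow> (\<lambda>m. x m - y m) \<in> null"
proof
  assume "coset x = coset y"
  moreover have "x \<in> coset x" using assms by (simp add: mem_coset null_iff)
  ultimately show "(\<lambda>m. x m - y m) \<in> null" using assms by (simp add: mem_coset)
next
  assume n: "(\<lambda>m. x m - y m) \<in> null"
  show "coset x = coset y"
  proof (rule Set.set_eqI)
    fix z
    show "z \<in> coset x \<longleftrightarrow> z \<in> coset y"
      using null_add[OF n, of "\<lambda>m. z m - x m"] null_add[OF null_uminus[OF n], of "\<lambda>m. z m - y m"] assms
      by (auto simp: mem_coset)
  qed
qed

lemma A_simps: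
  "monoid.mult A = rcoset_mult Ca null" "add A = set_add Ca" "zero A = null" "one A = coset (\<lambda>m. single [])"
  by (simp_all add: completion_def coset_def)

lemma ring_A: "ring A"
  unfolding completion_def by (rule star_quot_ring[OF ideal_null])

lemma coset_hom: "coset \<in> Ring.ring_hom Ca A"
  unfolding coset_def[abs_def] completion_def by (rule star_quot_ring[OF ideal_null])

lemma carrier_A: "carrier A = coset ` seqs"
  by (auto simp: completion_def A_RCOSETS_def' coset_def)

lemma coset_carrier [simp]: "x \<in> seqs \<Longrightarrow> coset x \<in> carrier A"
  by (simp add: carrier_A)

lemma coset_add: "x \<in> seqs \<Longrightarrow> y \<in> seqs \<Longrightarrow> coset x \<oplus>\<^bsub>A\<^esub> coset y = coset (\<lambda>m. x m + y m)"
  and coset_mult: "x \<in> seqs \<Longrightarrow> y \<in> seqs \<Longrightarrow> coset x \<otimes>\<^bsub>A\<^esub> coset y = coset (\<lambda>m. x m \<star> y m)"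
  and coset_one: "coset (\<lambda>m. single []) = \<one>\<^bsub>A\<^esub>"
  using coset_hom by (simp_all add: Ring.ring_hom_def)

lemma coset_zero: "coset (\<lambda>m. 0) = \<zero>\<^bsub>A\<^esub>"
  by (auto simp: A_simps mem_coset null_iff)

lemma coset_minus: assumes "x \<in> seqs" "y \<in> seqs" shows "coset x \<ominus>\<^bsub>A\<^esub> coset y = coset (\<lambda>m. x m - y m)"
proof -
  interpret A: ring A by (rule ring_A)
  have "\<ominus>\<^bsub>A\<^esub> coset y = coset (\<lambda>m. - y m)"
    by (rule A.minus_equality) (use assms in \<open>auto simp: coset_add coset_zero\<close>)
  then show ?thesis using assms by (simp add: a_minus_def coset_add)
qed

lemma coset_self: "x \<in> seqs \<Longrightarrow> x \<in> coset x"
  by (simp add: mem_coset null_iff)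

text \<open>The union over representatives in the definition of the scalar action consists of equal cosets; the
same holds for the star.\<close>

lemma smult_coset: assumes "x \<in> seqs" shows "c \<odot>\<^bsub>A\<^esub> coset x = coset (\<lambda>m. scal c (x m))"
proof -
  have "coset (\<lambda>m. scal c (y m)) = coset (\<lambda>m. scal c (x m))" if "y \<in> coset x" for y
  proof -
    have y: "y \<in> seqs" "(\<lambda>m. y m - x m) \<in> null" using that assms by (auto simp: mem_coset)
    have "(\<lambda>m. scal c (y m) - scal c (x m)) \<in> null"
      using y assms by (intro null_0I[OF _ y(2), of _ "cmod c"]) (auto simp: scal_diff[symmetric] p_scal dest!: seqsD)
    then show ?thesis using y assms by (simp add: coset_eq_iff)
  qed
  note eq = this
  have "c \<odot>\<^bsub>A\<^esub> coset x = (\<Union>y\<in>coset x. coset (\<lambda>m. scal c (y m)))"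
    by (simp add: completion_def coset_def)
  also have "\<dots> = (\<Union>y\<in>coset x. coset (\<lambda>m. scal c (x m)))"
    by (intro SUP_cong eq) simp_all
  also have "\<dots> = coset (\<lambda>m. scal c (x m))" using coset_self[OF assms] by blast
  finally show ?thesis .
qed

lemma star_coset: assumes "x \<in> seqs" shows "star A (coset x) = coset (\<lambda>m. adj (x m))"
proof -
  have "coset (\<lambda>m. adj (y m)) = coset (\<lambda>m. adj (x m))" if "y \<in> coset x" for y
  proof -
    have y: "y \<in> seqs" "(\<lambda>m. y m - x m) \<in> null" using that assms by (auto simp: mem_coset)
    have "(\<lambda>m. adj (y m) - adj (x m)) \<in> null"
      using y assms by (intro null_0I[OF _ y(2), of _ 1]) (auto simp: adj_simps(2)[symmetric] p_adj dest!: seqsD)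
    then show ?thesis using y assms by (simp add: coset_eq_iff)
  qed
  note eq = this
  have "star A (coset x) = (\<Union>y\<in>coset x. coset (\<lambda>m. adj (y m)))"
    by (simp add: completion_def coset_def)
  also have "\<dots> = (\<Union>y\<in>coset x. coset (\<lambda>m. adj (x m)))"
    by (intro SUP_cong eq) simp_all
  also have "\<dots> = coset (\<lambda>m. adj (x m))" using coset_self[OF assms] by blast
  finally show ?thesis .
qed

text \<open>The limit does not depend on the representative, since \<open>p\<close> is \<open>1\<close>-Lipschitz.\<close>

lemma cnorm_coset: assumes x: "x \<in> seqs" and l: "(\<lambda>m. p (x m)) \<longlonglongrightarrow> l" shows "cnorm A (coset x) = l"
proof -
  have "cnorm A (coset x) = (THE l. \<exists>y\<in>coset x. (\<lambda>m. p (y m)) \<longlonglongrightarrow> l)"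
    by (simp add: completion_def)
  also have "\<dots> = l"
  proof (rule the_equality)
    show "\<exists>y\<in>coset x. (\<lambda>m. p (y m)) \<longlonglongrightarrow> l" using coset_self[OF x] l by blast
    fix l' assume "\<exists>y\<in>coset x. (\<lambda>m. p (y m)) \<longlonglongrightarrow> l'"
    then obtain y where y: "y \<in> seqs" "(\<lambda>m. p (y m - x m)) \<longlonglongrightarrow> 0" "(\<lambda>m. p (y m)) \<longlonglongrightarrow> l'"
      using x by (auto simp: mem_coset null_iff)
    have "(\<lambda>m. \<bar>p (y m) - p (x m)\<bar>) \<longlonglongrightarrow> 0"
      using seqsD[OF x] seqsD[OF y(1)] p_lipschitz by (intro squeeze_0[OF _ _ y(2)]) auto
    then have "(\<lambda>m. p (y m) - p (x m)) \<longlonglongrightarrow> 0" by (rule tendsto_rabs_zero_cancel)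
    then show "l' = l"
      using tendsto_diff[OF y(3) l] LIMSEQ_unique by fastforce
  qed
  finally show ?thesis .
qed

lemma emb_carrier [simp]: "a \<in> polys X \<Longrightarrow> emb a \<in> carrier A"
  by (simp add: emb_def)

lemma emb_hom: "emb \<in> Ring.ring_hom F A"
  by (rule ring_hom_memI) (auto simp: emb_def coset_add coset_mult coset_one)

lemma emb_zero: "emb 0 = \<zero>\<^bsub>A\<^esub>"
  by (simp add: emb_def coset_zero)

lemma emb_scal: "a \<in> polys X \<Longrightarrow> emb (scal c a) = c \<odot>\<^bsub>A\<^esub> emb a"
  by (simp add: emb_def smult_coset)

lemma emb_sum:
  assumes "finite S" "\<And>i. i \<in> S \<Longrightarrow> f i \<in> polys X"
  shows "emb (sum f S) = (\<Oplus>\<^bsub>A\<^esub>i\<in>S. emb (f i))"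
proof -
  interpret A: ring A by (rule ring_A)
  show ?thesis using assms
  proof (induction S rule: finite_induct)
    case (insert x S)
    have "emb (sum f (insert x S)) = emb (f x + sum f S)"
      using insert.hyps by (subst sum.insert) auto
    also have "\<dots> = emb (f x) \<oplus>\<^bsub>A\<^esub> emb (sum f S)"
      using emb_hom insert.prems by (simp add: Ring.ring_hom_def)
    finally show ?case using insert by (simp add: Pi_def)
  qed (simp add: emb_zero)
qed

lemma emb_eq_iff: "a \<in> polys X \<Longrightarrow> b \<in> polys X \<Longrightarrow> emb a = emb b \<longleftrightarrow> p (a - b) = 0"
  by (simp add: emb_def coset_eq_iff null_iff LIMSEQ_const_iff)

end

section \<open>Closed ideals and quotients of the completion\<close>

context free_cstar_seminorm
begin

lemma ideal_carrier_closed: "norm_closed_in A (carrier A)"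
  by (simp add: norm_closed_in_def)

lemma star_closed: "Y \<in> carrier A \<Longrightarrow> star A Y \<in> carrier A"
  by (auto simp: carrier_A star_coset)

text \<open>The whole algebra is a closed *-ideal, so the family that is intersected is nonempty.\<close>

lemma ideal_closed_ideal_gen:
  assumes "S \<subseteq> carrier A"
  shows "ideal (closed_ideal_gen A S) A" "S \<subseteq> closed_ideal_gen A S"
proof -
  interpret A: ring A by (rule ring_A)
  have "carrier A \<in> {I. ideal I A \<and> star A ` I \<subseteq> I \<and> norm_closed_in A I \<and> S \<subseteq> I}"
    using A.oneideal assms star_closed by (auto simp: ideal_carrier_closed)
  then show "ideal (closed_ideal_gen A S) A"
    unfolding closed_ideal_gen_def by (intro A.i_Intersect) auto
  show "S \<subseteq> closed_ideal_gen A S" by (auto simp: closed_ideal_gen_def)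
qed

context
  fixes q assumes q: "cstar_seminorm F q" and q_le_p: "\<And>a. a \<in> polys X \<Longrightarrow> q a \<le> p a"
begin

interpretation Q: free_cstar_seminorm X q
  by (simp add: free_cstar_seminorm_def q)

text \<open>For a C*-seminorm \<open>q \<le> p\<close> this is the kernel of the continuous extension of \<open>q\<close> to the completion
with respect to \<open>p\<close>.\<close>

definition ker :: "(nat \<Rightarrow> 'g star_poly) set set"
  where "ker = coset ` {x \<in> seqs. (\<lambda>m. q (x m)) \<longlonglongrightarrow> 0}"

lemma seqs_Q: assumes "x \<in> seqs" shows "x \<in> Q.seqs"
proof -
  have le: "q (x m - x k) \<le> p (x m - x k)" for m k
    using seqsD[OF assms] by (intro q_le_p polys_diff) auto
  have "\<exists>N. \<forall>m\<ge>N. \<forall>k\<ge>N. q (x m - x k) < e" if e: "e > 0" for e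
  proof -
    obtain N where "\<forall>m\<ge>N. \<forall>k\<ge>N. p (x m - x k) < e"
      using assms e unfolding seqs_def by blast
    then have "\<forall>m\<ge>N. \<forall>k\<ge>N. q (x m - x k) < e" using le le_less_trans by blast
    then show ?thesis ..
  qed
  then show ?thesis using seqsD[OF assms] by (simp add: Q.seqs_def)
qed

lemma q_null: "x \<in> null \<Longrightarrow> (\<lambda>m. q (x m)) \<longlonglongrightarrow> 0"
  by (rule squeeze_0[of _ "\<lambda>m. p (x m)"]) (auto simp: null_iff q_le_p dest!: seqsD)

lemma q_tendsto_0_add:
  assumes "x \<in> seqs" "y \<in> seqs" "(\<lambda>m. q (x m)) \<longlonglongrightarrow> 0" "(\<lambda>m. q (y m)) \<longlonglongrightarrow> 0"
  shows "(\<lambda>m. q (x m + y m)) \<longlonglongrightarrow> 0"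
  using seqsD[OF assms(1)] seqsD[OF assms(2)]
  by (intro squeeze_0[of "\<lambda>m. q (x m + y m)" "\<lambda>m. q (x m) + q (y m)"] tendsto_add_zero assms(3,4))
    (auto simp: Q.p_add)

lemma coset_ker: assumes x: "x \<in> seqs" shows "coset x \<in> ker \<longleftrightarrow> (\<lambda>m. q (x m)) \<longlonglongrightarrow> 0"
proof
  assume "coset x \<in> ker"
  then obtain y where y: "y \<in> seqs" "(\<lambda>m. q (y m)) \<longlonglongrightarrow> 0" "coset x = coset y"
    by (auto simp: ker_def)
  then have "(\<lambda>m. x m - y m) \<in> null" using x by (simp add: coset_eq_iff)
  then have "(\<lambda>m. q (x m - y m)) \<longlonglongrightarrow> 0" by (rule q_null)
  then have "(\<lambda>m. q ((x m - y m) + y m)) \<longlonglongrightarrow> 0"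
    using x y by (intro q_tendsto_0_add) auto
  then show "(\<lambda>m. q (x m)) \<longlonglongrightarrow> 0" by simp
qed (use x in \<open>auto simp: ker_def\<close>)

lemma ker_carrier: "ker \<subseteq> carrier A"
  by (auto simp: ker_def)

lemma q_tendsto_0_le:
  assumes "x \<in> seqs" "(\<lambda>m. q (y m)) \<longlonglongrightarrow> 0" "\<And>m. q (x m) \<le> C * q (y m)"
  shows "(\<lambda>m. q (x m)) \<longlonglongrightarrow> 0"
  by (rule squeeze_0[of _ "\<lambda>m. C * q (y m)"])
    (use seqsD[OF assms(1)] assms(3) tendsto_mult_right_zero[OF assms(2)] in auto)

lemma ideal_ker: "ideal ker A"
proof (rule idealI[OF ring_A])
  interpret A: ring A by (rule ring_A)
  show "subgroup ker (add_monoid A)"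
  proof (rule group.subgroupI[OF A.a_group])
    show "ker \<subseteq> carrier (add_monoid A)" using ker_carrier by simp
    have "coset (\<lambda>m. 0) \<in> ker" by (simp add: coset_ker)
    then show "ker \<noteq> {}" by blast
    show "inv\<^bsub>add_monoid A\<^esub> Y \<in> ker" if Y: "Y \<in> ker" for Y
    proof -
      obtain x where x: "x \<in> seqs" "Y = coset x" "(\<lambda>m. q (x m)) \<longlonglongrightarrow> 0"
        using Y by (auto simp: ker_def)
      have "\<ominus>\<^bsub>A\<^esub> coset x = coset (\<lambda>m. - x m)"
        by (rule A.minus_equality) (use x in \<open>auto simp: coset_add coset_zero\<close>)
      moreover have "(\<lambda>m. q (- x m)) \<longlonglongrightarrow> 0"
        using x seqsD[OF x(1)] by (simp add: Q.p_minus)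
      ultimately show ?thesis using x by (simp add: a_inv_def coset_ker)
    qed
    show "Y \<otimes>\<^bsub>add_monoid A\<^esub> Z \<in> ker" if YZ: "Y \<in> ker" "Z \<in> ker" for Y Z
    proof -
      obtain x y where "x \<in> seqs" "Y = coset x" "(\<lambda>m. q (x m)) \<longlonglongrightarrow> 0"
          "y \<in> seqs" "Z = coset y" "(\<lambda>m. q (y m)) \<longlonglongrightarrow> 0"
        using YZ by (auto simp: ker_def)
      then show ?thesis by (simp add: coset_add coset_ker q_tendsto_0_add)
    qed
  qed
  fix Y Z assume "Y \<in> ker" "Z \<in> carrier A"
  then obtain x y where x: "x \<in> seqs" "Y = coset x" "(\<lambda>m. q (x m)) \<longlonglongrightarrow> 0"
      and y: "y \<in> seqs" "Z = coset y" by (auto simp: ker_def carrier_A)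
  obtain B where B: "B > 0" "\<And>m. q (y m) \<le> B" using Q.seqs_bounded[OF seqs_Q[OF y(1)]] by blast
  have "q (y m \<star> x m) \<le> B * q (x m)" "q (x m \<star> y m) \<le> B * q (x m)" for m
    using Q.p_conv[of "y m" "x m"] Q.p_conv[of "x m" "y m"] seqs_polys[OF x(1), of m]
      seqs_polys[OF y(1), of m] mult_right_mono[OF B(2)[of m], of "q (x m)"]
    by (auto simp: mult.commute)
  then have "(\<lambda>m. q (y m \<star> x m)) \<longlonglongrightarrow> 0" "(\<lambda>m. q (x m \<star> y m)) \<longlonglongrightarrow> 0"
    using x y by (auto intro!: q_tendsto_0_le[OF _ x(3)])
  then show "Z \<otimes>\<^bsub>A\<^esub> Y \<in> ker" "Y \<otimes>\<^bsub>A\<^esub> Z \<in> ker"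
    using x y by (auto simp: coset_mult coset_ker)
qed

lemma star_ker: "star A ` ker \<subseteq> ker"
proof
  fix Y assume "Y \<in> star A ` ker"
  then obtain x where x: "x \<in> seqs" "Y = star A (coset x)" "(\<lambda>m. q (x m)) \<longlonglongrightarrow> 0"
    by (auto simp: ker_def)
  moreover have "(\<lambda>m. q (adj (x m))) \<longlonglongrightarrow> 0"
    using x seqsD[OF x(1)] by (simp add: Q.p_adj)
  ultimately show "Y \<in> ker" by (simp add: star_coset coset_ker)
qed

text \<open>If \<open>Y\<^sub>m\<close> in the kernel converge to \<open>Z\<close>, then the value of the extended \<open>q\<close> at \<open>Z\<close> is at most
\<open>\<parallel>Y\<^sub>m - Z\<parallel>\<close> for every \<open>m\<close>, hence zero.\<close>

lemma norm_closed_ker: "norm_closed_in A ker"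
  unfolding norm_closed_in_def
proof (intro allI ballI impI, elim conjE)
  fix Y Z assume "\<forall>m. Y m \<in> ker" "Z \<in> carrier A" and lim: "(\<lambda>m. cnorm A (Y m \<ominus>\<^bsub>A\<^esub> Z)) \<longlonglongrightarrow> 0"
  then have "\<forall>m. \<exists>x. x \<in> seqs \<and> Y m = coset x \<and> (\<lambda>k. q (x k)) \<longlonglongrightarrow> 0"
    by (auto simp: ker_def)
  then obtain x where x: "\<And>m. x m \<in> seqs" "\<And>m. Y m = coset (x m)" "\<And>m. (\<lambda>k. q (x m k)) \<longlonglongrightarrow> 0"
    by metis
  obtain y where y: "y \<in> seqs" "Z = coset y" using \<open>Z \<in> carrier A\<close> by (auto simp: carrier_A)
  obtain L where L: "(\<lambda>k. q (y k)) \<longlonglongrightarrow> L"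
    using Q.convergent_p[OF seqs_Q[OF y(1)]] by (auto simp: convergent_def)
  have "L \<le> cnorm A (Y m \<ominus>\<^bsub>A\<^esub> Z)" for m
  proof -
    have d: "(\<lambda>k. x m k - y k) \<in> seqs" using x(1)[of m] y by simp
    then obtain c where c: "(\<lambda>k. p (x m k - y k)) \<longlonglongrightarrow> c"
      using convergent_p by (auto simp: convergent_def)
    have "cnorm A (Y m \<ominus>\<^bsub>A\<^esub> Z) = c"
      using x(1)[of m] x(2)[of m] y d c by (simp add: coset_minus cnorm_coset)
    moreover have "L \<le> 0 + c"
    proof (rule LIMSEQ_le[OF L tendsto_add[OF x(3)[of m] c]], intro exI allI impI)
      fix k
      have xy: "x m k \<in> polys X" "y k \<in> polys X" using seqs_polys x y by blast+
      then have "q (y k) \<le> q (x m k) + q (y k - x m k)" by (intro Q.p_le)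
      also have "q (y k - x m k) \<le> p (x m k - y k)"
        using xy q_le_p[of "y k - x m k"] p_minus_commute[of "x m k" "y k"] by simp
      finally show "q (y k) \<le> q (x m k) + p (x m k - y k)" by simp
    qed
    ultimately show ?thesis by simp
  qed
  then have "L \<le> 0" using lim by (intro LIMSEQ_le_const[OF lim]) auto
  moreover have "0 \<le> L" using seqsD[OF y(1)] by (intro LIMSEQ_le_const[OF L]) auto
  ultimately have "L = 0" by simp
  then show "Z \<in> ker" using y L by (simp add: coset_ker)
qed

text \<open>The kernel of \<open>q\<close> is one of the closed *-ideals in the intersection that defines the generated one. So
a C*-seminorm that kills the generators gives a lower bound for the quotient, which is how elements of
the quotient are told apart.\<close>

lemma emb_closed_ideal_gen:
  assumes S: "S \<subseteq> emb ` {a \<in> polys X. q a = 0}"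
    and a: "a \<in> polys X" "emb a \<in> closed_ideal_gen A S"
  shows "q a = 0"
proof -
  have "S \<subseteq> ker" using S by (force simp: emb_def coset_ker)
  then have "emb a \<in> ker"
    using a ideal_ker star_ker norm_closed_ker by (auto simp: closed_ideal_gen_def)
  then show ?thesis using a by (simp add: emb_def coset_ker LIMSEQ_const_iff)
qed

end

end

locale quotient_map = free_cstar_seminorm X p
  for X :: "'g set" and p :: "'g star_poly \<Rightarrow> real" +
  fixes I assumes ideal_I: "ideal I A"
begin

abbreviation Q :: "(nat \<Rightarrow> 'g star_poly) set set cstar_alg" where "Q \<equiv> cstar_quot A I"

definition \<theta> :: "'g star_poly \<Rightarrow> (nat \<Rightarrow> 'g star_poly) set set"
  where "\<theta> a = I +>\<^bsub>A\<^esub> emb a"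

lemma ring_Q: "ring Q"
  unfolding cstar_quot_def by (rule star_quot_ring[OF ideal_I])

lemma \<theta>_hom: "\<theta> \<in> Ring.ring_hom F Q"
proof -
  have "a_r_coset A I \<in> Ring.ring_hom A Q"
    unfolding cstar_quot_def by (rule star_quot_ring[OF ideal_I])
  with emb_hom show ?thesis by (auto simp: Ring.ring_hom_def \<theta>_def Pi_iff)
qed

lemma \<theta>_mult: "a \<in> polys X \<Longrightarrow> b \<in> polys X \<Longrightarrow> \<theta> (a \<star> b) = \<theta> a \<otimes>\<^bsub>Q\<^esub> \<theta> b"
  and \<theta>_one: "\<theta> (single []) = \<one>\<^bsub>Q\<^esub>"
  and \<theta>_carrier [simp]: "a \<in> polys X \<Longrightarrow> \<theta> a \<in> carrier Q"
  using \<theta>_hom by (auto simp: Ring.ring_hom_def)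

text \<open>The preimage of the ideal in the free *-algebra. Equations in the quotient become congruences modulo
this set.\<close>

definition K :: "'g star_poly set"
  where "K = {a \<in> polys X. emb a \<in> I}"

lemma \<theta>_eq_iff: assumes "a \<in> polys X" "b \<in> polys X" shows "\<theta> a = \<theta> b \<longleftrightarrow> a - b \<in> K"
proof -
  interpret A: ring A by (rule ring_A)
  have "emb a \<ominus>\<^bsub>A\<^esub> emb b = emb (a - b)"
    using assms by (simp add: emb_def coset_minus)
  then show ?thesis
    using A.quotient_eq_iff_same_a_r_cos[OF ideal_I, of "emb a" "emb b"] assms by (auto simp: \<theta>_def K_def)
qed

lemma K_add: assumes "a \<in> K" "b \<in> K" shows "a + b \<in> K"
proof -
  interpret ideal I A by (rule ideal_I)
  have "emb (a + b) = emb a \<oplus>\<^bsub>A\<^esub> emb b" using assms by (simp add: K_def emb_def coset_add)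
  with assms show ?thesis by (simp add: K_def)
qed

lemma K_conv:
  assumes "a \<in> K" "b \<in> polys X" shows "a \<star> b \<in> K" "b \<star> a \<in> K"
proof -
  interpret ideal I A by (rule ideal_I)
  have "emb (a \<star> b) = emb a \<otimes>\<^bsub>A\<^esub> emb b" "emb (b \<star> a) = emb b \<otimes>\<^bsub>A\<^esub> emb a"
    using assms by (simp_all add: K_def emb_def coset_mult)
  with assms show "a \<star> b \<in> K" "b \<star> a \<in> K"
    by (simp_all add: K_def I_l_closed I_r_closed)
qed

text \<open>Only ring ideals are at hand, but multiplication by a scalar is multiplication by a multiple of \<open>1\<close>.\<close>

lemma K_scal: assumes "a \<in> K" shows "scal c a \<in> K"
  using K_conv(2)[OF assms, of "scal c (single [])"] by (simp add: conv_scal_left)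

lemma K_zero [simp]: "0 \<in> K"
proof -
  interpret ideal I A by (rule ideal_I)
  show ?thesis by (simp add: K_def emb_zero)
qed

lemma K_diff: "a \<in> K \<Longrightarrow> b \<in> K \<Longrightarrow> a - b \<in> K"
  using K_add[of a "scal (- 1) b"] K_scal[of b "- 1"] by (simp add: scal_minus_one[symmetric])

lemma K_sum: assumes "\<And>i. i \<in> S \<Longrightarrow> f i \<in> K" shows "sum f S \<in> K"
proof (cases "finite S")
  case True
  then show ?thesis using assms
  proof (induction S rule: finite_induct)
    case (insert x S)
    then have "f x + sum f S \<in> K" by (intro K_add) auto
    then show ?case using insert.hyps by (subst sum.insert) auto
  qed simp
qed simp

lemma K_null: "a \<in> polys X \<Longrightarrow> p a = 0 \<Longrightarrow> a \<in> K"
proof -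
  interpret ideal I A by (rule ideal_I)
  assume "a \<in> polys X" "p a = 0"
  then have "emb a = \<zero>\<^bsub>A\<^esub>" using emb_eq_iff[of a 0] by (simp add: emb_zero)
  with \<open>a \<in> polys X\<close> show ?thesis by (simp add: K_def)
qed

end

section \<open>Representations on finitely supported functions\<close>

lemma adj_sum: "adj (sum f S) = (\<Sum>i\<in>S. adj (f i))"
  using sum_comp_morphism[of adj f S] by (simp add: adj_simps comp_def)

definition fins :: "('v \<Rightarrow> complex) set"
  where "fins = {h. finite {x. h x \<noteq> 0}}"

definition ip :: "('v \<Rightarrow> complex) \<Rightarrow> ('v \<Rightarrow> complex) \<Rightarrow> complex"
  where "ip h k = (\<Sum>x | h x \<noteq> 0. h x * cnj (k x))"

definition nrm :: "('v \<Rightarrow> complex) \<Rightarrow> real"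
  where "nrm h = L2_set (\<lambda>x. cmod (h x)) {x. h x \<noteq> 0}"

lemma fins_finite: "h \<in> fins \<Longrightarrow> finite {x. h x \<noteq> 0}"
  by (simp add: fins_def)

lemma fins_zero [simp]: "0 \<in> fins"
  by (simp add: fins_def zero_fun_apply)

lemma fins_add [simp]: "h \<in> fins \<Longrightarrow> k \<in> fins \<Longrightarrow> h + k \<in> fins"
  unfolding fins_def plus_fun_def
  by (auto intro: finite_subset[of "{x. h x + k x \<noteq> 0}" "{x. h x \<noteq> 0} \<union> {x. k x \<noteq> 0}"])

lemma fins_scal [simp]: "h \<in> fins \<Longrightarrow> scal c h \<in> fins"
  unfolding fins_def by (auto simp: scal_apply elim!: rev_finite_subset)

lemma fins_sum: assumes "\<And>i. i \<in> S \<Longrightarrow> f i \<in> fins" shows "sum f S \<in> fins"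
proof (cases "finite S")
  case True
  then show ?thesis using assms
  proof (induction S rule: finite_induct)
    case (insert x S)
    then have "f x + sum f S \<in> fins" by (intro fins_add) auto
    then show ?case using insert.hyps by (subst sum.insert) auto
  qed simp
qed simp

lemma ip_on: "finite S \<Longrightarrow> {x. h x \<noteq> 0} \<subseteq> S \<Longrightarrow> ip h k = (\<Sum>x\<in>S. h x * cnj (k x))"
  unfolding ip_def by (rule sum.mono_neutral_left) auto

lemma nrm_on: "finite S \<Longrightarrow> {x. h x \<noteq> 0} \<subseteq> S \<Longrightarrow> nrm h = L2_set (\<lambda>x. cmod (h x)) S"
  unfolding nrm_def L2_set_def by (subst sum.mono_neutral_left[of S]) auto

lemma ip_add_left: assumes "h \<in> fins" "h' \<in> fins" shows "ip (h + h') k = ip h k + ip h' k"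
proof -
  let ?S = "{x. h x \<noteq> 0} \<union> {x. h' x \<noteq> 0}"
  have S: "finite ?S" using assms by (simp add: fins_finite)
  have "{x. (h + h') x \<noteq> 0} \<subseteq> ?S" by (auto simp: plus_fun_apply)
  then show ?thesis
    by (simp add: ip_on[OF S] plus_fun_apply sum.distrib[symmetric] algebra_simps)
qed

lemma ip_scal_left: "ip (scal c h) k = c * ip h k"
proof (cases "c = 0")
  case False
  then show ?thesis by (simp add: ip_def scal_apply sum_distrib_left mult.assoc)
qed (simp add: ip_def zero_fun_apply)

lemma ip_zero [simp]: "ip 0 k = 0"
  by (simp add: ip_def zero_fun_apply)

lemma ip_sum_left: assumes "\<And>i. i \<in> S \<Longrightarrow> f i \<in> fins" shows "ip (sum f S) k = (\<Sum>i\<in>S. ip (f i) k)"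
proof (cases "finite S")
  case True
  then show ?thesis using assms
  proof (induction S rule: finite_induct)
    case (insert x S)
    then have "ip (f x + sum f S) k = ip (f x) k + (\<Sum>i\<in>S. ip (f i) k)"
      by (subst ip_add_left) (auto intro!: fins_sum)
    then show ?case using insert.hyps by (subst sum.insert) auto
  qed simp
qed simp

lemma ip_scal_right: "ip h (scal c k) = cnj c * ip h k"
  by (simp add: ip_def scal_apply sum_distrib_left algebra_simps)

lemma ip_sum_right: "ip h (sum f S) = (\<Sum>i\<in>S. ip h (f i))"
  unfolding ip_def sum_fun_apply cnj_sum sum_distrib_left by (rule sum.swap)

lemma ip_self: "ip h h = of_real ((nrm h)\<^sup>2)"
  by (simp add: ip_def nrm_def L2_set_def sum_nonneg complex_norm_square[symmetric] of_real_power[symmetric]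
      del: of_real_power)

lemma nrm_nonneg [simp]: "0 \<le> nrm h"
  by (simp add: nrm_def)

lemma nrm_zero [simp]: "nrm 0 = 0"
  by (simp add: nrm_def zero_fun_apply)

lemma nrm_eq_0: "h \<in> fins \<Longrightarrow> nrm h = 0 \<Longrightarrow> h = 0"
  by (auto simp: nrm_def L2_set_eq_0_iff fins_finite fun_eq_iff zero_fun_apply)

lemma nrm_add: assumes "h \<in> fins" "k \<in> fins" shows "nrm (h + k) \<le> nrm h + nrm k"
proof -
  let ?S = "{x. h x \<noteq> 0} \<union> {x. k x \<noteq> 0}"
  have S: "finite ?S" using assms by (simp add: fins_finite)
  have "{x. (h + k) x \<noteq> 0} \<subseteq> ?S" by (auto simp: plus_fun_apply)
  then have "nrm (h + k) = L2_set (\<lambda>x. cmod (h x + k x)) ?S"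
    by (simp add: nrm_on[OF S] plus_fun_apply)
  also have "\<dots> \<le> L2_set (\<lambda>x. cmod (h x) + cmod (k x)) ?S"
    by (intro L2_set_mono) (auto intro: norm_triangle_ineq)
  also have "\<dots> \<le> nrm h + nrm k"
    by (simp add: nrm_on[OF S] L2_set_triangle_ineq)
  finally show ?thesis .
qed

lemma nrm_scal: "nrm (scal c h) = cmod c * nrm h"
proof (cases "c = 0")
  case False
  then show ?thesis by (simp add: nrm_def scal_apply norm_mult L2_set_right_distrib)
qed simp

lemma nrm_sum: assumes "\<And>i. i \<in> S \<Longrightarrow> f i \<in> fins" shows "nrm (sum f S) \<le> (\<Sum>i\<in>S. nrm (f i))"
  by (rule sum_subadditive[where S = fins]) (use assms nrm_add in auto)

lemma cauchy_schwarz: assumes "h \<in> fins" "k \<in> fins" shows "cmod (ip h k) \<le> nrm h * nrm k"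
proof -
  let ?S = "{x. h x \<noteq> 0} \<union> {x. k x \<noteq> 0}"
  have S: "finite ?S" using assms by (simp add: fins_finite)
  have "cmod (ip h k) \<le> (\<Sum>x\<in>?S. \<bar>cmod (h x)\<bar> * \<bar>cmod (k x)\<bar>)"
    by (simp add: ip_on[OF S] order.trans[OF norm_sum] norm_mult)
  also have "\<dots> \<le> nrm h * nrm k"
    by (simp only: nrm_on[OF S] L2_set_mult_ineq Un_upper1 Un_upper2)
  finally show ?thesis .
qed

text \<open>Bounded operators, one for every letter, on the pre-Hilbert space of finitely supported functions;
the operators of a generator and of its adjoint letter are adjoint to each other. Linearity is asked
for on all functions, which spares side conditions.\<close>

locale star_rep =
  fixes opr :: "'g \<times> bool \<Rightarrow> ('v \<Rightarrow> complex) \<Rightarrow> ('v \<Rightarrow> complex)" and B :: "'g \<times> bool \<Rightarrow> real"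
  assumes opr_fins: "h \<in> fins \<Longrightarrow> opr l h \<in> fins"
    and opr_add: "opr l (h + k) = opr l h + opr l k"
    and opr_scal: "opr l (scal c h) = scal c (opr l h)"
    and opr_adj: "h \<in> fins \<Longrightarrow> k \<in> fins \<Longrightarrow> ip (opr (x, s) h) k = ip h (opr (x, \<not> s) k)"
    and opr_bound: "h \<in> fins \<Longrightarrow> nrm (opr l h) \<le> B l * nrm h"
    and B_nonneg: "0 \<le> B l"
begin

definition opw :: "'g star_word \<Rightarrow> ('v \<Rightarrow> complex) \<Rightarrow> ('v \<Rightarrow> complex)"
  where "opw w = foldr opr w"

definition rep :: "'g star_poly \<Rightarrow> ('v \<Rightarrow> complex) \<Rightarrow> ('v \<Rightarrow> complex)"
  where "rep a h = (\<Sum>w | a w \<noteq> 0. scal (a w) (opw w h))"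

lemma opw_simps: "opw [] h = h" "opw (l # w) h = opr l (opw w h)" "opw (v @ w) h = opw v (opw w h)"
  by (simp_all add: opw_def)

lemma opw_fins: "h \<in> fins \<Longrightarrow> opw w h \<in> fins"
  by (induction w) (simp_all add: opw_simps opr_fins)

lemma opw_add: "opw w (h + k) = opw w h + opw w k"
  by (induction w) (simp_all add: opw_simps opr_add)

lemma opw_scal: "opw w (scal c h) = scal c (opw w h)"
  by (induction w) (simp_all add: opw_simps opr_scal)

lemma opw_zero: "opw w 0 = 0"
  using opw_scal[of w 0 0] by simp

lemma opw_sum: "opw w (sum f S) = (\<Sum>i\<in>S. opw w (f i))"
  using sum_comp_morphism[of "opw w" f S] by (simp add: opw_zero opw_add comp_def)

lemma opw_adj: "h \<in> fins \<Longrightarrow> k \<in> fins \<Longrightarrow> ip (opw w h) k = ip h (opw (flip w) k)"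
proof (induction w arbitrary: k)
  case (Cons l w)
  obtain x s where l: "l = (x, s)" by (cases l)
  have f: "flip (l # w) = flip w @ [(x, \<not> s)]" by (simp add: flip_def l)
  show ?case
    unfolding f using Cons by (simp add: opw_simps l opr_adj opw_fins opr_fins)
qed (simp add: opw_simps)

lemma opw_bound: "h \<in> fins \<Longrightarrow> nrm (opw w h) \<le> prod_list (map B w) * nrm h"
proof (induction w)
  case (Cons l w)
  have "nrm (opr l (opw w h)) \<le> B l * nrm (opw w h)" using Cons by (intro opr_bound opw_fins)
  also have "\<dots> \<le> B l * (prod_list (map B w) * nrm h)"
    using Cons by (intro mult_left_mono B_nonneg) auto
  finally show ?case by (simp add: opw_simps mult.assoc)
qed (simp add: opw_simps)

lemma rep_on: "finite S \<Longrightarrow> {w. a w \<noteq> 0} \<subseteq> S \<Longrightarrow> rep a h = (\<Sum>w\<in>S. scal (a w) (opw w h))"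
  unfolding rep_def by (rule sum.mono_neutral_left) auto

lemma rep_zero: "rep 0 h = 0"
  by (simp add: rep_def zero_fun_apply)

lemma rep_single: "rep (single w) h = opw w h"
  by (subst rep_on[of "{w}"]) (auto simp: single_def)

lemma rep_add: assumes "a \<in> polys X" "b \<in> polys X" shows "rep (a + b) h = rep a h + rep b h"
proof -
  let ?S = "{x. a x \<noteq> 0} \<union> {x. b x \<noteq> 0}"
  have S: "finite ?S" using assms by (simp add: polys_def)
  have "{x. (a + b) x \<noteq> 0} \<subseteq> ?S" by (auto simp: plus_fun_apply)
  then show ?thesis
    by (simp add: rep_on[OF S] plus_fun_apply sum.distrib[symmetric] scal_left_add)
qed

lemma rep_scal: "rep (scal c a) h = scal c (rep a h)"
proof (cases "c = 0")
  case False
  then show ?thesis by (simp add: rep_def scal_apply scal_sum)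
qed (simp add: rep_zero)

lemma rep_diff: assumes "a \<in> polys X" "b \<in> polys X" shows "rep (a - b) h = rep a h - rep b h"
proof -
  have "rep (a + scal (- 1) b) h = rep a h + scal (- 1) (rep b h)"
    using assms by (simp add: rep_add[of _ X] rep_scal)
  then show ?thesis by (simp add: scal_minus_one[symmetric])
qed

lemma rep_sum: assumes "\<And>i. i \<in> S \<Longrightarrow> f i \<in> polys X" shows "rep (sum f S) h = (\<Sum>i\<in>S. rep (f i) h)"
proof (cases "finite S")
  case True
  then show ?thesis using assms
  proof (induction S rule: finite_induct)
    case (insert x S)
    then have "rep (f x + sum f S) h = rep (f x) h + (\<Sum>i\<in>S. rep (f i) h)"
      by (subst rep_add[of _ X]) (auto intro!: polys_sum)
    then show ?case using insert.hyps by (subst (1 2) sum.insert) auto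
  qed (simp add: rep_zero)
qed (simp add: rep_zero)

lemma rep_arg_scal: "rep a (scal c h) = scal c (rep a h)"
  by (simp add: rep_def opw_scal scal_sum mult.commute)

lemma rep_conv: assumes a: "a \<in> polys X" and b: "b \<in> polys X" shows "rep (a \<star> b) h = rep a (rep b h)"
proof -
  let ?f = "\<lambda>v w. scal (a v * b w) (single (v @ w))"
  have s: "fst ` set w \<subseteq> X" if "a w \<noteq> 0 \<or> b w \<noteq> 0" for w
    using assms that by (auto simp: polys_def)
  have f: "?f v w \<in> polys X" if "a v \<noteq> 0" "b w \<noteq> 0" for v w
    using s[of v] s[of w] that by (intro polys_scal polys_single) (simp add: image_Un)
  have "a \<star> b = (\<Sum>v | a v \<noteq> 0. scal (a v) (single v)) \<star> (\<Sum>w | b w \<noteq> 0. scal (b w) (single w))"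
    using polys_expand[OF a] polys_expand[OF b] by simp
  also have "\<dots> = (\<Sum>v | a v \<noteq> 0. \<Sum>w | b w \<noteq> 0. ?f v w)"
    by (subst sum.swap) (simp add: conv_sum_left conv_sum_right conv_scal_left conv_scal_right
        single_conv_single scal_sum mult.commute)
  finally have eq: "a \<star> b = (\<Sum>v | a v \<noteq> 0. \<Sum>w | b w \<noteq> 0. ?f v w)" .
  have "rep (a \<star> b) h = rep (\<Sum>v | a v \<noteq> 0. \<Sum>w | b w \<noteq> 0. ?f v w) h"
    by (simp only: eq)
  also have "\<dots> = (\<Sum>v | a v \<noteq> 0. \<Sum>w | b w \<noteq> 0. rep (?f v w) h)"
    using f by (subst rep_sum[of _ _ X], force intro!: polys_sum)
      (intro sum.cong refl rep_sum[of _ _ X], auto)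
  also have "\<dots> = rep a (rep b h)"
    unfolding rep_scal rep_single
    by (simp add: rep_def opw_sum opw_scal opw_simps scal_sum)
  finally show ?thesis .
qed

lemma rep_fins: "h \<in> fins \<Longrightarrow> rep a h \<in> fins"
  unfolding rep_def by (intro fins_sum fins_scal opw_fins)

lemma rep_adj: assumes a: "a \<in> polys X" and h: "h \<in> fins" "k \<in> fins"
  shows "ip (rep a h) k = ip h (rep (adj a) k)"
proof -
  have s: "fst ` set w \<subseteq> X" if "a w \<noteq> 0" for w
    using a that by (auto simp: polys_def)
  have m: "scal (cnj (a w)) (single (flip w)) \<in> polys X" if "a w \<noteq> 0" for w
    using s[OF that] by (intro polys_scal polys_single) simp
  have "adj a = adj (\<Sum>w | a w \<noteq> 0. scal (a w) (single w))"
    using polys_expand[OF a] by simp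
  also have "\<dots> = (\<Sum>w | a w \<noteq> 0. adj (scal (a w) (single w)))"
    by (rule adj_sum)
  also have "\<dots> = (\<Sum>w | a w \<noteq> 0. scal (cnj (a w)) (single (flip w)))"
    by (simp add: adj_simps adj_single)
  finally have eq: "adj a = (\<Sum>w | a w \<noteq> 0. scal (cnj (a w)) (single (flip w)))" .
  have "rep (adj a) k = (\<Sum>w | a w \<noteq> 0. scal (cnj (a w)) (opw (flip w) k))"
    unfolding eq using m by (subst rep_sum[of _ _ X]) (auto simp: rep_scal rep_single)
  then show ?thesis
    using h by (simp add: rep_def ip_sum_left ip_sum_right ip_scal_left ip_scal_right opw_adj opw_fins)
qed

lemma rep_bound: "h \<in> fins \<Longrightarrow> nrm (rep a h) \<le> (\<Sum>w | a w \<noteq> 0. cmod (a w) * prod_list (map B w)) * nrm h"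
proof -
  assume h: "h \<in> fins"
  have "nrm (rep a h) \<le> (\<Sum>w | a w \<noteq> 0. nrm (scal (a w) (opw w h)))"
    unfolding rep_def by (intro nrm_sum fins_scal opw_fins h)
  also have "\<dots> \<le> (\<Sum>w | a w \<noteq> 0. cmod (a w) * (prod_list (map B w) * nrm h))"
    unfolding nrm_scal by (intro sum_mono mult_left_mono opw_bound h) simp
  finally show ?thesis by (simp add: sum_distrib_right mult.assoc)
qed

definition opnorm :: "'g star_poly \<Rightarrow> real"
  where "opnorm a = (SUP h\<in>{h \<in> fins. nrm h \<le> 1}. nrm (rep a h))"

lemma opnorm_bdd: "bdd_above ((\<lambda>h. nrm (rep a h)) ` {h \<in> fins. nrm h \<le> 1})"
proof (rule bdd_aboveI2)
  fix h :: "'v \<Rightarrow> complex" assume "h \<in> {h \<in> fins. nrm h \<le> 1}"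
  then have h: "h \<in> fins" "nrm h \<le> 1" by auto
  let ?C = "\<Sum>w | a w \<noteq> 0. cmod (a w) * prod_list (map B w)"
  have "prod_list (map B w) \<ge> 0" for w
    by (induction w) (auto simp: B_nonneg)
  then have "?C \<ge> 0" by (intro sum_nonneg mult_nonneg_nonneg) auto
  then have "?C * nrm h \<le> ?C * 1" using h by (intro mult_left_mono)
  then show "nrm (rep a h) \<le> ?C" using rep_bound[OF h(1), of a] by simp
qed

lemma opnorm_le: "(\<And>h. h \<in> fins \<Longrightarrow> nrm h \<le> 1 \<Longrightarrow> nrm (rep a h) \<le> c) \<Longrightarrow> opnorm a \<le> c"
proof -
  assume le: "\<And>h. h \<in> fins \<Longrightarrow> nrm h \<le> 1 \<Longrightarrow> nrm (rep a h) \<le> c"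
  have "0 \<in> {h \<in> fins. nrm h \<le> 1}" by simp
  then have "{h \<in> fins. nrm h \<le> 1} \<noteq> {}" by blast
  then show ?thesis unfolding opnorm_def by (rule cSUP_least) (auto intro: le)
qed

lemma rep_opnorm: assumes h: "h \<in> fins" shows "nrm (rep a h) \<le> opnorm a * nrm h"
proof (cases "nrm h = 0")
  case True
  then have "h = 0" using h by (rule nrm_eq_0[rotated])
  moreover have "rep a 0 = 0" using rep_arg_scal[of a 0 0] by simp
  ultimately show ?thesis by simp
next
  case False
  then have pos: "nrm h > 0" using nrm_nonneg[of h] by linarith
  let ?k = "scal (of_real (1 / nrm h)) h"
  have "?k \<in> {h \<in> fins. nrm h \<le> 1}" using h pos by (simp add: nrm_scal norm_divide)
  then have "nrm (rep a ?k) \<le> opnorm a"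
    unfolding opnorm_def by (rule cSUP_upper[OF _ opnorm_bdd])
  also have "nrm (rep a ?k) = nrm (rep a h) / nrm h"
    using pos by (simp add: rep_arg_scal nrm_scal norm_divide)
  finally show ?thesis using pos by (simp add: field_simps)
qed

lemma opnorm_rep_le: "h \<in> fins \<Longrightarrow> nrm h \<le> 1 \<Longrightarrow> nrm (rep a h) \<le> opnorm a"
  unfolding opnorm_def by (rule cSUP_upper[OF _ opnorm_bdd]) auto

lemma opnorm_nonneg: "0 \<le> opnorm a"
  by (rule order.trans[OF nrm_nonneg opnorm_rep_le[of 0]]) simp_all

text \<open>With \<open>k = a\<^sup>* h\<close>, the Cauchy-Schwarz inequality gives \<open>\<parallel>k\<parallel>\<^sup>2 = \<langle>h, a k\<rangle> \<le> \<parallel>a\<parallel> \<parallel>k\<parallel>\<close>.\<close>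

lemma opnorm_adj_le: assumes a: "a \<in> polys X" shows "opnorm (adj a) \<le> opnorm a"
proof (rule opnorm_le)
  fix h :: "'v \<Rightarrow> complex" assume h: "h \<in> fins" "nrm h \<le> 1"
  let ?k = "rep (adj a) h"
  have k: "?k \<in> fins" by (rule rep_fins[OF h(1)])
  have "(nrm ?k)\<^sup>2 = cmod (ip ?k ?k)" by (simp add: ip_self norm_power)
  also have "ip ?k ?k = ip h (rep a ?k)"
    using rep_adj[OF polys_adj[OF a] h(1) k] by simp
  also have "cmod \<dots> \<le> nrm h * nrm (rep a ?k)"
    by (intro cauchy_schwarz h rep_fins k)
  also have "\<dots> \<le> 1 * (opnorm a * nrm ?k)"
    using h by (intro mult_mono rep_opnorm k) auto
  finally have "nrm ?k * nrm ?k \<le> opnorm a * nrm ?k" by (simp add: power2_eq_square)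
  then show "nrm ?k \<le> opnorm a"
    using nrm_nonneg[of ?k] opnorm_nonneg[of a] by (cases "nrm ?k = 0") auto
qed

text \<open>The C*-identity needs only adjoints and the Cauchy-Schwarz inequality,
\<open>\<parallel>a h\<parallel>\<^sup>2 = \<langle>h, a\<^sup>* a h\<rangle> \<le> \<parallel>a\<^sup>* a\<parallel>\<close>, and therefore holds on an incomplete space.\<close>

theorem opnorm_cstar_seminorm: "cstar_seminorm (free_star_alg X) opnorm"
  unfolding cstar_seminorm_def free_star_alg_simps
proof (intro conjI ballI allI opnorm_nonneg)
  fix a b :: "'g star_poly" and c :: complex assume a: "a \<in> polys X"
  show "opnorm (scal c a) = cmod c * opnorm a"
  proof (rule antisym)
    show "opnorm (scal c a) \<le> cmod c * opnorm a"
      by (rule opnorm_le) (simp add: rep_scal nrm_scal mult_left_mono opnorm_rep_le)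
    show "cmod c * opnorm a \<le> opnorm (scal c a)"
    proof (cases "c = 0")
      case False
      have "opnorm a \<le> opnorm (scal c a) / cmod c"
      proof (rule opnorm_le)
        fix h :: "'v \<Rightarrow> complex" assume "h \<in> fins" "nrm h \<le> 1"
        then have "nrm (rep (scal c a) h) \<le> opnorm (scal c a)" by (rule opnorm_rep_le)
        then show "nrm (rep a h) \<le> opnorm (scal c a) / cmod c"
          using False by (simp add: rep_scal nrm_scal field_simps)
      qed
      then show ?thesis using False by (simp add: field_simps)
    qed (simp add: opnorm_nonneg)
  qed
  have conv: "opnorm (a \<star> b) \<le> opnorm a * opnorm b" if "a \<in> polys X" "b \<in> polys X" for a b
  proof (rule opnorm_le)
    fix h :: "'v \<Rightarrow> complex" assume h: "h \<in> fins" "nrm h \<le> 1"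
    have "nrm (rep (a \<star> b) h) \<le> opnorm a * nrm (rep b h)"
      using h that by (simp add: rep_conv[of _ X] rep_opnorm rep_fins)
    also have "\<dots> \<le> opnorm a * opnorm b"
      using h by (intro mult_left_mono opnorm_rep_le opnorm_nonneg)
    finally show "nrm (rep (a \<star> b) h) \<le> opnorm a * opnorm b" .
  qed
  show "opnorm (adj a \<star> a) = (opnorm a)\<^sup>2"
  proof (rule antisym)
    have "opnorm (adj a \<star> a) \<le> opnorm (adj a) * opnorm a" using a by (intro conv) auto
    also have "\<dots> \<le> opnorm a * opnorm a"
      by (intro mult_right_mono opnorm_adj_le[OF a] opnorm_nonneg)
    finally show "opnorm (adj a \<star> a) \<le> (opnorm a)\<^sup>2" by (simp add: power2_eq_square)
    have "opnorm a \<le> sqrt (opnorm (adj a \<star> a))"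
    proof (rule opnorm_le)
      fix h :: "'v \<Rightarrow> complex" assume h: "h \<in> fins" "nrm h \<le> 1"
      let ?k = "rep a h"
      have k: "?k \<in> fins" by (rule rep_fins[OF h(1)])
      have "(nrm ?k)\<^sup>2 = cmod (ip ?k ?k)" by (simp add: ip_self norm_power)
      also have "ip ?k ?k = ip h (rep (adj a) ?k)" by (rule rep_adj[OF a h(1) k])
      also have "rep (adj a) ?k = rep (adj a \<star> a) h" using a by (simp add: rep_conv[of _ X])
      also have "cmod (ip h (rep (adj a \<star> a) h)) \<le> nrm h * nrm (rep (adj a \<star> a) h)"
        by (intro cauchy_schwarz h rep_fins)
      also have "\<dots> \<le> 1 * opnorm (adj a \<star> a)"
        using h by (intro mult_mono opnorm_rep_le) auto
      finally show "nrm ?k \<le> sqrt (opnorm (adj a \<star> a))" by (intro real_le_rsqrt) simp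
    qed
    then have "(opnorm a)\<^sup>2 \<le> (sqrt (opnorm (adj a \<star> a)))\<^sup>2"
      by (intro power_mono opnorm_nonneg)
    then show "(opnorm a)\<^sup>2 \<le> opnorm (adj a \<star> a)" by (simp add: opnorm_nonneg)
  qed
  assume b: "b \<in> polys X"
  show "opnorm (a + b) \<le> opnorm a + opnorm b"
  proof (rule opnorm_le)
    fix h :: "'v \<Rightarrow> complex" assume h: "h \<in> fins" "nrm h \<le> 1"
    have "nrm (rep (a + b) h) \<le> nrm (rep a h) + nrm (rep b h)"
      using a b h by (simp add: rep_add[of _ X] nrm_add rep_fins)
    then show "nrm (rep (a + b) h) \<le> opnorm a + opnorm b"
      using opnorm_rep_le[OF h, of a] opnorm_rep_le[OF h, of b] by linarith
  qed
  show "opnorm (a \<star> b) \<le> opnorm a * opnorm b" by (rule conv[OF a b])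
qed

lemma opnorm_eq_0_iff: "opnorm a = 0 \<longleftrightarrow> (\<forall>h\<in>fins. rep a h = 0)"
proof
  assume "opnorm a = 0"
  then have "nrm (rep a h) = 0" if "h \<in> fins" for h
    using rep_opnorm[OF that, of a] by (intro antisym) simp_all
  then show "\<forall>h\<in>fins. rep a h = 0" by (blast intro: nrm_eq_0 rep_fins)
next
  assume "\<forall>h\<in>fins. rep a h = 0"
  then have "opnorm a \<le> 0" by (intro opnorm_le) auto
  then show "opnorm a = 0" using opnorm_nonneg[of a] by simp
qed

end

section \<open>Free products of groups\<close>

definition fp_lift :: "('b, 'y) monoid_scheme \<Rightarrow> ('i \<Rightarrow> 'a \<Rightarrow> 'b) \<Rightarrow> ('i \<times> 'a) list \<Rightarrow> 'b"
  where "fp_lift H f w = foldr (\<lambda>(i, x) m. f i x \<otimes>\<^bsub>H\<^esub> m) w \<one>\<^bsub>H\<^esub>"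

lemma fp_lift_simps [simp]: "fp_lift H f [] = \<one>\<^bsub>H\<^esub>"
    "fp_lift H f ((i, x) # w) = f i x \<otimes>\<^bsub>H\<^esub> fp_lift H f w"
  by (simp_all add: fp_lift_def)

locale free_product_family =
  fixes I :: "'i set" and G :: "'i \<Rightarrow> ('a, 'z) monoid_scheme"
  assumes group_G: "i \<in> I \<Longrightarrow> group (G i)"
begin

abbreviation W :: "('i \<times> 'a) list set" where "W \<equiv> fp_words I G"

abbreviation eqw :: "('i \<times> 'a) list \<Rightarrow> ('i \<times> 'a) list \<Rightarrow> bool" (infix "\<sim>" 50) where "v \<sim> w \<equiv> fp_eq I G v w"

definition cls :: "('i \<times> 'a) list \<Rightarrow> ('i \<times> 'a) list set"
  where "cls w = {z. w \<sim> z}"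

lemma W_simps [simp]:
  "[] \<in> W" "l # w \<in> W \<longleftrightarrow> fst l \<in> I \<and> snd l \<in> carrier (G (fst l)) \<and> w \<in> W"
  "v @ w \<in> W \<longleftrightarrow> v \<in> W \<and> w \<in> W"
  by (auto simp: fp_words_def)

lemma eqw_words: "v \<sim> w \<Longrightarrow> v \<in> W \<and> w \<in> W"
proof (induction rule: fp_eq.induct)
  case (unit v w i)
  then interpret group "G i" by (intro group_G)
  show ?case using unit by simp
next
  case (mult v w i x y)
  then interpret group "G i" by (intro group_G)
  show ?case using mult by simp
qed auto

lemma eqw_append: "v \<sim> w \<Longrightarrow> y \<in> W \<Longrightarrow> z \<in> W \<Longrightarrow> y @ v @ z \<sim> y @ w @ z"
proof (induction rule: fp_eq.induct)
  case (unit v w i)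
  then show ?case using fp_eq.unit[of "y @ v" I G "w @ z" i] by simp
next
  case (mult v w i a b)
  then show ?case using fp_eq.mult[of "y @ v" I G "w @ z" i a b] by simp
qed (auto intro: fp_eq.intros)

lemma eqw_app: assumes "v \<sim> v'" "w \<sim> w'" shows "v @ w \<sim> v' @ w'"
proof -
  have "[] @ v @ w \<sim> [] @ v' @ w" using assms eqw_words by (intro eqw_append) auto
  moreover have "v' @ w @ [] \<sim> v' @ w' @ []" using assms eqw_words by (intro eqw_append) auto
  ultimately show ?thesis by (auto intro: fp_eq.trans)
qed

lemma cls_eq_iff: "v \<in> W \<Longrightarrow> cls v = cls w \<longleftrightarrow> v \<sim> w"
  unfolding cls_def by (blast intro: fp_eq.intros)

lemma mem_cls: "z \<in> cls w \<longleftrightarrow> w \<sim> z"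
  by (simp add: cls_def)

abbreviation FP :: "('i \<times> 'a) list set monoid" where "FP \<equiv> free_product I G"

lemma carrier_FP: "carrier FP = cls ` W"
  by (auto simp: free_product_def quotient_def cls_def)

lemma FP_one: "\<one>\<^bsub>FP\<^esub> = cls []"
  by (simp add: free_product_def cls_def)

lemma FP_mult: assumes "v \<in> W" "w \<in> W" shows "cls v \<otimes>\<^bsub>FP\<^esub> cls w = cls (v @ w)"
proof -
  have eq: "cls (v' @ w') = cls (v @ w)" if "v' \<in> cls v" "w' \<in> cls w" for v' w'
    using that assms eqw_app[of v v' w w'] by (simp add: mem_cls cls_eq_iff[symmetric])
  have "cls v \<otimes>\<^bsub>FP\<^esub> cls w = (\<Union>v'\<in>cls v. \<Union>w'\<in>cls w. cls (v' @ w'))"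
    by (simp add: free_product_def cls_def)
  also have "\<dots> = (\<Union>v'\<in>cls v. \<Union>w'\<in>cls w. cls (v @ w))"
    by (intro SUP_cong eq) simp_all
  also have "\<dots> = cls (v @ w)"
  proof -
    have "v \<in> cls v" "w \<in> cls w" using assms by (auto simp: mem_cls intro: fp_eq.refl)
    then show ?thesis by blast
  qed
  finally show ?thesis .
qed

definition invw :: "('i \<times> 'a) list \<Rightarrow> ('i \<times> 'a) list"
  where "invw w = rev (map (\<lambda>(i, x). (i, inv\<^bsub>G i\<^esub> x)) w)"

lemma invw_words: "w \<in> W \<Longrightarrow> invw w \<in> W"
proof (induction w)
  case (Cons l w)
  obtain i x where l: "l = (i, x)" by (cases l)
  interpret group "G i" using Cons l by (intro group_G) simp
  show ?case using Cons by (simp add: invw_def l)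
qed (simp add: invw_def)

lemma invw_left: "w \<in> W \<Longrightarrow> invw w @ w \<sim> []"
proof (induction w)
  case (Cons l w)
  obtain i x where l: "l = (i, x)" by (cases l)
  have i: "i \<in> I" and x: "x \<in> carrier (G i)" and w: "w \<in> W" using Cons.prems by (auto simp: l)
  interpret group "G i" using i by (rule group_G)
  have "invw (l # w) @ (l # w) = invw w @ [(i, inv\<^bsub>G i\<^esub> x), (i, x)] @ w" by (simp add: invw_def l)
  also have "fp_eq I G \<dots> (invw w @ [(i, inv\<^bsub>G i\<^esub> x \<otimes>\<^bsub>G i\<^esub> x)] @ w)"
    using i x w invw_words[OF w] by (intro fp_eq.mult) auto
  also have "inv\<^bsub>G i\<^esub> x \<otimes>\<^bsub>G i\<^esub> x = \<one>\<^bsub>G i\<^esub>" using x by simp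
  finally have "invw (l # w) @ (l # w) \<sim> invw w @ [(i, \<one>\<^bsub>G i\<^esub>)] @ w" .
  moreover have "invw w @ [(i, \<one>\<^bsub>G i\<^esub>)] @ w \<sim> invw w @ w"
    using i w invw_words[OF w] by (intro fp_eq.unit) auto
  ultimately show ?case using Cons.IH[OF w] by (blast intro: fp_eq.trans)
qed (simp add: invw_def fp_eq.refl)

lemma group_FP: "group FP"
proof (rule groupI)
  fix x assume "x \<in> carrier FP"
  then obtain w where w: "w \<in> W" "x = cls w" by (auto simp: carrier_FP)
  have "cls (invw w) \<otimes>\<^bsub>FP\<^esub> x = \<one>\<^bsub>FP\<^esub>"
    using w invw_left[OF w(1)] by (simp add: FP_mult invw_words FP_one cls_eq_iff)
  then show "\<exists>y\<in>carrier FP. y \<otimes>\<^bsub>FP\<^esub> x = \<one>\<^bsub>FP\<^esub>"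
    using invw_words[OF w(1)] by (auto simp: carrier_FP)
qed (auto simp: carrier_FP FP_mult FP_one)

context
  fixes H :: "('b, 'y) monoid_scheme" and f :: "'i \<Rightarrow> 'a \<Rightarrow> 'b"
  assumes group_H: "group H" and f_hom: "\<And>i. i \<in> I \<Longrightarrow> f i \<in> hom (G i) H"
begin

interpretation H: group H by (rule group_H)

abbreviation lift where "lift \<equiv> fp_lift H f"

lemma f_closed: "i \<in> I \<Longrightarrow> x \<in> carrier (G i) \<Longrightarrow> f i x \<in> carrier H"
  using f_hom by (auto simp: hom_def)

lemma lift_closed [simp]: "w \<in> W \<Longrightarrow> lift w \<in> carrier H"
  by (induction w) (auto simp: f_closed)

lemma lift_append: "v \<in> W \<Longrightarrow> w \<in> W \<Longrightarrow> lift (v @ w) = lift v \<otimes>\<^bsub>H\<^esub> lift w"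
  by (induction v) (auto simp: f_closed H.m_assoc)

lemma lift_eqw: "v \<sim> w \<Longrightarrow> lift v = lift w"
proof (induction rule: fp_eq.induct)
  case (unit v w i)
  interpret Gi: group "G i" using unit(3) by (rule group_G)
  have "f i \<one>\<^bsub>G i\<^esub> = \<one>\<^bsub>H\<^esub>" using f_hom[OF unit(3)] Gi.is_group H.is_group by (rule hom_one)
  then show ?case using unit by (simp add: lift_append)
next
  case (mult v w i x y)
  then have "f i (x \<otimes>\<^bsub>G i\<^esub> y) = f i x \<otimes>\<^bsub>H\<^esub> f i y" using f_hom by (auto simp: hom_def)
  moreover have "x \<otimes>\<^bsub>G i\<^esub> y \<in> carrier (G i)"
    using mult group_G[of i] by (simp add: group.is_monoid monoid.m_closed)
  ultimately show ?case using mult by (simp add: lift_append f_closed H.m_assoc)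
qed auto

text \<open>The homomorphism is induced by evaluation of words. Its image is a subgroup that contains the
generators and consists of products of generators. Injectivity is asked for on words.\<close>

theorem free_product_iso_generated:
  assumes inj: "\<And>w. w \<in> W \<Longrightarrow> lift w = \<one>\<^bsub>H\<^esub> \<Longrightarrow> w \<sim> []"
  shows "FP \<cong> subgroup_generated H (\<Union>i\<in>I. f i ` carrier (G i))"
proof -
  define S where "S = (\<Union>i\<in>I. f i ` carrier (G i))"
  have S: "S \<subseteq> carrier H" using f_closed by (auto simp: S_def)
  define \<Phi> where "\<Phi> C = lift (SOME w. w \<in> C)" for C
  have \<Phi>: "\<Phi> (cls w) = lift w" if "w \<in> W" for w
  proof -
    have "w \<sim> (SOME v. v \<in> cls w)"
      unfolding mem_cls[symmetric] by (rule someI[of _ w]) (simp add: mem_cls fp_eq.refl that)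
    then show ?thesis unfolding \<Phi>_def by (rule lift_eqw[symmetric])
  qed
  have hom: "\<Phi> \<in> hom FP H"
    by (rule homI) (auto simp: carrier_FP FP_mult \<Phi> lift_append)
  interpret \<Phi>: group_hom FP H \<Phi>
    using hom group_FP by (simp add: group_hom_def group_hom_axioms_def H.is_group)
  have "inj_on \<Phi> (carrier FP)"
  proof (rule \<Phi>.inj_on_one_iff[THEN iffD2], intro allI impI)
    fix x assume "x \<in> carrier FP" "\<Phi> x = \<one>\<^bsub>H\<^esub>"
    then obtain w where "w \<in> W" "x = cls w" "lift w = \<one>\<^bsub>H\<^esub>" by (auto simp: carrier_FP \<Phi>)
    then show "x = \<one>\<^bsub>FP\<^esub>" using inj[of w] by (simp add: FP_one cls_eq_iff)
  qed
  moreover have "\<Phi> ` carrier FP = generate H S"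
  proof
    have "lift w \<in> generate H S" if "w \<in> W" for w
      using that
    proof (induction w)
      case (Cons l w)
      then have "f (fst l) (snd l) \<in> generate H S"
        by (intro generate.incl) (auto simp: S_def)
      then show ?case using Cons by (cases l) (auto intro: generate.eng)
    qed (simp add: generate.one)
    then show "\<Phi> ` carrier FP \<subseteq> generate H S" by (auto simp: carrier_FP \<Phi>)
    have "S \<subseteq> \<Phi> ` carrier FP"
    proof
      fix s assume "s \<in> S"
      then obtain i x where ix: "i \<in> I" "x \<in> carrier (G i)" "s = f i x" by (auto simp: S_def)
      then have "\<Phi> (cls [(i, x)]) = s" by (simp add: \<Phi> f_closed)
      moreover have "cls [(i, x)] \<in> carrier FP"
        unfolding carrier_FP using ix by (intro imageI) simp
      ultimately show "s \<in> \<Phi> ` carrier FP" by blast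
    qed
    then show "generate H S \<subseteq> \<Phi> ` carrier FP"
      by (rule H.generate_subgroup_incl[OF _ \<Phi>.img_is_subgroup])
  qed
  moreover have "carrier (subgroup_generated H S) = generate H S"
    using S by (simp add: carrier_subgroup_generated Int_absorb1)
  ultimately have bij: "bij_betw \<Phi> (carrier FP) (carrier (subgroup_generated H S))"
    by (simp add: bij_betw_def)
  then have "\<Phi> \<in> hom FP (subgroup_generated H S)"
    using \<Phi>.hom_mult by (intro homI) (auto simp: bij_betw_def)
  with bij have "\<Phi> \<in> iso FP (subgroup_generated H S)" by (simp add: iso_def)
  then show ?thesis by (auto simp: is_iso_def S_def)
qed

end

end

section \<open>Block-diagonal Fourier matrices\<close>

text \<open>Position \<open>i < \<Sum> rs\<close> lies in block \<open>blk rs i\<close> at offset \<open>loc rs i\<close>; \<open>idx\<close> is the inverse map.\<close>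

fun blk :: "nat list \<Rightarrow> nat \<Rightarrow> nat" where
  "blk [] i = 0"
| "blk (r # rs) i = (if i < r then 0 else Suc (blk rs (i - r)))"

fun loc :: "nat list \<Rightarrow> nat \<Rightarrow> nat" where
  "loc [] i = i"
| "loc (r # rs) i = (if i < r then i else loc rs (i - r))"

definition idx :: "nat list \<Rightarrow> nat \<Rightarrow> nat \<Rightarrow> nat" where
  "idx rs b a = sum_list (take b rs) + a"

lemma blk_loc:
  "i < sum_list rs \<Longrightarrow> blk rs i < length rs \<and> loc rs i < rs ! blk rs i \<and> idx rs (blk rs i) (loc rs i) = i"
proof (induction rs arbitrary: i)
  case (Cons r rs)
  show ?case
  proof (cases "i < r")
    case False
    then have "i - r < sum_list rs" using Cons.prems by simp
    then show ?thesis using Cons.IH[of "i - r"] False by (auto simp: idx_def)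
  qed (simp add: idx_def)
qed simp

lemma idx:
  "b < length rs \<Longrightarrow> a < rs ! b \<Longrightarrow> idx rs b a < sum_list rs \<and> blk rs (idx rs b a) = b \<and> loc rs (idx rs b a) = a"
proof (induction rs arbitrary: b)
  case (Cons r rs)
  show ?case
  proof (cases b)
    case (Suc c)
    then show ?thesis using Cons.IH[of c] Cons.prems by (simp add: idx_def)
  qed (use Cons.prems in \<open>simp add: idx_def\<close>)
qed simp

definition root1 :: "nat \<Rightarrow> complex"
  where "root1 r = exp (2 * of_real pi * \<i> / of_nat r)"

lemma fourier_mat_index: "i < r \<Longrightarrow> j < r \<Longrightarrow> fourier_mat r $$ (i, j) = root1 r ^ (i * j) / of_real (sqrt (of_nat r))"
  by (simp add: fourier_mat_def root1_def)

lemma dim_fourier_mat: "dim_row (fourier_mat r) = r" "dim_col (fourier_mat r) = r"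
  by (simp_all add: fourier_mat_def)

lemma diag_fourier_dim:
  "dim_row (diag_block_mat (map fourier_mat rs)) = sum_list rs"
  "dim_col (diag_block_mat (map fourier_mat rs)) = sum_list rs"
  by (simp_all add: dim_diag_block_mat comp_def dim_fourier_mat)

lemma diag_fourier_index:
  "i < sum_list rs \<Longrightarrow> j < sum_list rs \<Longrightarrow> diag_block_mat (map fourier_mat rs) $$ (i, j) =
    (if blk rs i = blk rs j then fourier_mat (rs ! blk rs i) $$ (loc rs i, loc rs j) else 0)"
proof (induction rs arbitrary: i j)
  case (Cons r rs)
  then show ?case
    by (auto simp: Let_def diag_fourier_dim dim_fourier_mat)
qed simp

lemma root1_power: "root1 r ^ m = cis (2 * pi * real m / real r)"
proof -
  have "root1 r = cis (2 * pi / real r)"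
    by (simp add: root1_def cis_conv_exp mult.commute)
  then show ?thesis by (simp add: DeMoivre mult.commute)
qed

lemma root1_r: "r > 0 \<Longrightarrow> root1 r ^ r = 1"
  by (simp add: root1_power)

lemma cmod_root1 [simp]: "cmod (root1 r) = 1"
  using root1_power[of r 1] by simp

lemma root1_cnj: "root1 r * cnj (root1 r) = 1"
  by (simp add: complex_norm_square[symmetric])

lemma root1_inj: assumes "a < r" "c < r" "root1 r ^ a = root1 r ^ c" shows "a = c"
proof -
  have "inj_on (\<lambda>k. cis (2 * pi * real k / real r)) {..<r}"
    using bij_betw_roots_unity[of r] assms by (auto simp: bij_betw_def)
  then show ?thesis using assms by (auto simp: inj_on_def root1_power)
qed

lemma root_sum:
  fixes z :: complex assumes "z ^ r = 1" "z \<noteq> 1" shows "(\<Sum>m<r. z ^ m) = 0"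
  using geometric_sum[OF assms(2), of r] assms(1) by simp

text \<open>The sum is geometric with ratio \<open>\<xi>\<^bsup>a-c\<^esup>\<close>, an \<open>r\<close>-th root of unity that is \<open>1\<close> only if \<open>a = c\<close>.\<close>

lemma root1_orthogonal:
  assumes "a < r" "c < r"
  shows "(\<Sum>m<r. root1 r ^ (a * m) * cnj (root1 r ^ (c * m))) = (if a = c then of_nat r else 0)"
proof -
  define z where "z = root1 r ^ a * cnj (root1 r ^ c)"
  have eq: "root1 r ^ (a * m) * cnj (root1 r ^ (c * m)) = z ^ m" for m
    by (simp add: z_def power_mult power_mult_distrib)
  have c1: "root1 r ^ c * cnj (root1 r ^ c) = 1"
    by (simp add: complex_cnj_power power_mult_distrib[symmetric] root1_cnj)
  show ?thesis
  proof (cases "a = c")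
    case True
    then have "z = 1" using c1 by (simp add: z_def)
    then show ?thesis using True unfolding eq by simp
  next
    case False
    have "z * root1 r ^ c = root1 r ^ a" using c1 by (simp add: z_def mult.assoc mult.commute)
    then have "z \<noteq> 1" using root1_inj[OF assms] False by auto
    have pw: "(root1 r ^ k) ^ r = 1" for k
      using root1_r[of r] assms by (metis power_mult mult.commute power_one gr_implies_not0 not_gr_zero)
    have "z ^ r = 1"
      by (simp only: z_def power_mult_distrib complex_cnj_power[symmetric] pw complex_cnj_one mult_1)
    with \<open>z \<noteq> 1\<close> show ?thesis using False root_sum unfolding eq by simp
  qed
qed

locale fourier_blocks =
  fixes ns :: "nat list"
  assumes pos: "\<forall>m\<in>set ns. 1 \<le> m"
begin

definition n where "n = sum_list ns"

definition U :: "nat \<Rightarrow> nat \<Rightarrow> complex"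
  where "U i j = diag_block_mat (map fourier_mat ns) $$ (i, j)"

abbreviation bl where "bl \<equiv> blk ns"
abbreviation lo where "lo \<equiv> loc ns"
abbreviation ix where "ix \<equiv> idx ns"
abbreviation sz where "sz i \<equiv> ns ! bl i"

lemma bl_lo: "i < n \<Longrightarrow> bl i < length ns" "i < n \<Longrightarrow> lo i < sz i" "i < n \<Longrightarrow> ix (bl i) (lo i) = i"
  using blk_loc[of i ns] by (simp_all add: n_def)

lemma ix: assumes "b < length ns" "a < ns ! b" shows "ix b a < n" "bl (ix b a) = b" "lo (ix b a) = a"
  using idx[OF assms] by (simp_all add: n_def)

lemma sz_pos: "b < length ns \<Longrightarrow> 0 < ns ! b"
  using pos by (auto simp: Suc_le_eq dest: nth_mem)

lemma U_eq: assumes "i < n" "j < n"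
  shows "U i j = (if bl i = bl j then root1 (sz i) ^ (lo i * lo j) / of_real (sqrt (of_nat (sz i))) else 0)"
  using assms bl_lo(2)[of i] bl_lo(2)[of j]
  by (cases "bl i = bl j") (simp_all add: U_def n_def diag_fourier_index fourier_mat_index)

lemma U_sym: "i < n \<Longrightarrow> j < n \<Longrightarrow> U i j = U j i"
  by (simp add: U_eq mult.commute)

lemma sum_block:
  fixes f :: "nat \<Rightarrow> 'x::comm_monoid_add"
  assumes b: "b < length ns" and f: "\<And>i. i < n \<Longrightarrow> bl i \<noteq> b \<Longrightarrow> f i = 0"
  shows "(\<Sum>i<n. f i) = (\<Sum>a<ns ! b. f (ix b a))"
proof -
  have "(\<Sum>i<n. f i) = (\<Sum>i\<in>{i. i < n \<and> bl i = b}. f i)"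
    by (rule sum.mono_neutral_right) (auto intro: f)
  also have "\<dots> = (\<Sum>a<ns ! b. f (ix b a))"
    by (rule sum.reindex_bij_witness[where i = "ix b" and j = lo]) (use b bl_lo ix in auto)
  finally show ?thesis .
qed

lemma rows_orthonormal: assumes "i < n" "j < n"
  shows "(\<Sum>k<n. U i k * cnj (U j k)) = (if i = j then 1 else 0)"
proof (cases "bl i = bl j")
  case False
  then show ?thesis using assms by (auto simp: U_eq intro!: sum.neutral)
next
  case True
  let ?r = "sz i"
  have r: "?r > 0" using assms bl_lo by (intro sz_pos) auto
  have "(\<Sum>k<n. U i k * cnj (U j k)) = (\<Sum>a<?r. U i (ix (bl i) a) * cnj (U j (ix (bl i) a)))"
    using assms bl_lo by (intro sum_block) (auto simp: U_eq)
  also have "\<dots> = (\<Sum>a<?r. root1 ?r ^ (lo i * a) * cnj (root1 ?r ^ (lo j * a)) / of_nat ?r)"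
  proof (rule sum.cong[OF HOL.refl])
    fix a assume "a \<in> {..<?r}"
    then have a: "ix (bl i) a < n" "bl (ix (bl i) a) = bl i" "lo (ix (bl i) a) = a"
      using ix[of "bl i" a] bl_lo assms by auto
    have "complex_of_real (sqrt (real ?r)) * complex_of_real (sqrt (real ?r)) = of_nat ?r"
      by (simp add: of_real_mult[symmetric] del: of_real_mult)
    then show "U i (ix (bl i) a) * cnj (U j (ix (bl i) a))
        = root1 ?r ^ (lo i * a) * cnj (root1 ?r ^ (lo j * a)) / of_nat ?r"
      using a assms True by (simp add: U_eq)
  qed
  also have "\<dots> = (if lo i = lo j then 1 else 0)"
  proof -
    have "lo i < ?r" "lo j < ?r" using assms bl_lo(2)[of i] bl_lo(2)[of j] True by simp_all
    then show ?thesis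
      by (simp only: sum_divide_distrib[symmetric] root1_orthogonal) (use r in simp)
  qed
  also have "\<dots> = (if i = j then 1 else 0)"
  proof -
    have "lo i = lo j \<longleftrightarrow> i = j" using bl_lo(3)[OF assms(1)] bl_lo(3)[OF assms(2)] True by metis
    then show ?thesis by simp
  qed
  finally show ?thesis .
qed

lemma cols_orthonormal: assumes "k < n" "l < n"
  shows "(\<Sum>i<n. cnj (U i k) * U i l) = (if k = l then 1 else 0)"
proof -
  have "(\<Sum>i<n. cnj (U i k) * U i l) = (\<Sum>i<n. U l i * cnj (U k i))"
    using assms by (intro sum.cong) (auto simp: U_sym mult.commute)
  then show ?thesis using rows_orthonormal[OF assms(2,1)] by auto
qed

text \<open>The first row of a block is constant, so the row sum is an inner product with that row.\<close>

lemma row_sum: assumes "i < n"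
  shows "(\<Sum>l<n. U i l) = (if lo i = 0 then of_real (sqrt (real (sz i))) else 0)"
proof -
  let ?r = "sz i"
  have b: "bl i < length ns" using assms bl_lo by auto
  then have r: "?r > 0" by (rule sz_pos)
  have zi: "ix (bl i) 0 < n" "bl (ix (bl i) 0) = bl i" "lo (ix (bl i) 0) = 0" using ix[OF b r] by auto
  have "U (ix (bl i) 0) l = (if bl l = bl i then 1 / of_real (sqrt (real ?r)) else 0)" if "l < n" for l
    using U_eq[OF zi(1) that] zi by simp
  then have "(\<Sum>l<n. U i l) = of_real (sqrt (real ?r)) * (\<Sum>l<n. U i l * cnj (U (ix (bl i) 0) l))"
    unfolding sum_distrib_left using assms r by (intro sum.cong) (auto simp: U_eq)
  also have "\<dots> = (if i = ix (bl i) 0 then of_real (sqrt (real ?r)) else 0)"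
    using rows_orthonormal[OF assms zi(1)] by simp
  also have "\<dots> = (if lo i = 0 then of_real (sqrt (real ?r)) else 0)"
  proof -
    have "i = ix (bl i) 0 \<longleftrightarrow> lo i = 0" using bl_lo(3)[OF assms] zi(3) by metis
    then show ?thesis by simp
  qed
  finally show ?thesis .
qed

end

section \<open>The magic relations and the spun generators\<close>

abbreviation square :: "nat \<Rightarrow> (nat \<times> nat) set" where "square N \<equiv> {..<N} \<times> {..<N}"

abbreviation gen :: "nat \<Rightarrow> nat \<Rightarrow> (nat \<times> nat) star_poly" where "gen k l \<equiv> free_gen (k, l)"

lemma row_polys [simp]: "i < N \<Longrightarrow> (\<Sum>j<N. gen i j) \<in> polys (square N)"
  and col_polys [simp]: "j < N \<Longrightarrow> (\<Sum>i<N. gen i j) \<in> polys (square N)"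
  by (auto intro!: polys_sum)

lemma ball_magic_relations:
  "(\<forall>r\<in>magic_relations N. Q r) \<longleftrightarrow>
    (\<forall>i<N. \<forall>j<N. Q (gen i j \<star> gen i j - gen i j)) \<and>
    (\<forall>i<N. \<forall>j<N. Q (adj (gen i j) - gen i j)) \<and>
    (\<forall>i<N. Q ((\<Sum>j<N. gen i j) - single [])) \<and>
    (\<forall>j<N. Q ((\<Sum>i<N. gen i j) - single []))"
  (is "?lhs \<longleftrightarrow> ?rhs")
proof -
  let ?F = "free_star_alg (square N)"
  have 1: "gen i j \<otimes>\<^bsub>?F\<^esub> gen i j \<ominus>\<^bsub>?F\<^esub> gen i j = gen i j \<star> gen i j - gen i j"
    and 2: "star ?F (gen i j) \<ominus>\<^bsub>?F\<^esub> gen i j = adj (gen i j) - gen i j" if "i < N" "j < N" for i j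
    using that by simp_all
  have 3: "(\<Oplus>\<^bsub>?F\<^esub>j\<in>{..<N}. gen i j) \<ominus>\<^bsub>?F\<^esub> \<one>\<^bsub>?F\<^esub> = (\<Sum>j<N. gen i j) - single []" if "i < N" for i
  proof -
    have "(\<Oplus>\<^bsub>?F\<^esub>j\<in>{..<N}. gen i j) = (\<Sum>j<N. gen i j)"
      using that by (intro free_finsum) auto
    then show ?thesis using that by simp
  qed
  have 4: "(\<Oplus>\<^bsub>?F\<^esub>i\<in>{..<N}. gen i j) \<ominus>\<^bsub>?F\<^esub> \<one>\<^bsub>?F\<^esub> = (\<Sum>i<N. gen i j) - single []" if "j < N" for j
  proof -
    have "(\<Oplus>\<^bsub>?F\<^esub>i\<in>{..<N}. gen i j) = (\<Sum>i<N. gen i j)"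
      using that by (intro free_finsum) auto
    then show ?thesis using that by simp
  qed
  have "?lhs \<longleftrightarrow>
    (\<forall>i<N. \<forall>j<N. Q (gen i j \<otimes>\<^bsub>?F\<^esub> gen i j \<ominus>\<^bsub>?F\<^esub> gen i j)) \<and>
    (\<forall>i<N. \<forall>j<N. Q (star ?F (gen i j) \<ominus>\<^bsub>?F\<^esub> gen i j)) \<and>
    (\<forall>i<N. Q ((\<Oplus>\<^bsub>?F\<^esub>j\<in>{..<N}. gen i j) \<ominus>\<^bsub>?F\<^esub> \<one>\<^bsub>?F\<^esub>)) \<and>
    (\<forall>j<N. Q ((\<Oplus>\<^bsub>?F\<^esub>i\<in>{..<N}. gen i j) \<ominus>\<^bsub>?F\<^esub> \<one>\<^bsub>?F\<^esub>))"
    unfolding magic_relations_def Let_def by blast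
  also have "\<dots> \<longleftrightarrow> ?rhs"
    by (simp only: 1 2 3 4 cong: imp_cong)
  finally show ?thesis .
qed

lemma magic_polys: "r \<in> magic_relations N \<Longrightarrow> r \<in> polys (square N)"
  using ball_magic_relations[of N "\<lambda>r. r \<in> polys (square N)"] by auto

lemma gen_adj: "adj (gen k l) = single [((k, l), True)]"
  by (simp add: free_gen_single adj_single flip_def)

interpretation magic: cstar_presentation "square N" "magic_relations N" for N
proof
  fix p x s
  assume "cstar_seminorm (free_star_alg (square N)) p" and rel: "\<forall>r\<in>magic_relations N. p r = 0"
    and "x \<in> square N"
  then interpret free_cstar_seminorm "square N" p by (simp add: free_cstar_seminorm_def)
  obtain k l where x: "x = (k, l)" "k < N" "l < N" using \<open>x \<in> square N\<close> by auto
  have g [simp]: "gen k l \<in> polys (square N)" using x by simp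
  have idem: "eqv (gen k l \<star> gen k l) (gen k l)" and sa: "eqv (adj (gen k l)) (gen k l)"
    using rel x by (auto simp: ball_magic_relations eqv_def)
  have "eqv (adj (gen k l) \<star> gen k l) (gen k l)"
    using eqv_trans[OF eqv_conv[OF sa, of "gen k l" "gen k l"] idem] by simp
  then have "p (gen k l) \<le> 1" by (intro p_le_1_of_idem) (auto dest: eqv_p)
  moreover have "p (adj (gen k l)) = p (gen k l)" by (simp add: p_adj)
  ultimately show "p (single [(x, s)]) \<le> 1"
    by (cases s) (simp_all add: x gen_adj free_gen_single[symmetric])
qed

context fourier_blocks
begin

abbreviation X where "X \<equiv> square n"
abbreviation P where "P \<equiv> univ_seminorm X (magic_relations n)"

lemma P_magic: "r \<in> magic_relations n \<Longrightarrow> P r = 0"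
  by (intro magic.P_relation magic_polys)

lemma gen_idem: "i < n \<Longrightarrow> j < n \<Longrightarrow> P (gen i j \<star> gen i j - gen i j) = 0"
  and gen_sa: "i < n \<Longrightarrow> j < n \<Longrightarrow> P (adj (gen i j) - gen i j) = 0"
  and gen_row: "i < n \<Longrightarrow> P ((\<Sum>j<n. gen i j) - single []) = 0"
  using P_magic ball_magic_relations[of n "\<lambda>r. P r = 0"] by auto

text \<open>The entries of a row are projections with sum \<open>1\<close> modulo the null elements of the largest C*-seminorm.\<close>

lemma gen_orthogonal:
  assumes "k < n" "l < n" "l' < n" "l \<noteq> l'" shows "P (gen k l \<star> gen k l') = 0"
proof -
  have "magic.eqv n (gen k l \<star> gen k l') 0"
    by (rule magic.projections_sum_1_orthogonal[of "{..<n}"])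
      (use assms in \<open>auto simp: magic.eqv_def gen_idem gen_sa gen_row\<close>)
  then show ?thesis by (simp add: magic.eqv_def)
qed

definition spun_poly :: "nat \<Rightarrow> nat \<Rightarrow> (nat \<times> nat) star_poly"
  where "spun_poly i j = (\<Sum>k<n. \<Sum>l<n. scal (U i k * cnj (U j l)) (gen k l))"

lemma spun_poly_polys [simp]: "spun_poly i j \<in> polys X"
  unfolding spun_poly_def by (intro polys_sum polys_scal polys_gen) auto

text \<open>The identity \<open>U\<^sup>* v = u U\<^sup>*\<close> in the free algebra, where \<open>v = U u U\<^sup>*\<close>.\<close>

lemma spun_poly_column: assumes "k < n" "j < n"
  shows "(\<Sum>i<n. scal (cnj (U i k)) (spun_poly i j)) = (\<Sum>l<n. scal (cnj (U j l)) (gen k l))"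
proof -
  have "(\<Sum>i<n. cnj (U i k) * (\<Sum>k'<n. \<Sum>l<n. U i k' * cnj (U j l) * c k' l)) = (\<Sum>l<n. cnj (U j l) * c k l)"
    for c :: "nat \<Rightarrow> nat \<Rightarrow> complex"
  proof -
    have "(\<Sum>i<n. cnj (U i k) * (\<Sum>k'<n. \<Sum>l<n. U i k' * cnj (U j l) * c k' l))
        = (\<Sum>i<n. \<Sum>k'<n. cnj (U i k) * U i k' * (\<Sum>l<n. cnj (U j l) * c k' l))"
      by (simp add: sum_distrib_left mult.assoc)
    also have "\<dots> = (\<Sum>k'<n. (\<Sum>i<n. cnj (U i k) * U i k') * (\<Sum>l<n. cnj (U j l) * c k' l))"
      by (subst sum.swap) (simp add: sum_distrib_right)
    also have "\<dots> = (\<Sum>k'<n. if k' = k then \<Sum>l<n. cnj (U j l) * c k' l else 0)"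
      using assms by (intro sum.cong) (auto simp: cols_orthonormal)
    finally show ?thesis using assms by simp
  qed
  then show ?thesis by (simp add: fun_ext_simps sum_fun_apply spun_poly_def)
qed

text \<open>The identity \<open>v U 1 = U u 1\<close>, where \<open>1\<close> is the vector with all entries \<open>1\<close>.\<close>

lemma spun_poly_row: assumes "i < n"
  shows "(\<Sum>j<n. scal (\<Sum>m<n. U j m) (spun_poly i j)) = (\<Sum>k<n. scal (U i k) (\<Sum>l<n. gen k l))"
proof -
  \<comment> \<open>The vector \<open>U\<^sup>* U 1\<close> is \<open>1\<close>.\<close>
  have one: "(\<Sum>j<n. (\<Sum>m<n. U j m) * cnj (U j l)) = 1" if "l < n" for l
  proof -
    have "(\<Sum>j<n. (\<Sum>m<n. U j m) * cnj (U j l)) = (\<Sum>m<n. \<Sum>j<n. cnj (U j l) * U j m)"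
      by (subst sum.swap) (simp add: sum_distrib_right sum_distrib_left mult.commute)
    then show ?thesis using that by (simp add: cols_orthonormal)
  qed
  have "(\<Sum>j<n. (\<Sum>m<n. U j m) * (\<Sum>k<n. \<Sum>l<n. U i k * cnj (U j l) * c k l)) = (\<Sum>k<n. U i k * (\<Sum>l<n. c k l))"
    for c :: "nat \<Rightarrow> nat \<Rightarrow> complex"
  proof -
    have "(\<Sum>j<n. (\<Sum>m<n. U j m) * (\<Sum>k<n. \<Sum>l<n. U i k * cnj (U j l) * c k l))
        = (\<Sum>j<n. \<Sum>k<n. \<Sum>l<n. (\<Sum>m<n. U j m) * cnj (U j l) * (U i k * c k l))"
      unfolding sum_distrib_left by (intro sum.cong HOL.refl) (simp add: mult_ac)
    also have "\<dots> = (\<Sum>k<n. \<Sum>l<n. \<Sum>j<n. (\<Sum>m<n. U j m) * cnj (U j l) * (U i k * c k l))"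
      by (subst sum.swap) (intro sum.cong HOL.refl sum.swap)
    also have "\<dots> = (\<Sum>k<n. \<Sum>l<n. U i k * c k l)"
      by (intro sum.cong HOL.refl) (simp only: sum_distrib_right[symmetric] one lessThan_iff mult_1)
    finally show ?thesis by (simp add: sum_distrib_left)
  qed
  then show ?thesis by (simp add: fun_ext_simps sum_fun_apply spun_poly_def)
qed

definition Umat :: "complex mat" where "Umat = diag_block_mat (map fourier_mat ns)"

abbreviation A where "A \<equiv> C_qperm n"
abbreviation I where "I \<equiv> diag_ideal A (qperm_gen n) n Umat"

lemma C_qperm_eq: "C_qperm n = completion (free_star_alg X) P"
  by (simp add: C_qperm_def univ_cstar_def)

lemma qperm_gen_eq: "qperm_gen n k l = magic.emb n (gen k l)"
  by (simp add: qperm_gen_def univ_gen_def magic.completion_emb_eq)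

lemma spun_eq: assumes "i < n" "j < n" shows "spun A (qperm_gen n) n Umat i j = magic.emb n (spun_poly i j)"
proof -
  interpret A: ring A unfolding C_qperm_eq by (rule magic.ring_A)
  have g: "scal c (gen k l) \<in> polys X" if "k < n" "l < n" for c k l using that by simp
  have c: "magic.emb n a \<in> carrier A" if "a \<in> polys X" for a
    unfolding C_qperm_eq using that by (rule magic.emb_carrier)
  have entry: "magic.emb n (scal (U i k * cnj (U j l)) (gen k l))
      = (Umat $$ (i, k) * cnj (Umat $$ (j, l))) \<odot>\<^bsub>A\<^esub> qperm_gen n k l" if "k < n" "l < n" for k l
    unfolding C_qperm_eq qperm_gen_eq U_def Umat_def using that by (intro magic.emb_scal) simp
  have inner: "magic.emb n (\<Sum>l<n. scal (U i k * cnj (U j l)) (gen k l))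
      = (\<Oplus>\<^bsub>A\<^esub>l\<in>{..<n}. (Umat $$ (i, k) * cnj (Umat $$ (j, l))) \<odot>\<^bsub>A\<^esub> qperm_gen n k l)" if k: "k < n" for k
  proof -
    have "magic.emb n (\<Sum>l<n. scal (U i k * cnj (U j l)) (gen k l))
        = (\<Oplus>\<^bsub>A\<^esub>l\<in>{..<n}. magic.emb n (scal (U i k * cnj (U j l)) (gen k l)))"
      unfolding C_qperm_eq using k by (intro magic.emb_sum) (auto intro!: g)
    also have "\<dots> = (\<Oplus>\<^bsub>A\<^esub>l\<in>{..<n}. (Umat $$ (i, k) * cnj (Umat $$ (j, l))) \<odot>\<^bsub>A\<^esub> qperm_gen n k l)"
    proof (rule A.finsum_cong'[OF HOL.refl])
      show "(\<lambda>l. (Umat $$ (i, k) * cnj (Umat $$ (j, l))) \<odot>\<^bsub>A\<^esub> qperm_gen n k l) \<in> {..<n} \<rightarrow> carrier A"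
        using k by (auto simp: entry[symmetric] intro!: c g)
    qed (use k entry in simp)
    finally show ?thesis .
  qed
  have "magic.emb n (spun_poly i j) = (\<Oplus>\<^bsub>A\<^esub>k\<in>{..<n}. magic.emb n (\<Sum>l<n. scal (U i k * cnj (U j l)) (gen k l)))"
    unfolding spun_poly_def C_qperm_eq by (rule magic.emb_sum) (auto intro!: polys_sum g)
  also have "\<dots> = (\<Oplus>\<^bsub>A\<^esub>k\<in>{..<n}. \<Oplus>\<^bsub>A\<^esub>l\<in>{..<n}. (Umat $$ (i, k) * cnj (Umat $$ (j, l))) \<odot>\<^bsub>A\<^esub> qperm_gen n k l)"
  proof (rule A.finsum_cong'[OF HOL.refl])
    show "(\<lambda>k. \<Oplus>\<^bsub>A\<^esub>l\<in>{..<n}. (Umat $$ (i, k) * cnj (Umat $$ (j, l))) \<odot>\<^bsub>A\<^esub> qperm_gen n k l) \<in> {..<n} \<rightarrow> carrier A"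
      by (auto simp: inner[symmetric] intro!: c polys_sum g)
  qed (simp add: inner)
  also have "\<dots> = spun A (qperm_gen n) n Umat i j" by (simp only: spun_def)
  finally show ?thesis by simp
qed

end

section \<open>The group relations in the diagonal quotient\<close>

context fourier_blocks
begin

lemma spun_poly_emb_carrier: "{magic.emb n (spun_poly i j) |i j. i < n \<and> j < n \<and> i \<noteq> j} \<subseteq> carrier (completion (free_star_alg X) P)"
  by (auto intro!: magic.emb_carrier)

lemma I_eq: "I = closed_ideal_gen (completion (free_star_alg X) P) {magic.emb n (spun_poly i j) |i j. i < n \<and> j < n \<and> i \<noteq> j}"
proof -
  have "{spun A (qperm_gen n) n Umat i j |i j. i < n \<and> j < n \<and> i \<noteq> j} = {magic.emb n (spun_poly i j) |i j. i < n \<and> j < n \<and> i \<noteq> j}"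
    by (intro Collect_cong ex_cong1) (auto simp: spun_eq)
  then show ?thesis by (simp add: diag_ideal_def C_qperm_eq)
qed

sublocale quot: quotient_map X P I
proof (rule quotient_map.intro)
  show "free_cstar_seminorm X P"
    by (simp add: free_cstar_seminorm_def magic.P_cstar_seminorm)
  show "quotient_map_axioms X P I"
    unfolding quotient_map_axioms_def I_eq by (rule magic.ideal_closed_ideal_gen(1)[OF spun_poly_emb_carrier])
qed

lemma spun_poly_off_diagonal: assumes "i < n" "j < n" "i \<noteq> j" shows "spun_poly i j \<in> quot.K"
proof -
  have "magic.emb n (spun_poly i j) \<in> I"
    unfolding I_eq using magic.ideal_closed_ideal_gen(2)[OF spun_poly_emb_carrier] assms by blast
  then show ?thesis by (simp add: quot.K_def)
qed

lemma diag_gen_eq: "i < n \<Longrightarrow> diag_gen A (qperm_gen n) n Umat i = quot.\<theta> (spun_poly i i)"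
  by (simp only: diag_gen_def spun_eq quot.\<theta>_def) (simp only: C_qperm_eq)

text \<open>The Fourier transform of the first row of block \<open>b\<close> of \<open>u\<close>, at frequency \<open>m\<close>.\<close>

definition block_gen :: "nat \<Rightarrow> nat \<Rightarrow> (nat \<times> nat) star_poly"
  where "block_gen b m = (\<Sum>a<ns ! b. scal (cnj (root1 (ns ! b)) ^ (m * a)) (gen (ix b 0) (ix b a)))"

lemma block_gen_polys [simp]: "b < length ns \<Longrightarrow> block_gen b m \<in> polys X"
  unfolding block_gen_def using ix(1) sz_pos by (intro polys_sum polys_scal polys_gen) auto

text \<open>This is entry \<open>(k, j)\<close> of \<open>U\<^sup>* v = u U\<^sup>*\<close> modulo the off-diagonal entries of \<open>v\<close>, where \<open>k\<close> is the first
position in the block of \<open>j\<close>. Both sides carry the factor \<open>1/\<surd>r\<close>, since \<open>U\<^sub>j\<^sub>k = 1/\<surd>r\<close>.\<close>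

lemma spun_poly_diagonal: assumes j: "j < n" shows "spun_poly j j - block_gen (bl j) (lo j) \<in> quot.K"
proof -
  let ?b = "bl j" and ?r = "sz j"
  define s where "s = complex_of_real (sqrt (real ?r))"
  have b: "?b < length ns" using bl_lo j by auto
  have r: "?r > 0" using sz_pos[OF b] .
  have s: "s \<noteq> 0" "cnj s = s" using r by (auto simp: s_def)
  define k where "k = ix ?b 0"
  have k: "k < n" "bl k = ?b" "lo k = 0" using ix[OF b r] by (auto simp: k_def)
  \<comment> \<open>The first column of a Fourier block is constant.\<close>
  have Uk: "U j k = 1 / s" using U_eq[OF j k(1)] k by (simp add: s_def)
  have Ua: "U j (ix ?b a) = root1 ?r ^ (lo j * a) / s" if "a < ?r" for a
    using U_eq[OF j ix(1)[OF b that]] ix[OF b that] by (simp add: s_def)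
  let ?rest = "\<Sum>i\<in>{..<n} - {j}. scal (cnj (U i k)) (spun_poly i j)"
  have "(\<Sum>i<n. scal (cnj (U i k)) (spun_poly i j)) = scal (cnj (U j k)) (spun_poly j j) + ?rest"
    using j by (subst sum.remove[of _ j]) auto
  moreover have "(\<Sum>l<n. scal (cnj (U j l)) (gen k l)) = (\<Sum>a<?r. scal (cnj (U j (ix ?b a))) (gen k (ix ?b a)))"
    using j b by (intro sum_block) (auto simp: U_eq)
  ultimately have "scal (cnj (U j k)) (spun_poly j j) + ?rest = (\<Sum>a<?r. scal (cnj (U j (ix ?b a))) (gen k (ix ?b a)))"
    using spun_poly_column[OF k(1) j] by simp
  then have "scal s (scal (cnj (U j k)) (spun_poly j j) + ?rest) = scal s (\<Sum>a<?r. scal (cnj (U j (ix ?b a))) (gen k (ix ?b a)))"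
    by simp
  moreover have "scal s (scal (cnj (U j k)) (spun_poly j j) + ?rest) = spun_poly j j + scal s ?rest"
    using s by (simp add: scal_add Uk)
  moreover have "scal s (\<Sum>a<?r. scal (cnj (U j (ix ?b a))) (gen k (ix ?b a))) = block_gen ?b (lo j)"
    unfolding block_gen_def scal_sum using s by (intro sum.cong) (auto simp: Ua k_def)
  ultimately have "block_gen ?b (lo j) = spun_poly j j + scal s ?rest" by (simp only:)
  then have "spun_poly j j - block_gen ?b (lo j) = 0 - scal s ?rest" by simp
  moreover have "?rest \<in> quot.K"
    using j by (intro quot.K_sum quot.K_scal spun_poly_off_diagonal) auto
  ultimately show ?thesis by (simp only: quot.K_scal quot.K_diff quot.K_zero)
qed

text \<open>As \<open>u 1 = 1\<close> by the row relations, the identity \<open>v U 1 = U u 1\<close> becomes \<open>v\<^sub>i\<^sub>i (U 1)\<^sub>i = (U 1)\<^sub>i\<close> where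
\<open>v\<close> is diagonal. At the first position of a block \<open>(U 1)\<^sub>i\<close> does not vanish.\<close>

lemma spun_poly_first: assumes b: "b < length ns" shows "spun_poly (ix b 0) (ix b 0) - single [] \<in> quot.K"
proof -
  define i where "i = ix b 0"
  define s where "s j = (\<Sum>m<n. U j m)" for j
  have r: "ns ! b > 0" using sz_pos[OF b] .
  have i: "i < n" "bl i = b" "lo i = 0" using ix[OF b r] by (auto simp: i_def)
  have si: "s i \<noteq> 0" using row_sum[OF i(1)] i r by (simp add: s_def)
  let ?rest = "\<Sum>j\<in>{..<n} - {i}. scal (s j) (spun_poly i j)"
  let ?rows = "\<Sum>k<n. scal (U i k) ((\<Sum>l<n. gen k l) - single [])"
  have "(\<Sum>j<n. scal (s j) (spun_poly i j)) = scal (s i) (spun_poly i i) + ?rest"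
    using i by (subst sum.remove[of _ i]) auto
  moreover have "(\<Sum>k<n. scal (U i k) (\<Sum>l<n. gen k l)) = ?rows + scal (s i) (single [])"
    by (simp add: fun_ext_simps sum_fun_apply s_def right_diff_distrib sum_subtractf sum_distrib_right)
  ultimately have "scal (s i) (spun_poly i i) + ?rest = ?rows + scal (s i) (single [])"
    using spun_poly_row[OF i(1)] by (simp add: s_def)
  then have eq: "scal (s i) (spun_poly i i - single []) = ?rows - ?rest"
    by (simp add: scal_diff algebra_simps)
  have "?rows - ?rest \<in> quot.K"
    using i by (intro quot.K_diff quot.K_sum quot.K_scal spun_poly_off_diagonal quot.K_null)
      (auto simp: gen_row)
  then have "scal (1 / s i) (scal (s i) (spun_poly i i - single [])) \<in> quot.K"
    unfolding eq by (rule quot.K_scal)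
  then show ?thesis using si by (simp add: i_def)
qed

text \<open>In the product of two Fourier transforms the mixed terms vanish by orthogonality, and the diagonal
terms are projections whose coefficients multiply.\<close>

lemma block_gen_mult: assumes b: "b < length ns" shows "block_gen b m \<star> block_gen b m' - block_gen b (m + m') \<in> quot.K"
proof -
  let ?r = "ns ! b" and ?e = "\<lambda>a. gen (ix b 0) (ix b a)"
  define c where "c = cnj (root1 ?r)"
  have e: "?e a \<in> polys X" if "a < ?r" for a using ix(1)[OF b] sz_pos[OF b] that by simp
  define t where "t a a' = scal (c ^ (m * a) * c ^ (m' * a')) (?e a \<star> ?e a')" for a a'
  define d where "d a = scal (c ^ ((m + m') * a)) (?e a)" for a
  have "block_gen b m \<star> block_gen b m' = (\<Sum>a<?r. \<Sum>a'<?r. t a a')"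
    unfolding block_gen_def t_def c_def
    by (subst sum.swap) (simp add: conv_sum_left conv_sum_right conv_scal_left conv_scal_right scal_sum mult.commute)
  moreover have "block_gen b (m + m') = (\<Sum>a<?r. \<Sum>a'<?r. if a' = a then d a else 0)"
    by (simp add: block_gen_def d_def c_def)
  ultimately have "block_gen b m \<star> block_gen b m' - block_gen b (m + m') = (\<Sum>a<?r. \<Sum>a'<?r. t a a' - (if a' = a then d a else 0))"
    by (simp only: sum_subtractf)
  moreover have "t a a' - (if a' = a then d a else 0) \<in> quot.K" if a: "a < ?r" "a' < ?r" for a a'
  proof (cases "a' = a")
    case True
    have "?e a \<star> ?e a - ?e a \<in> quot.K"
      using e[OF a(1)] ix(1)[OF b a(1)] ix(1)[OF b sz_pos[OF b]]
      by (intro quot.K_null gen_idem) auto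
    moreover have "t a a' - (if a' = a then d a else 0) = scal (c ^ ((m + m') * a)) (?e a \<star> ?e a - ?e a)"
      using True by (simp add: t_def d_def scal_diff power_add[symmetric] distrib_right)
    ultimately show ?thesis by (simp add: quot.K_scal)
  next
    case False
    then have "ix b a \<noteq> ix b a'" using ix(3)[OF b] a by metis
    then have "?e a \<star> ?e a' \<in> quot.K"
      using e a ix(1)[OF b] sz_pos[OF b] by (intro quot.K_null gen_orthogonal) auto
    then show ?thesis using False by (simp add: t_def quot.K_scal)
  qed
  ultimately show ?thesis by (auto intro!: quot.K_sum)
qed

lemma block_gen_mod: assumes b: "b < length ns" shows "block_gen b (m mod (ns ! b)) = block_gen b m"
proof -
  let ?r = "ns ! b"
  have "cnj (root1 ?r) ^ ?r = 1"
    using root1_r[OF sz_pos[OF b]] by (metis complex_cnj_power complex_cnj_one)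
  moreover have "cnj (root1 ?r) ^ m = (cnj (root1 ?r) ^ ?r) ^ (m div ?r) * cnj (root1 ?r) ^ (m mod ?r)"
    by (simp add: power_mult[symmetric] power_add[symmetric])
  ultimately have "cnj (root1 ?r) ^ m = cnj (root1 ?r) ^ (m mod ?r)" by simp
  then show ?thesis by (simp add: block_gen_def power_mult)
qed

definition grp_gen :: "nat \<Rightarrow> nat \<Rightarrow> (nat \<Rightarrow> (nat \<times> nat) star_poly) set set"
  where "grp_gen b m = quot.\<theta> (block_gen b m)"

lemma grp_gen_mult: "b < length ns \<Longrightarrow> grp_gen b m \<otimes>\<^bsub>quot.Q\<^esub> grp_gen b m' = grp_gen b (m + m')"
  using block_gen_mult[of b m m'] by (simp add: grp_gen_def quot.\<theta>_mult[symmetric] quot.\<theta>_eq_iff)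

lemma grp_gen_zero: assumes b: "b < length ns" shows "grp_gen b 0 = \<one>\<^bsub>quot.Q\<^esub>"
proof -
  have i: "ix b 0 < n" "bl (ix b 0) = b" "lo (ix b 0) = 0" using ix[OF b sz_pos[OF b]] .
  have "spun_poly (ix b 0) (ix b 0) - block_gen b 0 \<in> quot.K" using spun_poly_diagonal[OF i(1)] i by simp
  then have "quot.\<theta> (spun_poly (ix b 0) (ix b 0)) = quot.\<theta> (block_gen b 0)" using b by (simp add: quot.\<theta>_eq_iff)
  then have "quot.\<theta> (block_gen b 0) = quot.\<theta> (spun_poly (ix b 0) (ix b 0))" by (rule HOL.sym)
  also have "\<dots> = quot.\<theta> (single [])" using spun_poly_first[OF b] by (simp add: quot.\<theta>_eq_iff)
  finally show ?thesis by (simp add: grp_gen_def quot.\<theta>_one)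
qed

lemma grp_gen_mod: "b < length ns \<Longrightarrow> grp_gen b (m mod (ns ! b)) = grp_gen b m"
  by (simp add: grp_gen_def block_gen_mod)

lemma grp_gen_Units: assumes b: "b < length ns" shows "grp_gen b m \<in> Units quot.Q"
proof -
  \<comment> \<open>The inverse is the power with exponent \<open>r - 1\<close>.\<close>
  have "grp_gen b (ns ! b * m) = \<one>\<^bsub>quot.Q\<^esub>"
    using grp_gen_mod[OF b, of "ns ! b * m"] grp_gen_zero[OF b] by simp
  moreover have "m + (ns ! b - 1) * m = ns ! b * m" "(ns ! b - 1) * m + m = ns ! b * m"
    using sz_pos[OF b] by (simp_all add: mult_eq_if)
  ultimately have "grp_gen b m \<otimes>\<^bsub>quot.Q\<^esub> grp_gen b ((ns ! b - 1) * m) = \<one>\<^bsub>quot.Q\<^esub>"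
      "grp_gen b ((ns ! b - 1) * m) \<otimes>\<^bsub>quot.Q\<^esub> grp_gen b m = \<one>\<^bsub>quot.Q\<^esub>"
    using b by (simp_all only: grp_gen_mult)
  moreover have "grp_gen b k \<in> carrier quot.Q" for k using b by (simp add: grp_gen_def)
  ultimately show ?thesis by (auto simp: Units_def)
qed

lemma diag_gen_grp_gen: assumes "i < n" shows "diag_gen A (qperm_gen n) n Umat i = grp_gen (bl i) (lo i)"
  using spun_poly_diagonal[OF assms] assms bl_lo(1) by (simp add: diag_gen_eq grp_gen_def quot.\<theta>_eq_iff)

definition grp_hom :: "nat \<Rightarrow> int \<Rightarrow> (nat \<Rightarrow> (nat \<times> nat) star_poly) set set"
  where "grp_hom b x = grp_gen b (nat x)"

lemma grp_hom_hom: assumes b: "b < length ns" shows "grp_hom b \<in> hom (integer_mod_group (ns ! b)) (units_of quot.Q)"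
proof (rule homI)
  fix x y assume "x \<in> carrier (integer_mod_group (ns ! b))" "y \<in> carrier (integer_mod_group (ns ! b))"
  then have xy: "0 \<le> x" "0 \<le> y" using sz_pos[OF b] by (auto simp: carrier_integer_mod_group)
  have "nat ((x + y) mod int (ns ! b)) = (nat x + nat y) mod (ns ! b)"
    using xy by (simp add: nat_mod_distrib nat_add_distrib)
  then show "grp_hom b (x \<otimes>\<^bsub>integer_mod_group (ns ! b)\<^esub> y) = grp_hom b x \<otimes>\<^bsub>units_of quot.Q\<^esub> grp_hom b y"
    using b by (simp add: grp_hom_def units_of_mult grp_gen_mult grp_gen_mod)
qed (use b in \<open>simp add: grp_hom_def units_of_carrier grp_gen_Units\<close>)

lemma generators_eq:
  "diag_gen A (qperm_gen n) n Umat ` {..<n} = (\<Union>b\<in>{..<length ns}. grp_hom b ` carrier (integer_mod_group (ns ! b)))"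
proof (intro equalityI subsetI)
  fix y assume "y \<in> diag_gen A (qperm_gen n) n Umat ` {..<n}"
  then obtain i where i: "i < n" "y = grp_gen (bl i) (lo i)" by (auto simp: diag_gen_grp_gen)
  then have "bl i < length ns" "int (lo i) \<in> carrier (integer_mod_group (sz i))" "y = grp_hom (bl i) (int (lo i))"
    using bl_lo by (auto simp: carrier_integer_mod_group grp_hom_def)
  then show "y \<in> (\<Union>b\<in>{..<length ns}. grp_hom b ` carrier (integer_mod_group (ns ! b)))" by blast
next
  fix y assume "y \<in> (\<Union>b\<in>{..<length ns}. grp_hom b ` carrier (integer_mod_group (ns ! b)))"
  then obtain b x where b: "b < length ns" and x: "x \<in> carrier (integer_mod_group (ns ! b))" and y: "y = grp_gen b (nat x)"
    by (auto simp: grp_hom_def)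
  then have "nat x < ns ! b" using sz_pos[OF b] by (auto simp: carrier_integer_mod_group split: if_splits)
  from ix[OF b this] have "ix b (nat x) < n" "diag_gen A (qperm_gen n) n Umat (ix b (nat x)) = y"
    by (simp_all add: diag_gen_grp_gen y)
  then show "y \<in> diag_gen A (qperm_gen n) n Umat ` {..<n}" by blast
qed

end

section \<open>The magic unitary of the regular representation\<close>

lemma support_comp: assumes "bij \<sigma>" shows "{y. h y \<noteq> 0} = \<sigma> ` {x. h (\<sigma> x) \<noteq> (0::complex)}"
  using assms by (auto simp: image_iff bij_def surj_def)

lemma fins_comp: assumes "bij \<sigma>" "h \<in> fins" shows "h \<circ> \<sigma> \<in> fins"
proof -
  have "finite (\<sigma> -` {y. h y \<noteq> 0})"
    using assms by (intro finite_vimageI) (auto simp: fins_def bij_def)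
  moreover have "\<sigma> -` {y. h y \<noteq> 0} = {x. (h \<circ> \<sigma>) x \<noteq> 0}" by auto
  ultimately show ?thesis by (simp add: fins_def)
qed

lemma ip_comp: assumes "bij \<sigma>" shows "ip (h \<circ> \<sigma>) (k \<circ> \<sigma>) = ip h k"
proof -
  have "ip h k = (\<Sum>y\<in>\<sigma> ` {x. h (\<sigma> x) \<noteq> 0}. h y * cnj (k y))"
    unfolding ip_def using support_comp[OF assms, of h] by simp
  also have "\<dots> = (\<Sum>x | h (\<sigma> x) \<noteq> 0. h (\<sigma> x) * cnj (k (\<sigma> x)))"
    using assms by (subst sum.reindex) (auto simp: bij_def inj_on_def)
  finally show ?thesis by (simp add: ip_def)
qed

lemma nrm_comp: assumes "bij \<sigma>" shows "nrm (h \<circ> \<sigma>) = nrm h"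
proof -
  have "complex_of_real ((nrm (h \<circ> \<sigma>))\<^sup>2) = complex_of_real ((nrm h)\<^sup>2)"
    using ip_comp[OF assms, of h h] by (simp only: ip_self)
  then have "(nrm (h \<circ> \<sigma>))\<^sup>2 = (nrm h)\<^sup>2" by (simp only: of_real_eq_iff)
  then show ?thesis by simp
qed

context group
begin

text \<open>Left translation by \<open>g\<close>, extended by the identity outside the carrier so that it is a permutation of
the whole type.\<close>

definition mov :: "'a \<Rightarrow> 'a \<Rightarrow> 'a"
  where "mov g x = (if x \<in> carrier G then g \<otimes> x else x)"

definition reg :: "'a \<Rightarrow> ('a \<Rightarrow> complex) \<Rightarrow> 'a \<Rightarrow> complex"
  where "reg g h = h \<circ> mov (inv g)"

lemma mov_mult: "g \<in> carrier G \<Longrightarrow> g' \<in> carrier G \<Longrightarrow> mov g (mov g' x) = mov (g \<otimes> g') x"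
  by (simp add: mov_def m_assoc)

lemma mov_one: "mov \<one> x = x"
  by (simp add: mov_def)

lemma bij_mov: assumes g: "g \<in> carrier G" shows "bij (mov g)"
proof (rule o_bij[of "mov (inv g)"])
  show "mov (inv g) \<circ> mov g = id" "mov g \<circ> mov (inv g) = id"
    using g by (auto simp: fun_eq_iff mov_mult mov_one)
qed

lemma reg_fins: "g \<in> carrier G \<Longrightarrow> h \<in> fins \<Longrightarrow> reg g h \<in> fins"
  by (simp add: reg_def fins_comp bij_mov)

lemma reg_nrm: "g \<in> carrier G \<Longrightarrow> nrm (reg g h) = nrm h"
  by (simp add: reg_def nrm_comp bij_mov)

lemma reg_add: "reg g (h + k) = reg g h + reg g k"
  and reg_scal: "reg g (scal c h) = scal c (reg g h)"
  by (auto simp: reg_def fun_ext_simps)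

lemma reg_sum: "reg g (sum h S) = (\<Sum>i\<in>S. reg g (h i))"
  by (auto simp: reg_def fun_ext_simps sum_fun_apply)

lemma reg_one: "reg \<one> h = h"
  by (auto simp: reg_def fun_eq_iff mov_one)

lemma reg_mult: "g \<in> carrier G \<Longrightarrow> g' \<in> carrier G \<Longrightarrow> reg g (reg g' h) = reg (g \<otimes> g') h"
  by (auto simp: reg_def fun_eq_iff mov_mult inv_mult_group)

text \<open>Translations preserve the inner product.\<close>

lemma reg_adj: assumes g: "g \<in> carrier G" shows "ip (reg g h) k = ip h (reg (inv g) k)"
proof -
  have "ip (reg g h) (reg g (reg (inv g) k)) = ip h (reg (inv g) k)"
    unfolding reg_def[of g] using g by (intro ip_comp bij_mov) simp
  then show ?thesis using g by (simp add: reg_mult reg_one)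
qed

lemma reg_single: assumes "g \<in> carrier G" "x \<in> carrier G" shows "reg g (single x) = single (g \<otimes> x)"
proof
  fix y
  have "mov (inv g) y = x \<longleftrightarrow> y = g \<otimes> x"
    using assms by (auto simp: mov_def m_assoc[symmetric])
  then show "reg g (single x) y = single (g \<otimes> x) y" by (simp add: reg_def single_def)
qed

end

lemma sum_shift_periodic:
  fixes F :: "nat \<Rightarrow> 'x::comm_monoid_add"
  assumes per: "\<And>m. F (m + r) = F m" shows "(\<Sum>m<r. F (a + m)) = (\<Sum>m<r. F m)"
proof (induction a)
  case (Suc a)
  have "(\<Sum>m<r. F (Suc a + m)) = (\<Sum>m<r. F (a + m))"
  proof (cases r)
    case (Suc s)
    have "(\<Sum>m<r. F (Suc a + m)) = (\<Sum>m<s. F (a + Suc m)) + F (a + r)"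
      using Suc by simp
    also have "F (a + r) = F (a + 0)" using per by simp
    also have "(\<Sum>m<s. F (a + Suc m)) + F (a + 0) = (\<Sum>m<r. F (a + m))"
      unfolding Suc sum.lessThan_Suc_shift[of "\<lambda>m. F (a + m)"] by (rule add.commute)
    finally show ?thesis .
  qed simp
  then show ?case using Suc.IH by simp
qed simp

context fourier_blocks
begin

abbreviation Gs :: "nat \<Rightarrow> int monoid" where "Gs \<equiv> \<lambda>b. integer_mod_group (ns ! b)"

sublocale fam: free_product_family "{..<length ns}" Gs
  by (rule free_product_family.intro) simp

sublocale FP: group "free_product {..<length ns} Gs"
  by (rule fam.group_FP)

definition \<gamma> :: "nat \<Rightarrow> nat \<Rightarrow> (nat \<times> int) list set"
  where "\<gamma> b m = fam.cls [(b, int m mod int (ns ! b))]"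

lemma mod_carrier: "b < length ns \<Longrightarrow> int m mod int (ns ! b) \<in> carrier (Gs b)"
  using sz_pos[of b] by (simp add: carrier_integer_mod_group)

lemma \<gamma>_carrier [simp]: "b < length ns \<Longrightarrow> \<gamma> b m \<in> carrier fam.FP"
  unfolding fam.carrier_FP \<gamma>_def by (intro imageI) (simp add: mod_carrier)

lemma \<gamma>_mult: assumes b: "b < length ns" shows "\<gamma> b m \<otimes>\<^bsub>fam.FP\<^esub> \<gamma> b m' = \<gamma> b (m + m')"
proof -
  have "fp_eq {..<length ns} Gs ([] @ [(b, int m mod int (ns ! b)), (b, int m' mod int (ns ! b))] @ [])
      ([] @ [(b, int m mod int (ns ! b) \<otimes>\<^bsub>Gs b\<^esub> (int m' mod int (ns ! b)))] @ [])"
    using b by (intro fp_eq.mult mod_carrier) auto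
  then have "fam.cls [(b, int m mod int (ns ! b)), (b, int m' mod int (ns ! b))] = \<gamma> b (m + m')"
    using b by (simp add: \<gamma>_def fam.cls_eq_iff mod_carrier mod_add_eq)
  then show ?thesis using b by (simp add: \<gamma>_def fam.FP_mult mod_carrier)
qed

lemma \<gamma>_zero: assumes b: "b < length ns" shows "\<gamma> b 0 = \<one>\<^bsub>fam.FP\<^esub>"
proof -
  have "fp_eq {..<length ns} Gs ([] @ [(b, \<one>\<^bsub>Gs b\<^esub>)] @ []) ([] @ [])"
    using b by (intro fp_eq.unit) auto
  then show ?thesis using b mod_carrier[OF b, of 0] by (simp add: \<gamma>_def fam.FP_one fam.cls_eq_iff)
qed

lemma \<gamma>_mod: "\<gamma> b (m mod (ns ! b)) = \<gamma> b m" "\<gamma> b (m + ns ! b) = \<gamma> b m"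
  by (simp_all add: \<gamma>_def zmod_int)

abbreviation \<gamma>i where "\<gamma>i i \<equiv> \<gamma> (bl i) (lo i)"

text \<open>Entry \<open>(k, l)\<close> of \<open>U\<^sup>* diag(\<lambda>(\<gamma>)) U\<close>, where \<open>\<lambda>\<close> is the left regular representation.\<close>

definition magic_op :: "nat \<Rightarrow> nat \<Rightarrow> ((nat \<times> int) list set \<Rightarrow> complex) \<Rightarrow> (nat \<times> int) list set \<Rightarrow> complex"
  where "magic_op k l h = (\<Sum>i<n. scal (cnj (U i k) * U i l) (FP.reg (\<gamma>i i) h))"

lemma \<gamma>i_carrier [simp]: "i < n \<Longrightarrow> \<gamma>i i \<in> carrier fam.FP"
  by (simp add: bl_lo)

lemma magic_op_fins: "h \<in> fins \<Longrightarrow> magic_op k l h \<in> fins"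
  unfolding magic_op_def by (intro fins_sum fins_scal FP.reg_fins) auto

lemma magic_op_add: "magic_op k l (h + h') = magic_op k l h + magic_op k l h'"
  by (simp add: magic_op_def FP.reg_add scal_add sum.distrib)

lemma magic_op_scal: "magic_op k l (scal c h) = scal c (magic_op k l h)"
  by (simp add: magic_op_def FP.reg_scal scal_sum mult.commute)

lemma magic_op_bound: assumes "h \<in> fins" shows "nrm (magic_op k l h) \<le> (\<Sum>i<n. cmod (cnj (U i k) * U i l)) * nrm h"
proof -
  have "nrm (magic_op k l h) \<le> (\<Sum>i<n. nrm (scal (cnj (U i k) * U i l) (FP.reg (\<gamma>i i) h)))"
    unfolding magic_op_def using assms by (intro nrm_sum fins_scal FP.reg_fins) auto
  also have "\<dots> = (\<Sum>i<n. cmod (cnj (U i k) * U i l)) * nrm h"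
    unfolding sum_distrib_right by (intro sum.cong HOL.refl) (simp add: nrm_scal FP.reg_nrm)
  finally show ?thesis .
qed

text \<open>The index whose group element is inverse to that of \<open>i\<close>. It also conjugates the rows of \<open>U\<close>, which
makes the entries of \<open>U\<^sup>* diag(\<lambda>(\<gamma>)) U\<close> self-adjoint.\<close>

definition neg :: "nat \<Rightarrow> nat"
  where "neg i = ix (bl i) ((sz i - lo i) mod sz i)"

lemma neg: assumes i: "i < n" shows "neg i < n" "bl (neg i) = bl i" "lo (neg i) = (sz i - lo i) mod sz i"
  using ix[of "bl i" "(sz i - lo i) mod sz i"] bl_lo(1)[OF i] sz_pos[of "bl i"] by (simp_all add: neg_def)

lemma neg_neg: assumes i: "i < n" shows "neg (neg i) = i"
proof -
  have "(sz i - (sz i - lo i) mod sz i) mod sz i = lo i"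
    using bl_lo(2)[OF i] by (cases "lo i = 0") auto
  then have "neg (neg i) = ix (bl i) (lo i)"
    using neg[OF i] by (simp add: neg_def[of "neg i"])
  then show ?thesis using bl_lo(3)[OF i] by simp
qed

lemma \<gamma>_neg: assumes i: "i < n" shows "\<gamma>i (neg i) = inv\<^bsub>fam.FP\<^esub> (\<gamma>i i)"
proof (rule FP.inv_equality[symmetric])
  have "\<gamma>i (neg i) = \<gamma> (bl i) (sz i - lo i)" using neg[OF i] by (simp add: \<gamma>_mod)
  moreover have "sz i - lo i + lo i = 0 + sz i" using bl_lo(2)[OF i] by simp
  ultimately show "\<gamma>i (neg i) \<otimes>\<^bsub>fam.FP\<^esub> \<gamma>i i = \<one>\<^bsub>fam.FP\<^esub>"
    using bl_lo(1)[OF i] \<gamma>_mod(2)[of "bl i" 0] by (simp add: \<gamma>_mult \<gamma>_zero)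
qed (use i neg(1)[OF i] in auto)

lemma U_neg: assumes i: "i < n" and k: "k < n" shows "U (neg i) k = cnj (U i k)"
proof (cases "bl i = bl k")
  case True
  let ?r = "sz i"
  have r: "?r > 0" using sz_pos bl_lo(1)[OF i] by simp
  have "root1 ?r ^ (((?r - lo i) mod ?r) * lo k) = cnj (root1 ?r ^ (lo i * lo k))"
  proof -
    have m: "root1 ?r ^ (x mod ?r) = root1 ?r ^ x" for x
    proof -
      have "root1 ?r ^ x = (root1 ?r ^ ?r) ^ (x div ?r) * root1 ?r ^ (x mod ?r)"
        by (simp add: power_mult[symmetric] power_add[symmetric])
      then show ?thesis using root1_r[OF r] by simp
    qed
    have "root1 ?r ^ (?r - lo i) * root1 ?r ^ lo i = 1"
      using bl_lo(2)[OF i] root1_r[OF r] by (simp add: power_add[symmetric])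
    moreover have "root1 ?r ^ lo i * cnj (root1 ?r) ^ lo i = 1"
      by (simp add: power_mult_distrib[symmetric] root1_cnj)
    ultimately have "root1 ?r ^ (?r - lo i) = cnj (root1 ?r) ^ lo i"
      by (metis mult.assoc mult.left_neutral mult.right_neutral)
    then show ?thesis by (simp add: power_mult m)
  qed
  then show ?thesis using True i k neg[OF i] by (simp add: U_eq)
qed (use i k neg[OF i] in \<open>simp add: U_eq\<close>)

lemma magic_op_adj: assumes "k < n" "l < n" "h \<in> fins" shows "ip (magic_op k l h) h' = ip h (magic_op k l h')"
proof -
  have "ip (magic_op k l h) h' = (\<Sum>i<n. cnj (U i k) * U i l * ip h (FP.reg (inv\<^bsub>fam.FP\<^esub> (\<gamma>i i)) h'))"
    unfolding magic_op_def using assms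
    by (subst ip_sum_left) (auto simp: ip_scal_left FP.reg_adj intro!: fins_scal FP.reg_fins)
  also have "\<dots> = (\<Sum>i<n. cnj (cnj (U i k) * U i l) * ip h (FP.reg (\<gamma>i i) h'))"
    by (rule sum.reindex_bij_witness[where i = neg and j = neg])
      (use assms in \<open>auto simp: neg neg_neg \<gamma>_neg[symmetric] U_neg\<close>)
  also have "\<dots> = ip h (magic_op k l h')"
    by (simp add: magic_op_def ip_sum_right ip_scal_right)
  finally show ?thesis .
qed

lemma magic_op_zero: assumes "k < n" "l < n" "bl k \<noteq> bl l" shows "magic_op k l h = 0"
  unfolding magic_op_def using assms by (intro sum.neutral) (auto simp: U_eq)

text \<open>Inside a block, \<open>U\<^sup>* diag(\<lambda>(\<gamma>)) U\<close> is circulant: its entries are the spectral projections of the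
translation by a generator of the cyclic group, for the eigenvalues given by powers of \<open>\<xi>\<close>.\<close>

lemma magic_op_block:
  assumes "k < n" "l < n" "bl l = bl k"
  shows "magic_op k l h = scal (1 / of_nat (sz k)) (\<Sum>a<sz k.
      scal ((cnj (root1 (sz k)) ^ lo k * root1 (sz k) ^ lo l) ^ a) (FP.reg (\<gamma> (bl k) a) h))"
proof -
  let ?r = "sz k"
  have b: "bl k < length ns" using assms bl_lo by auto
  have r: "?r > 0" by (rule sz_pos[OF b])
  have sq: "complex_of_real (sqrt (real ?r)) * complex_of_real (sqrt (real ?r)) = of_nat ?r"
    by (simp add: of_real_mult[symmetric] del: of_real_mult)
  have "magic_op k l h = (\<Sum>a<?r. scal (cnj (U (ix (bl k) a) k) * U (ix (bl k) a) l) (FP.reg (\<gamma>i (ix (bl k) a)) h))"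
    unfolding magic_op_def using assms by (intro sum_block b) (auto simp: U_eq)
  also have "\<dots> = (\<Sum>a<?r. scal ((cnj (root1 ?r) ^ lo k * root1 ?r ^ lo l) ^ a / of_nat ?r) (FP.reg (\<gamma> (bl k) a) h))"
  proof (rule sum.cong[OF HOL.refl])
    fix a assume "a \<in> {..<?r}"
    then have a: "ix (bl k) a < n" "bl (ix (bl k) a) = bl k" "lo (ix (bl k) a) = a"
      using ix[OF b] by auto
    have "cnj (U (ix (bl k) a) k) * U (ix (bl k) a) l
        = (cnj (root1 ?r) ^ lo k * root1 ?r ^ lo l) ^ a / of_nat ?r"
      using a assms by (simp add: U_eq sq power_mult_distrib power_mult[symmetric] mult.commute)
    then show "scal (cnj (U (ix (bl k) a) k) * U (ix (bl k) a) l) (FP.reg (\<gamma>i (ix (bl k) a)) h)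
        = scal ((cnj (root1 ?r) ^ lo k * root1 ?r ^ lo l) ^ a / of_nat ?r) (FP.reg (\<gamma> (bl k) a) h)"
      using a by simp
  qed
  also have "\<dots> = scal (1 / of_nat ?r) (\<Sum>a<?r. scal ((cnj (root1 ?r) ^ lo k * root1 ?r ^ lo l) ^ a) (FP.reg (\<gamma> (bl k) a) h))"
    by (simp add: scal_sum)
  finally show ?thesis .
qed

text \<open>The terms \<open>z\<^sup>a \<lambda>(\<gamma>\<^sub>a)\<close> form a representation of \<open>\<int>/r\<close>, and the operator is its average. The average
over a group is idempotent, since translating the summation index changes nothing.\<close>

lemma magic_op_idem: assumes kl: "k < n" "l < n" shows "magic_op k l (magic_op k l h) = magic_op k l h"
proof (cases "bl l = bl k")
  case True
  let ?r = "sz k" and ?b = "bl k"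
  define z where "z = cnj (root1 ?r) ^ lo k * root1 ?r ^ lo l"
  define F where "F a = scal (z ^ a) (FP.reg (\<gamma> ?b a) h)" for a
  have b: "?b < length ns" using kl bl_lo by auto
  have r: "?r > 0" by (rule sz_pos[OF b])
  have "(root1 ?r ^ m) ^ ?r = 1" for m
    using root1_r[OF r] by (metis power_mult mult.commute power_one)
  moreover have "(cnj (root1 ?r) ^ m) ^ ?r = 1" for m
    using root1_r[OF r] by (metis power_mult mult.commute power_one complex_cnj_power complex_cnj_one)
  \<comment> \<open>Both \<open>z\<^sup>a\<close> and \<open>\<gamma>\<^sub>a\<close> have period \<open>r\<close> in \<open>a\<close>.\<close>
  ultimately have "z ^ ?r = 1" by (simp add: z_def power_mult_distrib)
  then have per: "F (m + ?r) = F m" for m by (simp add: F_def power_add \<gamma>_mod)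
  have magic_op: "magic_op k l h = scal (1 / of_nat ?r) (\<Sum>a<?r. F a)"
    using magic_op_block[OF kl True] by (simp add: F_def z_def)
  have shift: "scal (z ^ a) (FP.reg (\<gamma> ?b a) (F c)) = F (a + c)" for a c
    using b by (simp add: F_def FP.reg_scal FP.reg_mult \<gamma>_mult power_add)
  have "magic_op k l (magic_op k l h) = scal (1 / of_nat ?r) (\<Sum>a<?r. scal (z ^ a) (FP.reg (\<gamma> ?b a) (magic_op k l h)))"
    using magic_op_block[OF kl True, of "magic_op k l h"] by (simp add: z_def)
  also have "\<dots> = scal (1 / of_nat ?r) (\<Sum>a<?r. scal (1 / of_nat ?r) (\<Sum>c<?r. F (a + c)))"
  proof -
    have "scal (z ^ a) (FP.reg (\<gamma> ?b a) (magic_op k l h)) = scal (1 / of_nat ?r) (\<Sum>c<?r. F (a + c))" for a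
    proof -
      have "scal (z ^ a) (FP.reg (\<gamma> ?b a) (magic_op k l h))
          = scal (1 / of_nat ?r) (\<Sum>c<?r. scal (z ^ a) (FP.reg (\<gamma> ?b a) (F c)))"
        unfolding magic_op by (simp add: FP.reg_scal FP.reg_sum scal_sum mult.commute)
      then show ?thesis by (simp only: shift)
    qed
    then show ?thesis by (simp only:)
  qed
  also have "\<dots> = scal (1 / of_nat ?r) (\<Sum>a<?r. magic_op k l h)"
    by (simp only: sum_shift_periodic[of F, OF per] magic_op)
  also have "\<dots> = magic_op k l h"
    using r by (auto simp: fun_ext_simps sum_fun_apply)
  finally show ?thesis .
qed (use kl magic_op_zero in simp)

lemma reg_first: assumes "k < n" shows "cnj (U (ix (bl k) 0) k) * of_real (sqrt (real (sz k))) = 1"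
    "FP.reg (\<gamma>i (ix (bl k) 0)) h = h" "ix (bl k) 0 < n"
proof -
  have b: "bl k < length ns" using assms bl_lo by auto
  have r: "sz k > 0" by (rule sz_pos[OF b])
  note i = ix[OF b r]
  show "cnj (U (ix (bl k) 0) k) * of_real (sqrt (real (sz k))) = 1"
    using i assms r by (simp add: U_eq)
  show "FP.reg (\<gamma>i (ix (bl k) 0)) h = h"
    using i b by (simp add: \<gamma>_zero FP.reg_one)
  show "ix (bl k) 0 < n" by (rule i)
qed

text \<open>Row sums of \<open>U\<close> vanish except at the first position of a block, where the group element is \<open>1\<close>.\<close>

lemma first_sum:
  assumes k: "k < n"
  shows "(\<Sum>i<n. cnj (U i k) * (\<Sum>l<n. U i l) * FP.reg (\<gamma>i i) h x) = h x"
proof -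
  let ?i = "ix (bl k) 0"
  have b: "bl k < length ns" using k bl_lo by auto
  note i = ix[OF b sz_pos[OF b]]
  have "(\<Sum>i<n. cnj (U i k) * (\<Sum>l<n. U i l) * FP.reg (\<gamma>i i) h x)
      = (\<Sum>j\<in>{?i}. cnj (U j k) * (\<Sum>l<n. U j l) * FP.reg (\<gamma>i j) h x)"
  proof (rule sum.mono_neutral_right)
    show "\<forall>j\<in>{..<n} - {?i}. cnj (U j k) * (\<Sum>l<n. U j l) * FP.reg (\<gamma>i j) h x = 0"
    proof
      fix j assume j: "j \<in> {..<n} - {?i}"
      then have "ix (bl j) (lo j) = j" using bl_lo(3)[of j] by simp
      then have "bl j \<noteq> bl k \<or> lo j \<noteq> 0" using j by (metis DiffD2 singletonI)
      then show "cnj (U j k) * (\<Sum>l<n. U j l) * FP.reg (\<gamma>i j) h x = 0"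
        using U_eq[of j k] row_sum[of j] j k by auto
    qed
  qed (use i in auto)
  also have "\<dots> = cnj (U ?i k) * of_real (sqrt (real (sz k))) * FP.reg (\<gamma>i ?i) h x"
    using i by (simp add: row_sum)
  finally show ?thesis using reg_first[OF k] by simp
qed

lemma magic_op_row_sum: assumes k: "k < n" shows "(\<Sum>l<n. magic_op k l h) = h"
proof
  fix x
  have "(\<Sum>l<n. magic_op k l h) x = (\<Sum>l<n. \<Sum>i<n. cnj (U i k) * U i l * FP.reg (\<gamma>i i) h x)"
    by (simp add: sum_fun_apply magic_op_def scal_apply)
  also have "\<dots> = (\<Sum>i<n. cnj (U i k) * (\<Sum>l<n. U i l) * FP.reg (\<gamma>i i) h x)"
    by (subst sum.swap) (simp add: sum_distrib_left sum_distrib_right)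
  finally show "(\<Sum>l<n. magic_op k l h) x = h x" by (simp only: first_sum[OF k])
qed

lemma magic_op_col_sum: assumes l: "l < n" shows "(\<Sum>k<n. magic_op k l h) = h"
proof
  fix x
  have real: "cnj (\<Sum>k<n. U i k) = (\<Sum>k<n. U i k)" "cnj (U i l) * (\<Sum>k<n. U i k) = U i l * (\<Sum>k<n. U i k)"
    if "i < n" for i
    using that l row_sum[OF that] by (auto simp: U_eq)
  have "(\<Sum>k<n. magic_op k l h) x = (\<Sum>k<n. \<Sum>i<n. cnj (U i k) * U i l * FP.reg (\<gamma>i i) h x)"
    by (simp add: sum_fun_apply magic_op_def scal_apply)
  also have "\<dots> = (\<Sum>i<n. U i l * cnj (\<Sum>k<n. U i k) * FP.reg (\<gamma>i i) h x)"
    by (subst sum.swap) (simp add: sum_distrib_left sum_distrib_right mult.commute)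
  also have "\<dots> = (\<Sum>i<n. cnj (U i l) * (\<Sum>k<n. U i k) * FP.reg (\<gamma>i i) h x)"
    by (intro sum.cong HOL.refl) (simp only: real lessThan_iff)
  finally show "(\<Sum>k<n. magic_op k l h) x = h x" by (simp only: first_sum[OF l])
qed

text \<open>\<open>U U\<^sup>* diag(\<lambda>(\<gamma>)) U U\<^sup>* = diag(\<lambda>(\<gamma>))\<close>, entry by entry.\<close>

lemma magic_op_conjugate: assumes ij: "i < n" "j < n"
  shows "(\<Sum>k<n. \<Sum>l<n. scal (U i k * cnj (U j l)) (magic_op k l h)) = (if i = j then FP.reg (\<gamma>i i) h else 0)"
proof
  fix x
  define y where "y m = FP.reg (\<gamma>i m) h x" for m
  have "(\<Sum>k<n. \<Sum>l<n. scal (U i k * cnj (U j l)) (magic_op k l h)) x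
      = (\<Sum>k<n. \<Sum>l<n. \<Sum>m<n. (U i k * cnj (U m k)) * (U m l * cnj (U j l)) * y m)"
    by (simp add: sum_fun_apply magic_op_def scal_apply y_def sum_distrib_left mult_ac)
  also have "\<dots> = (\<Sum>k<n. \<Sum>m<n. \<Sum>l<n. (U i k * cnj (U m k)) * (U m l * cnj (U j l)) * y m)"
    by (intro sum.cong HOL.refl sum.swap)
  also have "\<dots> = (\<Sum>m<n. \<Sum>k<n. \<Sum>l<n. (U i k * cnj (U m k)) * (U m l * cnj (U j l)) * y m)"
    by (rule sum.swap)
  also have "\<dots> = (\<Sum>m<n. (\<Sum>k<n. U i k * cnj (U m k)) * (\<Sum>l<n. U m l * cnj (U j l)) * y m)"
    by (simp only: sum_product) (simp only: sum_distrib_right)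
  also have "\<dots> = (\<Sum>m<n. if m = i then (if i = j then y m else 0) else 0)"
    using ij by (intro sum.cong) (auto simp: rows_orthonormal)
  also have "\<dots> = (if i = j then y i else 0)" using ij by simp
  finally show "(\<Sum>k<n. \<Sum>l<n. scal (U i k * cnj (U j l)) (magic_op k l h)) x = (if i = j then FP.reg (\<gamma>i i) h else 0) x"
    by (simp add: y_def zero_fun_apply)
qed

end

section \<open>The isomorphism\<close>

context fourier_blocks
begin

text \<open>A generator and its adjoint letter act by the same operator, since the entries are self-adjoint.\<close>

definition opr :: "(nat \<times> nat) \<times> bool \<Rightarrow> ((nat \<times> int) list set \<Rightarrow> complex) \<Rightarrow> (nat \<times> int) list set \<Rightarrow> complex"
  where "opr l h = (if fst l \<in> X then magic_op (fst (fst l)) (snd (fst l)) h else 0)"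

definition opr_bound :: "(nat \<times> nat) \<times> bool \<Rightarrow> real"
  where "opr_bound l = (\<Sum>i<n. cmod (cnj (U i (fst (fst l))) * U i (snd (fst l))))"

sublocale lreg: star_rep opr opr_bound
proof
  fix h k :: "(nat \<times> int) list set \<Rightarrow> complex" and l x s c
  show "h \<in> fins \<Longrightarrow> opr l h \<in> fins" by (simp add: opr_def magic_op_fins)
  show "opr l (h + k) = opr l h + opr l k" by (simp add: opr_def magic_op_add)
  show "opr l (scal c h) = scal c (opr l h)" by (simp add: opr_def magic_op_scal)
  show "0 \<le> opr_bound l" by (simp add: opr_bound_def sum_nonneg)
  show "nrm (opr l h) \<le> opr_bound l * nrm h" if "h \<in> fins"
    using magic_op_bound[OF that] by (simp add: opr_def opr_bound_def sum_nonneg)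
  show "ip (opr (x, s) h) k = ip h (opr (x, \<not> s) k)" if "h \<in> fins" "k \<in> fins"
  proof (cases "x \<in> X")
    case True
    then show ?thesis using that by (auto simp: opr_def magic_op_adj)
  next
    case False
    then show ?thesis by (auto simp: opr_def ip_def zero_fun_apply)
  qed
qed

lemma rep_gen: "k < n \<Longrightarrow> l < n \<Longrightarrow> lreg.rep (gen k l) h = magic_op k l h"
  by (simp add: free_gen_single lreg.rep_single lreg.opw_simps opr_def)

lemma rep_gen_adj: "k < n \<Longrightarrow> l < n \<Longrightarrow> lreg.rep (adj (gen k l)) h = magic_op k l h"
  by (simp add: gen_adj lreg.rep_single lreg.opw_simps opr_def)

lemma opnorm_magic: "\<forall>r\<in>magic_relations n. lreg.opnorm r = 0"
proof -
  have one: "lreg.rep (single []) h = h" for h by (simp add: lreg.rep_single lreg.opw_simps)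
  have g: "gen k l \<in> polys X" if "k < n" "l < n" for k l using that by simp
  have "lreg.rep (gen k l \<star> gen k l - gen k l) h = 0" if "k < n" "l < n" for k l h
    using g[OF that] that by (simp add: lreg.rep_diff[of _ X] lreg.rep_conv[of _ X] rep_gen magic_op_idem)
  moreover have "lreg.rep (adj (gen k l) - gen k l) h = 0" if "k < n" "l < n" for k l h
    using g[OF that] that by (simp add: lreg.rep_diff[of _ X] rep_gen rep_gen_adj)
  moreover have "lreg.rep ((\<Sum>l<n. gen k l) - single []) h = 0" if "k < n" for k h
  proof -
    have "lreg.rep (\<Sum>l<n. gen k l) h = (\<Sum>l<n. magic_op k l h)"
      using that by (subst lreg.rep_sum[of _ _ X]) (auto simp: rep_gen)
    then show ?thesis using that by (simp add: lreg.rep_diff[of _ X] magic_op_row_sum one)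
  qed
  moreover have "lreg.rep ((\<Sum>k<n. gen k l) - single []) h = 0" if "l < n" for l h
  proof -
    have "lreg.rep (\<Sum>k<n. gen k l) h = (\<Sum>k<n. magic_op k l h)"
      using that by (subst lreg.rep_sum[of _ _ X]) (auto simp: rep_gen)
    then show ?thesis using that by (simp add: lreg.rep_diff[of _ X] magic_op_col_sum one)
  qed
  ultimately show ?thesis
    unfolding ball_magic_relations lreg.opnorm_eq_0_iff by blast
qed

lemma rep_spun_poly: assumes "i < n" "j < n" shows "lreg.rep (spun_poly i j) h = (if i = j then FP.reg (\<gamma>i i) h else 0)"
proof -
  have "lreg.rep (spun_poly i j) h = (\<Sum>k<n. lreg.rep (\<Sum>l<n. scal (U i k * cnj (U j l)) (gen k l)) h)"
    unfolding spun_poly_def by (rule lreg.rep_sum[of _ _ X]) (auto intro!: polys_sum polys_scal polys_gen)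
  also have "\<dots> = (\<Sum>k<n. \<Sum>l<n. lreg.rep (scal (U i k * cnj (U j l)) (gen k l)) h)"
    by (intro sum.cong HOL.refl lreg.rep_sum[of _ _ X] polys_scal polys_gen) auto
  also have "\<dots> = (\<Sum>k<n. \<Sum>l<n. scal (U i k * cnj (U j l)) (magic_op k l h))"
    by (intro sum.cong HOL.refl) (simp add: lreg.rep_scal rep_gen)
  finally show ?thesis by (simp only: magic_op_conjugate[OF assms])
qed

text \<open>The operator norm of the regular representation kills the magic relations and the off-diagonal entries
of \<open>v\<close>. By the former it is dominated by the universal C*-seminorm, and then by the latter it vanishes on
the whole diagonal ideal.\<close>

lemma opnorm_K: assumes "a \<in> quot.K" shows "lreg.opnorm a = 0"
proof -
  have adm: "magic.adm n lreg.opnorm"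
    by (simp add: magic.adm_def lreg.opnorm_cstar_seminorm opnorm_magic)
  have "lreg.opnorm (spun_poly i j) = 0" if "i < n" "j < n" "i \<noteq> j" for i j
    using that by (simp add: lreg.opnorm_eq_0_iff rep_spun_poly)
  then have S: "{magic.emb n (spun_poly i j) |i j. i < n \<and> j < n \<and> i \<noteq> j} \<subseteq> magic.emb n ` {a \<in> polys X. lreg.opnorm a = 0}"
    by auto
  have a: "a \<in> polys X" "magic.emb n a \<in> I" using assms by (simp_all add: quot.K_def)
  show ?thesis
    by (rule magic.emb_closed_ideal_gen[OF lreg.opnorm_cstar_seminorm magic.adm_le_P[OF adm] S a(1) a(2)[unfolded I_eq]])
qed

text \<open>A lift to the free algebra of the value of a word in the quotient. It is mapped to both sides that are
compared: to the diagonal quotient, and to operators on functions on the free product.\<close>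

definition word_poly :: "(nat \<times> int) list \<Rightarrow> (nat \<times> nat) star_poly"
  where "word_poly w = foldr (\<lambda>(b, x) a. spun_poly (ix b (nat x)) (ix b (nat x)) \<star> a) w (single [])"

lemma word_poly_simps:
  "word_poly [] = single []" "word_poly ((b, x) # w) = spun_poly (ix b (nat x)) (ix b (nat x)) \<star> word_poly w"
  by (simp_all add: word_poly_def)

lemma word_poly_polys [simp]: "word_poly w \<in> polys X"
  by (induction w) (auto simp: word_poly_simps)

lemma letter:
  assumes "b < length ns" "x \<in> carrier (Gs b)"
  shows "ix b (nat x) < n" "\<gamma>i (ix b (nat x)) = fam.cls [(b, x)]" "quot.\<theta> (spun_poly (ix b (nat x)) (ix b (nat x))) = grp_hom b x"
proof -
  have x: "0 \<le> x" "x < int (ns ! b)" using assms sz_pos[of b] by (auto simp: carrier_integer_mod_group split: if_splits)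
  then have i: "ix b (nat x) < n" "bl (ix b (nat x)) = b" "lo (ix b (nat x)) = nat x"
    using ix[OF assms(1), of "nat x"] by auto
  show "ix b (nat x) < n" by (rule i)
  show "\<gamma>i (ix b (nat x)) = fam.cls [(b, x)]" using i x by (simp add: \<gamma>_def)
  show "quot.\<theta> (spun_poly (ix b (nat x)) (ix b (nat x))) = grp_hom b x"
    using diag_gen_grp_gen[OF i(1)] i by (simp add: diag_gen_eq grp_hom_def)
qed

lemma rep_word_poly: "w \<in> fam.W \<Longrightarrow> lreg.rep (word_poly w) h = FP.reg (fam.cls w) h"
proof (induction w)
  case Nil
  show ?case by (simp add: word_poly_simps lreg.rep_single lreg.opw_simps fam.FP_one[symmetric] FP.reg_one)
next
  case (Cons l w)
  obtain b x where l: "l = (b, x)" by (cases l)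
  have bx: "b < length ns" "x \<in> carrier (Gs b)" and w: "w \<in> fam.W" using Cons.prems by (auto simp: l)
  have c: "fam.cls [(b, x)] \<in> carrier fam.FP" "fam.cls w \<in> carrier fam.FP"
    unfolding fam.carrier_FP using bx w by (auto intro!: imageI)
  have "lreg.rep (word_poly (l # w)) h = FP.reg (fam.cls [(b, x)]) (FP.reg (fam.cls w) h)"
    using Cons.IH[OF w] letter[OF bx] by (simp add: l word_poly_simps lreg.rep_conv[of _ X] rep_spun_poly)
  also have "\<dots> = FP.reg (fam.cls (l # w)) h"
    using c bx w fam.FP_mult[of "[(b, x)]" w] by (simp add: FP.reg_mult l)
  finally show ?case .
qed

abbreviation H where "H \<equiv> units_of quot.Q"

lemma group_H: "group H"
  using quot.ring_Q by (intro monoid.units_group) (simp add: ring_def)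

lemma grp_hom_hom': "b \<in> {..<length ns} \<Longrightarrow> grp_hom b \<in> hom (Gs b) H"
  by (simp add: grp_hom_hom)

lemma lift_word_poly: "w \<in> fam.W \<Longrightarrow> fp_lift H grp_hom w = quot.\<theta> (word_poly w)"
proof (induction w)
  case Nil
  show ?case by (simp add: word_poly_simps quot.\<theta>_one units_of_one)
next
  case (Cons l w)
  obtain b x where l: "l = (b, x)" by (cases l)
  have bx: "b < length ns" "x \<in> carrier (Gs b)" and w: "w \<in> fam.W" using Cons.prems by (auto simp: l)
  show ?case using Cons.IH[OF w] letter(3)[OF bx]
    by (simp add: l word_poly_simps quot.\<theta>_mult units_of_mult)
qed

text \<open>Injectivity: if a word is \<open>1\<close> in the quotient, translation by its class fixes the point mass at the
unit of the free product, so the class is the unit.\<close>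

theorem Gamma_iso: "Gamma A (qperm_gen n) n Umat \<cong> fam.FP"
proof -
  have inj: "fp_eq {..<length ns} Gs w []" if w: "w \<in> fam.W" and one: "fp_lift H grp_hom w = \<one>\<^bsub>H\<^esub>" for w
  proof -
    have "quot.\<theta> (word_poly w) = quot.\<theta> (single [])"
      using one by (simp add: lift_word_poly[OF w] quot.\<theta>_one units_of_one)
    then have "word_poly w - single [] \<in> quot.K" by (simp add: quot.\<theta>_eq_iff)
    then have zero: "\<forall>h\<in>fins. lreg.rep (word_poly w - single []) h = 0"
      using opnorm_K by (simp add: lreg.opnorm_eq_0_iff)
    let ?h = "single (fam.cls [])"
    have "?h \<in> fins" by (simp add: fins_def single_def)
    then have "lreg.rep (word_poly w) ?h - lreg.rep (single []) ?h = 0"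
      using zero by (simp add: lreg.rep_diff[of _ X])
    then have "FP.reg (fam.cls w) ?h = ?h"
      using w by (simp add: rep_word_poly lreg.rep_single lreg.opw_simps)
    moreover have "FP.reg (fam.cls w) ?h = single (fam.cls w)"
    proof -
      have "fam.cls w \<in> carrier fam.FP" "fam.cls [] \<in> carrier fam.FP"
        unfolding fam.carrier_FP using w by auto
      then show ?thesis using w fam.FP_mult[of w "[]"] by (simp add: FP.reg_single)
    qed
    ultimately have "single (fam.cls w) (fam.cls w) = ?h (fam.cls w)" by simp
    then have "fam.cls w = fam.cls []" by (simp add: single_def split: if_splits)
    then show ?thesis using w by (simp add: fam.cls_eq_iff)
  qed
  have "fam.FP \<cong> subgroup_generated H (\<Union>b\<in>{..<length ns}. grp_hom b ` carrier (Gs b))"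
    by (rule fam.free_product_iso_generated[OF group_H grp_hom_hom' inj])
  also have "subgroup_generated H (\<Union>b\<in>{..<length ns}. grp_hom b ` carrier (Gs b)) = Gamma A (qperm_gen n) n Umat"
    by (simp add: Gamma_def diag_quot_def generators_eq[symmetric] C_qperm_eq)
  finally show ?thesis by (rule group.iso_sym[OF fam.group_FP])
qed

end

theorem proposition5p4:
  fixes ns :: "nat list" and n :: nat and U :: "complex mat"
  assumes "ns \<noteq> []"
    and "\<forall>m\<in>set ns. 1 \<le> m"
    and "n = sum_list ns"
    and "U = diag_block_mat (map fourier_mat ns)"
  shows "Gamma (C_qperm n) (qperm_gen n) n U
           \<cong> free_product {..<length ns} (\<lambda>i. integer_mod_group (ns ! i))"
proof -
  interpret fourier_blocks ns by unfold_locales (rule assms(2))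
  show ?thesis using Gamma_iso by (simp add: n_def Umat_def assms(3,4))
qed

end
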